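(* Assume $K_0=\sum_{j\ge1}\lambda_jq_j<\infty$ and let $\{\mathbf u^l\}_{l=0}^N$ be the fully implicit time Euler scheme with initial condition $u_0$. Let $\tilde\alpha_0=\nu/\mathrm{Tr}(Q)$. (i) Let $u_0\in V$ be deterministic. For every $0<\alpha<\tilde\alpha_0$ there exist $C_1(\alpha)<\infty$ and $N_0$ such that for all $N\ge N_0$, $\mathbb E\big[\exp\big(\alpha\max_{0\le l\le N}|A^{1/2}\mathbf u^l|_{\mathbb L^2}^2\big)\big]\le C_1(\alpha)$; and for every $0<\beta<\tilde\alpha_0/2$ there exist $C_2(\beta)<\infty$ and $N_0$ such that for all $N\ge N_0$, $$\mathbb E\Big[\exp\Big(\beta\max_{0\le n\le N}\Big[|A^{\frac12}\mathbf u^n|_{\mathbb L^2}^2+\nu\frac TN\sum_{l=1}^n|A\mathbf u^l|_{\mathbb L^2}^2\Big]\Big)\Big]\le C_2(\beta).$$ (ii) Let $u_0$ be a $V$-valued $\mathcal F_0$-measurable random variable with $\mathbb E[\exp(\gamma_0|A^{1/2}u_0|_{\mathbb L^2}^2)]<\infty$ for some $\gamma_0>0$. Set $\tilde\beta_0=\tilde\alpha_0\frac{\gamma_0}{\gamma_0+\tilde\alpha_0}$ and $\tilde\beta_1=\tilde\alpha_0\frac{\gamma_0}{2\gamma_0+\tilde\alpha_0}$. Then for $0<\alpha<\tilde\beta_0$ the first bound of (i) holds for $N$ large enough, and for $0<\beta<\tilde\beta_1$ the second bound of (i) holds for $N$ large enough (with constants independent of $N$).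
   Context: Setting: $L>0$, $D=[0,L]^2$ periodic, $\nu>0$, $T>0$. $\mathbb L^2=L^2(D)^2$; $\mathbb L^2_{per}$ periodic mean-zero fields; $H=\{u\in\mathbb L^2_{per}:\operatorname{div}u=0\}$, inner product $(\cdot,\cdot)$, norm $|\cdot|_{\mathbb L^2}$; $V=H\cap W^{1,2}(D)^2$ with norm $\|\cdot\|_V$. $A=-\Delta$ with domain $W^{2,2}(D)^2\cap H$; eigenvalues $0<\lambda_1\le\lambda_2\le\dots$ with eigenfunctions $\zeta_j$ forming an orthonormal basis of $H$. $\langle B(u_1,u_2),u_3\rangle=\int_D(u_1\cdot\nabla u_2)\cdot u_3dx$. Noise: $W(t)=\sum_j\sqrt{q_j}\beta_j(t)\zeta_j$ on $(\Omega,\mathcal F,(\mathcal F_t),\mathbb P)$, $q_j>0$, $\beta_j$ independent standard Brownian motions, $\mathrm{Tr}(Q)=\sum_jq_j$. Time scheme: $t_l=lT/N$, $\Delta_lW=W(t_l)-W(t_{l-1})$, $\mathbf u^0=u_0$; for $l=1,\dots,N$, $\mathbf u^l$ is the (known to exist, unique) $\mathcal F_{t_l}$-measurable $V$-valued random variable with $(\mathbf u^l-\mathbf u^{l-1},\phi)+\frac TN[\nu(A^{1/2}\mathbf u^l,A^{1/2}\phi)+\langle B(\mathbf u^l,\mathbf u^l),\phi\rangle]=(\Delta_lW,\phi)$ a.s. for all $\phi\in V$; moreover $\mathbf u^l\in\mathrm{Dom}(A)$ a.s. *)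

theory Defs
  imports "HOL-Probability.Probability"
begin

type_synonym pt = "real^2"
type_synonym field = "real^2 \<Rightarrow> real^2"

definition Dom :: "real \<Rightarrow> pt set" where
  "Dom L = {x. \<forall>i. 0 \<le> x $ i \<and> x $ i \<le> L}"

definition periodic :: "real \<Rightarrow> (pt \<Rightarrow> 'b) \<Rightarrow> bool" where
  "periodic L f \<longleftrightarrow> (\<forall>x i. f (x + L *\<^sub>R axis i 1) = f x)"

definition l2inner :: "real \<Rightarrow> field \<Rightarrow> field \<Rightarrow> real" where
  "l2inner L u v = (LINT x:Dom L|lborel. u x \<bullet> v x)"

definition sq_int :: "real \<Rightarrow> (pt \<Rightarrow> real) \<Rightarrow> bool" where
  "sq_int L f \<longleftrightarrow> f \<in> borel_measurable lborel \<and> set_integrable lborel (Dom L) (\<lambda>x. (f x)\<^sup>2)"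

definition L2per :: "real \<Rightarrow> field \<Rightarrow> bool" where
  "L2per L u \<longleftrightarrow> periodic L u \<and> u \<in> borel_measurable lborel
     \<and> set_integrable lborel (Dom L) (\<lambda>x. (norm (u x))\<^sup>2)
     \<and> (LINT x:Dom L|lborel. u x) = 0"

definition pd :: "2 \<Rightarrow> (pt \<Rightarrow> real) \<Rightarrow> pt \<Rightarrow> real" where
  "pd i \<phi> x = frechet_derivative \<phi> (at x) (axis i 1)"

primrec Ck :: "nat \<Rightarrow> (pt \<Rightarrow> real) \<Rightarrow> bool" where
  "Ck 0 \<phi> \<longleftrightarrow> continuous_on UNIV \<phi>"
| "Ck (Suc n) \<phi> \<longleftrightarrow> (\<forall>x. \<phi> differentiable (at x)) \<and> (\<forall>i. Ck n (pd i \<phi>))"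

definition test :: "real \<Rightarrow> (pt \<Rightarrow> real) \<Rightarrow> bool" where
  "test L \<phi> \<longleftrightarrow> periodic L \<phi> \<and> (\<forall>n. Ck n \<phi>)"

definition weak_pd :: "real \<Rightarrow> 2 \<Rightarrow> (pt \<Rightarrow> real) \<Rightarrow> (pt \<Rightarrow> real) \<Rightarrow> bool" where
  "weak_pd L i f g \<longleftrightarrow> (\<forall>\<phi>. test L \<phi> \<longrightarrow>
     (LINT x:Dom L|lborel. f x * pd i \<phi> x) = - (LINT x:Dom L|lborel. g x * \<phi> x))"

definition W1s :: "real \<Rightarrow> (pt \<Rightarrow> real) \<Rightarrow> bool" where
  "W1s L f \<longleftrightarrow> sq_int L f \<and> (\<forall>i. \<exists>g. sq_int L g \<and> weak_pd L i f g)"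

definition W2s :: "real \<Rightarrow> (pt \<Rightarrow> real) \<Rightarrow> bool" where
  "W2s L f \<longleftrightarrow> sq_int L f \<and> (\<forall>i. \<exists>g. W1s L g \<and> weak_pd L i f g)"

definition W12 :: "real \<Rightarrow> field \<Rightarrow> bool" where
  "W12 L u \<longleftrightarrow> (\<forall>k. W1s L (\<lambda>x. u x $ k))"

definition W22 :: "real \<Rightarrow> field \<Rightarrow> bool" where
  "W22 L u \<longleftrightarrow> (\<forall>k. W2s L (\<lambda>x. u x $ k))"

text \<open>the (a.e. unique) weak derivative d_i u_k\<close>
definition wgrad :: "real \<Rightarrow> field \<Rightarrow> 2 \<Rightarrow> 2 \<Rightarrow> pt \<Rightarrow> real" where
  "wgrad L u k i = (SOME g. sq_int L g \<and> weak_pd L i (\<lambda>x. u x $ k) g)"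

definition Hsp :: "real \<Rightarrow> field \<Rightarrow> bool" where
  "Hsp L u \<longleftrightarrow> L2per L u \<and>
     (\<forall>\<phi>. test L \<phi> \<longrightarrow> (LINT x:Dom L|lborel. (\<Sum>i\<in>UNIV. u x $ i * pd i \<phi> x)) = 0)"

definition Vsp :: "real \<Rightarrow> field \<Rightarrow> bool" where
  "Vsp L u \<longleftrightarrow> Hsp L u \<and> W12 L u"

definition DomA :: "real \<Rightarrow> field \<Rightarrow> bool" where
  "DomA L u \<longleftrightarrow> Hsp L u \<and> W22 L u"

definition eigenfun :: "real \<Rightarrow> field \<Rightarrow> real \<Rightarrow> bool" where
  "eigenfun L u c \<longleftrightarrow> DomA L u \<and> (\<forall>\<phi> k. test L \<phi> \<longrightarrow>
     (LINT x:Dom L|lborel. u x $ k * (\<Sum>i\<in>UNIV. pd i (pd i \<phi>) x))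
       = - c * (LINT x:Dom L|lborel. u x $ k * \<phi> x))"

definition Bform :: "real \<Rightarrow> field \<Rightarrow> field \<Rightarrow> field \<Rightarrow> real" where
  "Bform L u v w = (LINT x:Dom L|lborel.
     (\<Sum>k\<in>UNIV. (\<Sum>i\<in>UNIV. u x $ i * wgrad L v k i x) * w x $ k))"

definition a12inner :: "real \<Rightarrow> (nat \<Rightarrow> field) \<Rightarrow> (nat \<Rightarrow> real) \<Rightarrow> field \<Rightarrow> field \<Rightarrow> real" where
  "a12inner L \<zeta> lam u v = (\<Sum>j. lam j * l2inner L u (\<zeta> j) * l2inner L v (\<zeta> j))"

definition a12sq :: "real \<Rightarrow> (nat \<Rightarrow> field) \<Rightarrow> (nat \<Rightarrow> real) \<Rightarrow> field \<Rightarrow> real" where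
  "a12sq L \<zeta> lam u = (\<Sum>j. lam j * (l2inner L u (\<zeta> j))\<^sup>2)"

definition Asq :: "real \<Rightarrow> (nat \<Rightarrow> field) \<Rightarrow> (nat \<Rightarrow> real) \<Rightarrow> field \<Rightarrow> real" where
  "Asq L \<zeta> lam u = (\<Sum>j. (lam j)\<^sup>2 * (l2inner L u (\<zeta> j))\<^sup>2)"

definition eigenbasis :: "real \<Rightarrow> (nat \<Rightarrow> field) \<Rightarrow> (nat \<Rightarrow> real) \<Rightarrow> bool" where
  "eigenbasis L \<zeta> lam \<longleftrightarrow>
     0 < lam 0 \<and> mono lam \<and>
     (\<forall>j. eigenfun L (\<zeta> j) (lam j)) \<and>
     (\<forall>i j. l2inner L (\<zeta> i) (\<zeta> j) = (if i = j then 1 else 0)) \<and>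
     (\<forall>u. Hsp L u \<and> (\<forall>j. l2inner L u (\<zeta> j) = 0) \<longrightarrow> l2inner L u u = 0)"

definition indep_BMs :: "'a measure \<Rightarrow> (real \<Rightarrow> 'a measure) \<Rightarrow> real \<Rightarrow> (nat \<Rightarrow> real \<Rightarrow> 'a \<Rightarrow> real) \<Rightarrow> bool" where
  "indep_BMs M F T b \<longleftrightarrow>
     (\<forall>j. AE \<omega> in M. b j 0 \<omega> = 0) \<and>
     (\<forall>j. AE \<omega> in M. continuous_on {0..T} (\<lambda>t. b j t \<omega>)) \<and>
     (\<forall>j t. 0 \<le> t \<and> t \<le> T \<longrightarrow> b j t \<in> borel_measurable (F t)) \<and>
     (\<forall>s t. 0 \<le> s \<and> s < t \<and> t \<le> T \<longrightarrow>
        prob_space.indep_sets M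
          (\<lambda>k. case k of None \<Rightarrow> sets (F s)
                | Some j \<Rightarrow> {(\<lambda>\<omega>. b j t \<omega> - b j s \<omega>) -` A \<inter> space M | A. A \<in> sets borel}) UNIV
        \<and> (\<forall>j. distributed M lborel (\<lambda>\<omega>. b j t \<omega> - b j s \<omega>)
                (\<lambda>x. ennreal (normal_density 0 (sqrt (t - s)) x))))"

text \<open>(W(t) - W(s), phi) for W = sum_j sqrt(q_j) b_j zeta_j\<close>
definition noise_inner :: "real \<Rightarrow> (nat \<Rightarrow> field) \<Rightarrow> (nat \<Rightarrow> real) \<Rightarrow> (nat \<Rightarrow> real \<Rightarrow> 'a \<Rightarrow> real)
    \<Rightarrow> real \<Rightarrow> real \<Rightarrow> field \<Rightarrow> 'a \<Rightarrow> real" where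
  "noise_inner L \<zeta> q b s t \<phi> \<omega> = (\<Sum>j. sqrt (q j) * (b j t \<omega> - b j s \<omega>) * l2inner L (\<zeta> j) \<phi>)"

definition tgrid :: "real \<Rightarrow> nat \<Rightarrow> nat \<Rightarrow> real" where
  "tgrid T N l = real l * T / real N"

definition Hmeas :: "real \<Rightarrow> 'a measure \<Rightarrow> ('a \<Rightarrow> field) \<Rightarrow> bool" where
  "Hmeas L G u \<longleftrightarrow> (\<forall>\<phi>. Hsp L \<phi> \<longrightarrow> (\<lambda>\<omega>. l2inner L (u \<omega>) \<phi>) \<in> borel_measurable G)"

definition euler_scheme :: "real \<Rightarrow> real \<Rightarrow> real \<Rightarrow> nat \<Rightarrow> 'a measure \<Rightarrow> (real \<Rightarrow> 'a measure)
    \<Rightarrow> (nat \<Rightarrow> real \<Rightarrow> 'a \<Rightarrow> real) \<Rightarrow> (nat \<Rightarrow> real) \<Rightarrow> (nat \<Rightarrow> field) \<Rightarrow> (nat \<Rightarrow> real)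
    \<Rightarrow> ('a \<Rightarrow> field) \<Rightarrow> (nat \<Rightarrow> 'a \<Rightarrow> field) \<Rightarrow> bool" where
  "euler_scheme L \<nu> T N M F b q \<zeta> lam u0 u \<longleftrightarrow>
     (\<forall>\<omega>\<in>space M. u 0 \<omega> = u0 \<omega>) \<and>
     (\<forall>l\<in>{1..N}.
        (\<forall>\<omega>\<in>space M. Vsp L (u l \<omega>)) \<and>
        Hmeas L (F (tgrid T N l)) (u l) \<and>
        (AE \<omega> in M. DomA L (u l \<omega>)) \<and>
        (AE \<omega> in M. \<forall>\<phi>. Vsp L \<phi> \<longrightarrow>
            l2inner L (u l \<omega> - u (l - 1) \<omega>) \<phi>
            + T / real N * (\<nu> * a12inner L \<zeta> lam (u l \<omega>) \<phi> + Bform L (u l \<omega>) (u l \<omega>) \<phi>)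
            = noise_inner L \<zeta> q b (tgrid T N (l - 1)) (tgrid T N l) \<phi> \<omega>))"

definition expmom1 :: "real \<Rightarrow> (nat \<Rightarrow> field) \<Rightarrow> (nat \<Rightarrow> real) \<Rightarrow> 'a measure \<Rightarrow> nat
    \<Rightarrow> (nat \<Rightarrow> 'a \<Rightarrow> field) \<Rightarrow> real \<Rightarrow> ennreal" where
  "expmom1 L \<zeta> lam M N u \<alpha> =
     (\<integral>\<^sup>+\<omega>. ennreal (exp (\<alpha> * Max ((\<lambda>l. a12sq L \<zeta> lam (u l \<omega>)) ` {0..N}))) \<partial>M)"

definition expmom2 :: "real \<Rightarrow> real \<Rightarrow> real \<Rightarrow> (nat \<Rightarrow> field) \<Rightarrow> (nat \<Rightarrow> real) \<Rightarrow> 'a measure \<Rightarrow> nat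
    \<Rightarrow> (nat \<Rightarrow> 'a \<Rightarrow> field) \<Rightarrow> real \<Rightarrow> ennreal" where
  "expmom2 L \<nu> T \<zeta> lam M N u \<beta> =
     (\<integral>\<^sup>+\<omega>. ennreal (exp (\<beta> * Max ((\<lambda>n. a12sq L \<zeta> lam (u n \<omega>)
          + \<nu> * (T / real N) * (\<Sum>l\<in>{1..n}. Asq L \<zeta> lam (u l \<omega>))) ` {0..N}))) \<partial>M)"

end

theory Submission
  imports Defs
begin

text \<open>The field is expanded in the eigenbasis, which a Fourier argument shows to consist of trigonometric
  polynomials: $\zeta_j$ has all its frequencies on the sphere $|k|^2 = \lambda_j$, so that spectral sums over
  $\lambda_j \le r$ are Fourier truncations. Since
  $(u \cdot \nabla u) \cdot \Delta u$ is a divergence for smooth divergence-free $u$ in two dimensions, and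
  Fourier truncations of $u \in W^{2,2}$ converge uniformly, the nonlinearity drops out of the balance for
  $X_l = |A^{1/2} u^l|^2$ and $Y_l = |A u^l|^2$, and with $h = T/N$ one gets
  $X_l + 2 \nu h Y_l \le X_{l-1} + R_l$ with
  $R_l = 2 (A^{1/2} \Delta_l W, A^{1/2} u^{l-1}) + |A^{1/2} \Delta_l W|^2$.
  Conditionally on the past, $R_l$ is a sum of independent quadratic functions of Gaussians, and its exponential
  moment of order $\mu$ is at most $\exp(2 \mu K_0 h + 2 \mu^2 h (1 + O(h)) \mathrm{Tr}(Q) Y_{l-1})$. For
  $\mu < \nu / \mathrm{Tr}(Q)$ and small $h$ the dissipation $2 \nu h Y_{l-1}$ absorbs the last term, so
  $\exp(\mu (X_l + 2 \nu h Y_l) - 2 \mu K_0 l h)$ is essentially a supermartingale, and its maximal inequality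
  gives all exponential moments of order below $\mu$; keeping half of the dissipation for the sum of the $Y_l$
  halves the threshold. A convex combination of exponents, as in Hoelder's inequality, accounts for a random
  initial value, and a deterministic one is the limit of large $\gamma_0$.\<close>

section \<open>The square-integrable functions on the periodicity cell\<close>

text \<open>The basis is given only through an eigenvalue equation tested with smooth periodic
  functions. Growth of the eigenvalues, boundedness of W^{2,2} functions and the spectral calculus
  of A are therefore all read off from Fourier coefficients. Implicitness makes R_l depend on
  u^{l-1} alone: pairing with A u^l produces |A^{1/2}(u^l - u^{l-1})|^2, which absorbs the
  correlation of the noise increment with u^l - u^{l-1} at the price of the squared increment. The
  variance of the linear part of R_l is then paid one step late, by the dissipation of the preceding
  step. In the first step there is no such dissipation, since u^0 lies only in V; there a small
  multiple of |A^{1/2} u^0|^2 suffices once N is large. All thresholds come from one condition. With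
  a0 = \<nu>/Tr(Q) and \<gamma> the order of the exponential moment of the initial value, it reads
  \<alpha>/a0 + \<alpha>/\<gamma> < 1 for the first bound and 2\<beta>/a0 + \<beta>/\<gamma> < 1 for
  the second; solving for \<alpha> and \<beta> gives the stated fractions.\<close>

definition cell :: "real \<Rightarrow> pt measure" where
  "cell L = restrict_space lborel (Dom L)"

definition ip :: "real \<Rightarrow> (pt \<Rightarrow> real) \<Rightarrow> (pt \<Rightarrow> real) \<Rightarrow> real" where
  "ip L f g = (\<integral>x. f x * g x \<partial>cell L)"

lemma Dom_cbox: "Dom L = cbox 0 (\<chi> i. L)"
  by (auto simp: Dom_def mem_box_cart)

lemma compact_Dom: "compact (Dom L)"
  by (simp add: Dom_cbox)

lemma sets_Dom [measurable, simp]: "Dom L \<in> sets borel"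
  by (simp add: Dom_cbox)

lemma space_cell [simp]: "space (cell L) = Dom L"
  by (simp add: cell_def space_restrict_space)

lemma measurable_cell: "f \<in> borel_measurable borel \<Longrightarrow> f \<in> borel_measurable (cell L)"
  by (simp add: cell_def measurable_restrict_space1)

lemma finite_measure_cell: "finite_measure (cell L)"
proof
  have "emeasure (cell L) (space (cell L)) = emeasure lborel (Dom L)"
    by (simp add: cell_def emeasure_restrict_space)
  then show "emeasure (cell L) (space (cell L)) \<noteq> \<infinity>"
    using emeasure_lborel_cbox_finite[of 0 "\<chi> i. L"] by (simp add: Dom_cbox less_top)
qed

lemma LINT_Dom: fixes f :: "pt \<Rightarrow> 'b::{banach, second_countable_topology}"
  shows "(LINT x:Dom L|lborel. f x) = (\<integral>x. f x \<partial>cell L)"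
  by (simp add: cell_def integral_restrict_space set_lebesgue_integral_def)

lemma set_integrable_Dom: fixes f :: "pt \<Rightarrow> 'b::{banach, second_countable_topology}"
  shows "set_integrable lborel (Dom L) f \<longleftrightarrow> integrable (cell L) f"
  by (simp add: cell_def integrable_restrict_space set_integrable_def)

lemma integrable_cell_bounded:
  fixes f :: "pt \<Rightarrow> real"
  assumes "f \<in> borel_measurable borel" "\<And>x. x \<in> Dom L \<Longrightarrow> \<bar>f x\<bar> \<le> B"
  shows "integrable (cell L) f"
proof (rule finite_measure.integrable_const_bound[OF finite_measure_cell])
  show "AE x in cell L. norm (f x) \<le> B" by (rule AE_I2) (use assms in auto)
qed (rule measurable_cell[OF assms(1)])

lemma sq_int_iff: "sq_int L f \<longleftrightarrow> f \<in> borel_measurable borel \<and> integrable (cell L) (\<lambda>x. (f x)\<^sup>2)"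
  by (simp add: sq_int_def set_integrable_Dom)

lemma sq_int_measurable: "sq_int L f \<Longrightarrow> f \<in> borel_measurable borel"
  by (simp add: sq_int_iff)

lemma sq_int_bounded:
  assumes "f \<in> borel_measurable borel" "\<And>x. x \<in> Dom L \<Longrightarrow> \<bar>f x\<bar> \<le> B"
  shows "sq_int L f"
  unfolding sq_int_iff
proof (intro conjI integrable_cell_bounded[where B="B\<^sup>2"])
  fix x assume "x \<in> Dom L"
  then show "\<bar>(f x)\<^sup>2\<bar> \<le> B\<^sup>2" using power_mono[OF assms(2)[of x] abs_ge_zero, of 2] by simp
qed (use assms(1) in measurable)

lemma continuous_Dom_bounded:
  fixes f :: "pt \<Rightarrow> real"
  assumes "continuous_on UNIV f"
  obtains B where "\<And>x. x \<in> Dom L \<Longrightarrow> \<bar>f x\<bar> \<le> B"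
proof -
  have "bounded (f ` Dom L)"
    by (intro compact_imp_bounded compact_continuous_image compact_Dom continuous_on_subset[OF assms]) auto
  then show ?thesis using that by (auto simp: bounded_iff)
qed

lemma sq_int_continuous:
  assumes "continuous_on UNIV f" shows "sq_int L f"
proof -
  obtain B where "\<And>x. x \<in> Dom L \<Longrightarrow> \<bar>f x\<bar> \<le> B"
    using continuous_Dom_bounded[OF assms] by blast
  with borel_measurable_continuous_onI[OF assms] show ?thesis by (rule sq_int_bounded)
qed

lemma integrable_cell_continuous:
  fixes f :: "pt \<Rightarrow> real"
  assumes "continuous_on UNIV f" shows "integrable (cell L) f"
proof -
  obtain B where "\<And>x. x \<in> Dom L \<Longrightarrow> \<bar>f x\<bar> \<le> B"
    using continuous_Dom_bounded[OF assms] by blast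
  with borel_measurable_continuous_onI[OF assms] show ?thesis by (rule integrable_cell_bounded)
qed

lemma sq_int_const [simp]: "sq_int L (\<lambda>x. c)"
  by (rule sq_int_continuous) (rule continuous_on_const)

lemma sq_int_mult_integrable:
  assumes "sq_int L f" "sq_int L g"
  shows "integrable (cell L) (\<lambda>x. f x * g x)"
proof (rule Bochner_Integration.integrable_bound)
  show "integrable (cell L) (\<lambda>x. (f x)\<^sup>2 + (g x)\<^sup>2)"
    using assms by (simp add: sq_int_iff)
  have *: "\<bar>a * b\<bar> \<le> a\<^sup>2 + b\<^sup>2" for a b :: real
  proof -
    have "2 * \<bar>a\<bar> * \<bar>b\<bar> \<le> \<bar>a\<bar>\<^sup>2 + \<bar>b\<bar>\<^sup>2" by (rule sum_squares_bound)
    moreover have "0 \<le> \<bar>a\<bar> * \<bar>b\<bar>" by simp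
    ultimately show ?thesis unfolding abs_mult power2_abs by linarith
  qed
  show "AE x in cell L. norm (f x * g x) \<le> norm ((f x)\<^sup>2 + (g x)\<^sup>2)"
    using * by (intro AE_I2) simp
  note [measurable] = assms[THEN sq_int_measurable]
  show "(\<lambda>x. f x * g x) \<in> borel_measurable (cell L)" by (rule measurable_cell) measurable
qed

lemma sq_int_add:
  assumes "sq_int L f" "sq_int L g" shows "sq_int L (\<lambda>x. f x + g x)"
  unfolding sq_int_iff
proof
  note [measurable] = assms[THEN sq_int_measurable]
  show "(\<lambda>x. f x + g x) \<in> borel_measurable borel" by measurable
  have "(\<lambda>x. (f x + g x)\<^sup>2) = (\<lambda>x. (f x)\<^sup>2 + (g x)\<^sup>2 + 2 * (f x * g x))"
    by (auto simp: power2_sum)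
  then show "integrable (cell L) (\<lambda>x. (f x + g x)\<^sup>2)"
    using assms sq_int_mult_integrable[OF assms] by (simp add: sq_int_iff)
qed

lemma sq_int_cmult:
  assumes "sq_int L f" shows "sq_int L (\<lambda>x. c * f x)"
  using assms by (auto simp: sq_int_iff power_mult_distrib)

lemma sq_int_uminus: "sq_int L f \<Longrightarrow> sq_int L (\<lambda>x. - f x)"
  using sq_int_cmult[of L f "-1"] by simp

lemma sq_int_diff:
  assumes "sq_int L f" "sq_int L g" shows "sq_int L (\<lambda>x. f x - g x)"
  using sq_int_add[OF assms(1) sq_int_uminus[OF assms(2)]] by simp

lemma sq_int_sum:
  assumes "\<And>i. i \<in> I \<Longrightarrow> sq_int L (f i)" shows "sq_int L (\<lambda>x. \<Sum>i\<in>I. f i x)"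
  using assms by (induction I rule: infinite_finite_induct) (auto intro: sq_int_add)

text \<open>The bound on \<open>g\<close> is asked only almost everywhere because it will be applied
  to velocity components, which are bounded merely up to null sets.\<close>

lemma sq_int_mult_bounded:
  assumes "sq_int L f" "g \<in> borel_measurable borel" "AE x in cell L. \<bar>g x\<bar> \<le> B"
  shows "sq_int L (\<lambda>x. g x * f x)"
  unfolding sq_int_iff
proof
  note [measurable] = assms(1)[THEN sq_int_measurable] assms(2)
  show "(\<lambda>x. g x * f x) \<in> borel_measurable borel" by measurable
  show "integrable (cell L) (\<lambda>x. (g x * f x)\<^sup>2)"
  proof (rule Bochner_Integration.integrable_bound)
    show "integrable (cell L) (\<lambda>x. B\<^sup>2 * (f x)\<^sup>2)" using assms by (simp add: sq_int_iff)
    show "AE x in cell L. norm ((g x * f x)\<^sup>2) \<le> norm (B\<^sup>2 * (f x)\<^sup>2)"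
      using assms(3)
    proof eventually_elim
      case (elim x)
      then have "(g x)\<^sup>2 \<le> B\<^sup>2" using power_mono[OF elim abs_ge_zero, of 2] by simp
      then show ?case by (simp add: power_mult_distrib mult_right_mono)
    qed
  qed (rule measurable_cell, measurable)
qed

lemma ip_commute: "ip L f g = ip L g f"
  by (simp add: ip_def mult.commute)

lemma ip_cmult_left [simp]: "ip L (\<lambda>x. c * f x) g = c * ip L f g"
  by (simp add: ip_def mult.assoc)

lemma ip_cmult_right [simp]: "ip L f (\<lambda>x. c * g x) = c * ip L f g"
  by (simp add: ip_def mult.left_commute)

lemma ip_uminus_left [simp]: "ip L (\<lambda>x. - f x) g = - ip L f g"
  by (simp add: ip_def)

lemma ip_zero_left [simp]: "ip L (\<lambda>x. 0) g = 0"
  by (simp add: ip_def)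

lemma ip_add_left:
  "\<lbrakk>sq_int L f; sq_int L g; sq_int L h\<rbrakk> \<Longrightarrow> ip L (\<lambda>x. f x + g x) h = ip L f h + ip L g h"
  by (simp add: ip_def distrib_right sq_int_mult_integrable)

lemma ip_diff_left:
  "\<lbrakk>sq_int L f; sq_int L g; sq_int L h\<rbrakk> \<Longrightarrow> ip L (\<lambda>x. f x - g x) h = ip L f h - ip L g h"
  by (simp add: ip_def left_diff_distrib sq_int_mult_integrable)

lemma ip_add_right:
  "\<lbrakk>sq_int L f; sq_int L g; sq_int L h\<rbrakk> \<Longrightarrow> ip L h (\<lambda>x. f x + g x) = ip L h f + ip L h g"
  by (simp add: ip_commute[of L h] ip_add_left)

lemma ip_diff_right:
  "\<lbrakk>sq_int L f; sq_int L g; sq_int L h\<rbrakk> \<Longrightarrow> ip L h (\<lambda>x. f x - g x) = ip L h f - ip L h g"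
  by (simp add: ip_commute[of L h] ip_diff_left)

lemma ip_sum_left:
  assumes "\<And>i. i \<in> I \<Longrightarrow> sq_int L (f i)" "sq_int L g"
  shows "ip L (\<lambda>x. \<Sum>i\<in>I. f i x) g = (\<Sum>i\<in>I. ip L (f i) g)"
  using assms(1)
  by (induction I rule: infinite_finite_induct) (auto simp: ip_add_left assms(2) sq_int_sum)

lemma ip_nonneg [simp]: "0 \<le> ip L f f"
  by (simp add: ip_def)

lemma ip_Cauchy_Schwarz:
  assumes "sq_int L f" "sq_int L g"
  shows "(ip L f g)\<^sup>2 \<le> ip L f f * ip L g g"
proof -
  let ?a = "ip L f f" and ?b = "ip L f g" and ?c = "ip L g g"
  have q: "0 \<le> t\<^sup>2 * ?a + 2 * t * ?b + ?c" for t
  proof -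
    have "0 \<le> ip L (\<lambda>x. t * f x + g x) (\<lambda>x. t * f x + g x)" by simp
    also have "\<dots> = t\<^sup>2 * ?a + 2 * t * ?b + ?c"
      using assms by (simp add: ip_add_left ip_add_right sq_int_cmult sq_int_add ip_commute[of L g f] power2_eq_square algebra_simps)
    finally show ?thesis .
  qed
  show ?thesis
  proof (cases "?a = 0")
    case True
    have "?b = 0"
    proof (rule ccontr)
      assume "?b \<noteq> 0"
      \<comment> \<open>With vanishing quadratic coefficient the form is affine in t, and this t
        gives it the value -1.\<close>
      then show False using q[of "- (?c + 1) / (2 * ?b)"] True by (simp add: field_simps)
    qed
    then show ?thesis using True by simp
  next
    case False
    then have "?a > 0" using ip_nonneg[of L f] by linarith
    have "0 \<le> ?a * ((- ?b / ?a)\<^sup>2 * ?a + 2 * (- ?b / ?a) * ?b + ?c)"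
      by (rule mult_nonneg_nonneg[OF less_imp_le[OF \<open>?a > 0\<close>] q])
    also have "\<dots> = ?a * ?c - ?b\<^sup>2" using \<open>?a > 0\<close> by (simp add: field_simps power2_eq_square)
    finally show ?thesis by simp
  qed
qed

text \<open>From |f - g|^2 \<ge> 0. It replaces the triangle inequality throughout, so that errors
  can be kept squared and no norm has to be introduced.\<close>

lemma ip_sum_sq_le:
  assumes "sq_int L f" "sq_int L g"
  shows "ip L (\<lambda>x. f x + g x) (\<lambda>x. f x + g x) \<le> 2 * ip L f f + 2 * ip L g g"
proof -
  have "0 \<le> ip L (\<lambda>x. f x - g x) (\<lambda>x. f x - g x)" by simp
  then show ?thesis
    using assms by (simp add: ip_add_left ip_add_right ip_diff_left ip_diff_right sq_int_add sq_int_diff ip_commute[of L g f])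
qed

lemma ip_AE_zero:
  assumes "sq_int L f" "ip L f f = 0" shows "AE x in cell L. f x = 0"
proof -
  have "AE x in cell L. (f x)\<^sup>2 = 0"
    using assms by (subst integral_nonneg_eq_0_iff_AE[symmetric]) (auto simp: sq_int_iff ip_def power2_eq_square)
  then show ?thesis by simp
qed

section \<open>Trigonometric polynomials and integration by parts\<close>

lemma integrable_indicator_continuous:
  fixes g :: "pt \<Rightarrow> real"
  assumes "continuous_on UNIV g" "A \<in> sets borel" "A \<subseteq> cbox a b"
  shows "integrable lborel (\<lambda>x. indicator A x * g x)"
proof -
  have "set_integrable lborel (cbox a b) g"
    unfolding set_integrable_def
    by (intro borel_integrable_compact continuous_on_subset[OF assms(1)]) auto
  from set_integrable_subset[OF this _ assms(3)] assms(2) show ?thesis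
    by (simp add: set_integrable_def)
qed

lemma lborel_integral_translate:
  fixes F :: "pt \<Rightarrow> real"
  assumes "F \<in> borel_measurable borel"
  shows "(\<integral>x. F (x + c) \<partial>lborel) = (\<integral>x. F x \<partial>lborel)"
proof -
  have "(\<integral>x. F x \<partial>lborel) = (\<integral>x. F x \<partial>distr lborel borel ((+) c))"
    by (simp add: lborel_distr_plus)
  also have "\<dots> = (\<integral>x. F (x + c) \<partial>lborel)"
    using assms by (subst integral_distr) (auto simp: add.commute)
  finally show ?thesis by simp
qed

lemma AE_lborel_component_neq: "AE x::pt in lborel. x $ i \<noteq> c"
proof -
  have "negligible {x::pt. x $ i = c}"
    using negligible_standard_hyperplane[of "axis i (1::real)" c] by (simp add: cart_eq_inner_axis axis_in_Basis_iff)
  then have "AE x::pt in lebesgue. x $ i \<noteq> c"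
    by (simp add: negligible_iff_null_sets AE_iff_null_sets Collect_neg_eq[symmetric])
  then show ?thesis by (simp add: AE_completion_iff)
qed

text \<open>The slabs \<open>S a b\<close> are half-open in direction i, so they fit together
  without overlap; the closed cell differs from \<open>S 0 L\<close> only in a null hyperplane.
  Translation turns \<open>S 0 L\<close> into \<open>S h (L + h)\<close>, and periodicity carries
  the part beyond L back to \<open>S 0 h\<close>.\<close>

lemma integral_cell_translate:
  fixes g :: "pt \<Rightarrow> real"
  assumes g: "continuous_on UNIV g" and per: "periodic L g" and h: "0 \<le> h" "h \<le> L"
  shows "(\<integral>x. g (x + h *\<^sub>R axis i 1) \<partial>cell L) = (\<integral>x. g x \<partial>cell L)"
proof -
  define S where "S a b = {y::pt. a < y $ i \<and> y $ i \<le> b \<and> (\<forall>j. j \<noteq> i \<longrightarrow> 0 \<le> y $ j \<and> y $ j \<le> L)}" for a b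
  have S_meas [measurable]: "S a b \<in> sets borel" for a b
    unfolding S_def by measurable
  have g_meas [measurable]: "g \<in> borel_measurable borel"
    by (rule borel_measurable_continuous_onI[OF g])
  have S_int: "integrable lborel (\<lambda>x. indicator (S a b) x * g x)" for a b
    by (rule integrable_indicator_continuous[OF g S_meas, of _ _ "\<chi> j. if j = i then a else 0" "\<chi> j. if j = i then b else L"])
       (auto simp: S_def mem_box_cart)
  define J where "J a b = (\<integral>x. indicator (S a b) x * g x \<partial>lborel)" for a b
  have split: "J a c = J a b + J b c" if "a \<le> b" "b \<le> c" for a b c
  proof -
    have "indicator (S a c) x * g x = indicator (S a b) x * g x + indicator (S b c) x * g x" for x
      using that by (auto simp: S_def indicator_def)
    then show ?thesis unfolding J_def by (simp add: S_int)
  qed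
  have ax: "(x + c *\<^sub>R axis i 1) $ j = (if j = i then x $ j + c else x $ j)" for x c j
    by (auto simp: axis_def)
  have shift: "(\<integral>x. indicator (S a b) x * g (x + c *\<^sub>R axis i 1) \<partial>lborel) = J (a + c) (b + c)" for a b c
  proof -
    have "indicator (S a b) x = (indicator (S (a + c) (b + c)) (x + c *\<^sub>R axis i 1) :: real)" for x
      unfolding S_def indicator_def mem_Collect_eq ax by simp
    then have "(\<integral>x. indicator (S a b) x * g (x + c *\<^sub>R axis i 1) \<partial>lborel)
        = (\<integral>x. indicator (S (a + c) (b + c)) (x + c *\<^sub>R axis i 1) * g (x + c *\<^sub>R axis i 1) \<partial>lborel)"
      by simp
    also have "\<dots> = J (a + c) (b + c)"
      unfolding J_def by (rule lborel_integral_translate) measurable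
    finally show ?thesis .
  qed
  have cell: "(\<integral>x. f x \<partial>cell L) = (\<integral>x. indicator (S 0 L) x * f x \<partial>lborel)"
    if [measurable]: "f \<in> borel_measurable borel" for f :: "pt \<Rightarrow> real"
  proof -
    have "(\<integral>x. f x \<partial>cell L) = (\<integral>x. indicator (Dom L) x * f x \<partial>lborel)"
      by (simp add: cell_def integral_restrict_space)
    also have "\<dots> = (\<integral>x. indicator (S 0 L) x * f x \<partial>lborel)"
    proof (rule integral_cong_AE)
      show "AE x in lborel. indicator (Dom L) x * f x = indicator (S 0 L) x * f x"
        using AE_lborel_component_neq[of i 0]
      proof eventually_elim
        case (elim x)
        then have "x \<in> Dom L \<longleftrightarrow> x \<in> S 0 L"
          unfolding S_def Dom_def by (auto simp: order_le_less)
        then show ?case by (simp add: indicator_def)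
      qed
    qed measurable
    finally show ?thesis .
  qed
  have "(\<integral>x. g (x + h *\<^sub>R axis i 1) \<partial>cell L) = J h (L + h)"
    by (subst cell) (simp_all add: shift)
  also have "\<dots> = J h L + J L (L + h)" using h by (intro split) auto
  also have "J L (L + h) = J 0 h"
    using shift[of 0 h L] per by (simp add: periodic_def J_def add.commute)
  also have "J h L + J 0 h = J 0 L" using split[of 0 h L] h by simp
  also have "\<dots> = (\<integral>x. g x \<partial>cell L)" by (simp add: cell J_def)
  finally show ?thesis .
qed

lemma pd_eq: "(\<phi> has_derivative D) (at x) \<Longrightarrow> pd i \<phi> x = D (axis i 1)"
  unfolding pd_def by (metis frechet_derivative_at)

lemma pd_DERIV:
  assumes "\<And>x. \<phi> differentiable (at x)"
  shows "((\<lambda>t. \<phi> (x + t *\<^sub>R axis i 1)) has_real_derivative pd i \<phi> (x + t *\<^sub>R axis i 1)) (at t)"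
proof -
  let ?D = "frechet_derivative \<phi> (at (x + t *\<^sub>R axis i 1))"
  have D: "(\<phi> has_derivative ?D) (at (x + t *\<^sub>R axis i 1))"
    using assms frechet_derivative_works by blast
  have "((\<lambda>t. \<phi> (x + t *\<^sub>R axis i 1)) has_derivative (\<lambda>h. ?D (h *\<^sub>R axis i 1))) (at t)"
    by (rule has_derivative_compose[where g=\<phi> and f="\<lambda>t. x + t *\<^sub>R axis i 1", OF _ D]) (auto intro!: derivative_eq_intros)
  moreover have "?D (h *\<^sub>R axis i 1) = h * pd i \<phi> (x + t *\<^sub>R axis i 1)" for h
    using D by (simp add: pd_def linear_cmul has_derivative_linear)
  ultimately show ?thesis
    by (simp add: has_field_derivative_def mult.commute[of _ "pd i \<phi> _"])
qed

text \<open>Difference quotients of a periodic function have integral zero by translation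
  invariance. They converge pointwise to the derivative, and the mean value theorem bounds them
  uniformly, so dominated convergence applies.\<close>

lemma integral_pd_periodic:
  fixes \<phi> :: "pt \<Rightarrow> real"
  assumes L: "0 < L" and per: "periodic L \<phi>" and diff: "\<And>x. \<phi> differentiable (at x)"
    and cont: "continuous_on UNIV (pd i \<phi>)"
  shows "(\<integral>x. pd i \<phi> x \<partial>cell L) = 0"
proof -
  have c\<phi>: "continuous_on UNIV \<phi>"
    using diff by (simp add: continuous_on_eq_continuous_at differentiable_imp_continuous_within)
  define h where "h n = L / real (Suc n)" for n
  have h: "0 < h n" "h n \<le> L" for n
    using L by (auto simp: h_def field_simps)
  have h0: "h \<longlonglongrightarrow> 0"
    unfolding h_def using LIMSEQ_Suc[OF lim_const_over_n[of L]] by simp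
  define F where "F n x = (\<phi> (x + h n *\<^sub>R axis i 1) - \<phi> x) / h n" for n x
  have Fint: "(\<integral>x. F n x \<partial>cell L) = 0" for n
  proof -
    have "continuous_on UNIV (\<lambda>x. \<phi> (x + h n *\<^sub>R axis i 1))"
      by (intro continuous_on_compose2[OF c\<phi>] continuous_intros) auto
    then show ?thesis
      using integral_cell_translate[OF c\<phi> per, of "h n" i] h[of n]
      by (simp add: F_def integrable_cell_continuous c\<phi>)
  qed
  have lim: "(\<lambda>n. F n x) \<longlonglongrightarrow> pd i \<phi> x" for x
  proof -
    have "((\<lambda>t. (\<phi> (x + t *\<^sub>R axis i 1) - \<phi> x) / t) \<longlongrightarrow> pd i \<phi> x) (at 0)"
      using pd_DERIV[OF diff, of x i 0] by (simp add: has_field_derivative_iff)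
    then show ?thesis unfolding F_def
      by (rule filterlim_compose) (use h0 h in \<open>auto simp: filterlim_at less_imp_neq[OF h(1), symmetric]\<close>)
  qed
  \<comment> \<open>The doubled box is needed since the intermediate point of the mean value theorem
    may leave the cell by up to h n \<le> L.\<close>
  have "bounded (pd i \<phi> ` cbox 0 (\<chi> j. 2 * L))"
    by (intro compact_imp_bounded compact_continuous_image continuous_on_subset[OF cont]) auto
  then obtain B where B: "\<And>x. x \<in> cbox 0 (\<chi> j. 2 * L) \<Longrightarrow> \<bar>pd i \<phi> x\<bar> \<le> B"
    by (auto simp: bounded_iff)
  have bound: "\<bar>F n x\<bar> \<le> B" if x: "x \<in> Dom L" for n x
  proof -
    obtain t where t: "0 < t" "t < h n" and eq: "\<phi> (x + h n *\<^sub>R axis i 1) - \<phi> (x + 0 *\<^sub>R axis i 1) = (h n - 0) * pd i \<phi> (x + t *\<^sub>R axis i 1)"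
      using MVT2[OF h(1)[of n], of "\<lambda>t. \<phi> (x + t *\<^sub>R axis i 1)" "\<lambda>t. pd i \<phi> (x + t *\<^sub>R axis i 1)"] pd_DERIV[OF diff] by blast
    have "x + t *\<^sub>R axis i 1 \<in> cbox 0 (\<chi> j. 2 * L)"
      using x t h[of n] L unfolding Dom_def mem_box_cart axis_def by (auto simp: add_mono) (smt (verit) mult_cancel_left1)+
    then show ?thesis using B eq h[of n] by (simp add: F_def)
  qed
  have "(\<lambda>n. \<integral>x. F n x \<partial>cell L) \<longlonglongrightarrow> (\<integral>x. pd i \<phi> x \<partial>cell L)"
  proof (rule integral_dominated_convergence[where w="\<lambda>_. B"])
    have m [measurable]: "\<phi> \<in> borel_measurable borel" "pd i \<phi> \<in> borel_measurable borel"
      by (rule borel_measurable_continuous_onI, fact)+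
    show "pd i \<phi> \<in> borel_measurable (cell L)" by (rule measurable_cell) measurable
    show "F n \<in> borel_measurable (cell L)" for n unfolding F_def by (rule measurable_cell) measurable
    show "integrable (cell L) (\<lambda>_. B)" by (rule finite_measure.integrable_const[OF finite_measure_cell])
  qed (use lim bound in auto)
  then show ?thesis by (simp add: Fint LIMSEQ_const_iff)
qed

text \<open>The dual lattice of the torus: the wave vectors for which cos(k x) and sin(k x) have
  period L in each coordinate.\<close>

definition Lat :: "real \<Rightarrow> pt set" where
  "Lat L = {k. \<forall>i. \<exists>m::int. k $ i = 2 * pi * m / L}"

text \<open>An inductive predicate instead of a coefficient family: closure under products and
  derivatives is then a rule induction with no index bookkeeping.\<close>

inductive trig :: "real \<Rightarrow> (pt \<Rightarrow> real) \<Rightarrow> bool" for L where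
  cos: "k \<in> Lat L \<Longrightarrow> trig L (\<lambda>x. a * cos (k \<bullet> x))"
| sin: "k \<in> Lat L \<Longrightarrow> trig L (\<lambda>x. a * sin (k \<bullet> x))"
| add: "trig L f \<Longrightarrow> trig L g \<Longrightarrow> trig L (\<lambda>x. f x + g x)"

section \<open>Algebra and calculus of trigonometric polynomials\<close>

lemma zero_Lat [simp]: "0 \<in> Lat L"
  by (auto simp: Lat_def intro!: exI[of _ "0::int"])

lemma Lat_add: "k \<in> Lat L \<Longrightarrow> m \<in> Lat L \<Longrightarrow> k + m \<in> Lat L"
  unfolding Lat_def
proof (intro CollectI allI)
  fix i assume "k \<in> {k. \<forall>i. \<exists>m::int. k $ i = 2 * pi * m / L}" "m \<in> {k. \<forall>i. \<exists>m::int. k $ i = 2 * pi * m / L}"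
  then obtain a b :: int where "k $ i = 2 * pi * a / L" "m $ i = 2 * pi * b / L" by blast
  then have "(k + m) $ i = 2 * pi * of_int (a + b) / L" by (simp add: add_divide_distrib distrib_left)
  then show "\<exists>ma::int. (k + m) $ i = 2 * pi * ma / L" by blast
qed

lemma Lat_uminus: "k \<in> Lat L \<Longrightarrow> - k \<in> Lat L"
  unfolding Lat_def
proof (intro CollectI allI)
  fix i assume "k \<in> {k. \<forall>i. \<exists>m::int. k $ i = 2 * pi * m / L}"
  then obtain a :: int where "k $ i = 2 * pi * a / L" by blast
  then have "(- k) $ i = 2 * pi * of_int (- a) / L" by simp
  then show "\<exists>ma::int. (- k) $ i = 2 * pi * ma / L" by blast
qed

lemma Lat_diff: "k \<in> Lat L \<Longrightarrow> m \<in> Lat L \<Longrightarrow> k - m \<in> Lat L"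
  using Lat_add[OF _ Lat_uminus, of k L m] by simp

lemma trig_cmult: "trig L f \<Longrightarrow> trig L (\<lambda>x. c * f x)"
proof (induction rule: trig.induct)
  case (add f g)
  then show ?case using trig.add by (simp add: distrib_left)
qed (simp_all only: mult.assoc[symmetric] trig.cos trig.sin)

lemma trig_const: "trig L (\<lambda>x. c)"
  using trig.cos[of 0 L c] by simp

lemma trig_cos1: "k \<in> Lat L \<Longrightarrow> trig L (\<lambda>x. cos (k \<bullet> x))"
  and trig_sin1: "k \<in> Lat L \<Longrightarrow> trig L (\<lambda>x. sin (k \<bullet> x))"
  using trig.cos[of k L 1] trig.sin[of k L 1] by simp_all

lemma trig_sum: "(\<And>i. i \<in> I \<Longrightarrow> trig L (f i)) \<Longrightarrow> trig L (\<lambda>x. \<Sum>i\<in>I. f i x)"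
  by (induction I rule: infinite_finite_induct) (auto simp: trig_const trig.add)

text \<open>The product-to-sum formulas only create the frequencies k + m and k - m (or m - k),
  which stay in the lattice.\<close>

lemma trig_mult:
  assumes "trig L f" "trig L g" shows "trig L (\<lambda>x. f x * g x)"
proof -
  have c: "trig L (\<lambda>x. cos (k \<bullet> x) * g x)" if "trig L g" "k \<in> Lat L" for g k
    using that
  proof (induction rule: trig.induct)
    case (cos m a)
    have "trig L (\<lambda>x. a / 2 * cos ((k - m) \<bullet> x) + a / 2 * cos ((k + m) \<bullet> x))"
      using cos by (intro trig.intros Lat_add Lat_diff)
    then show ?case by (simp add: inner_add_left inner_diff_left cos_add cos_diff field_simps)
  next
    case (sin m a)
    have "trig L (\<lambda>x. a / 2 * sin ((m - k) \<bullet> x) + a / 2 * sin ((k + m) \<bullet> x))"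
      using sin by (intro trig.intros Lat_add Lat_diff)
    then show ?case by (simp add: inner_add_left inner_diff_left sin_add sin_diff field_simps)
  qed (simp add: distrib_left trig.add)
  have s: "trig L (\<lambda>x. sin (k \<bullet> x) * g x)" if "trig L g" "k \<in> Lat L" for g k
    using that
  proof (induction rule: trig.induct)
    case (cos m a)
    have "trig L (\<lambda>x. a / 2 * sin ((k - m) \<bullet> x) + a / 2 * sin ((k + m) \<bullet> x))"
      using cos by (intro trig.intros Lat_add Lat_diff)
    then show ?case by (simp add: inner_add_left inner_diff_left sin_add sin_diff field_simps)
  next
    case (sin m a)
    have "trig L (\<lambda>x. a / 2 * cos ((k - m) \<bullet> x) + (- a / 2) * cos ((k + m) \<bullet> x))"
      using sin by (intro trig.intros Lat_add Lat_diff)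
    then show ?case by (simp add: inner_add_left inner_diff_left cos_add cos_diff field_simps)
  qed (simp add: distrib_left trig.add)
  from assms show ?thesis
  proof (induction rule: trig.induct)
    case (add f1 f2) then show ?case by (simp add: distrib_right trig.add)
  qed (auto simp: mult.assoc intro: trig_cmult c s)
qed

text \<open>Differentiability and the form of the partial derivatives are carried through one
  induction, because the sum rule for derivatives presupposes differentiability of both
  summands.\<close>

lemma trig_has_derivative:
  assumes "trig L f"
  shows "\<exists>D. (\<forall>x. (f has_derivative D x) (at x)) \<and> (\<forall>i. trig L (\<lambda>x. D x (axis i 1)))"
  using assms
proof (induction rule: trig.induct)
  case (cos k a)
  show ?case
  proof (intro exI conjI allI)
    show "((\<lambda>x. a * cos (k \<bullet> x)) has_derivative (\<lambda>h. a * (- (k \<bullet> h) * sin (k \<bullet> x)))) (at x)" for x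
      by (auto intro!: derivative_eq_intros)
    show "trig L (\<lambda>x. a * (- (k \<bullet> axis i 1) * sin (k \<bullet> x)))" for i
      using trig.sin[OF cos, of "a * (- (k \<bullet> axis i 1))"] by (simp add: mult.assoc)
  qed
next
  case (sin k a)
  show ?case
  proof (intro exI conjI allI)
    show "((\<lambda>x. a * sin (k \<bullet> x)) has_derivative (\<lambda>h. a * ((k \<bullet> h) * cos (k \<bullet> x)))) (at x)" for x
      by (auto intro!: derivative_eq_intros)
    show "trig L (\<lambda>x. a * ((k \<bullet> axis i 1) * cos (k \<bullet> x)))" for i
      using trig.cos[OF sin, of "a * (k \<bullet> axis i 1)"] by (simp add: mult.assoc)
  qed
next
  case (add f g)
  then obtain D E where "\<And>x. (f has_derivative D x) (at x)" "\<And>i. trig L (\<lambda>x. D x (axis i 1))"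
    "\<And>x. (g has_derivative E x) (at x)" "\<And>i. trig L (\<lambda>x. E x (axis i 1))" by blast
  then show ?case
    by (intro exI[of _ "\<lambda>x h. D x h + E x h"]) (auto intro: has_derivative_add trig.add)
qed

lemma trig_differentiable: "trig L f \<Longrightarrow> f differentiable (at x)"
  using trig_has_derivative differentiableI by blast

lemma trig_pd: assumes "trig L f" shows "trig L (pd i f)"
proof -
  obtain D where D: "\<And>x. (f has_derivative D x) (at x)" "trig L (\<lambda>x. D x (axis i 1))"
    using trig_has_derivative[OF assms] by blast
  then show ?thesis using pd_eq[OF D(1)] by (metis (no_types, lifting) ext)
qed

lemma trig_continuous: "trig L f \<Longrightarrow> continuous_on UNIV f"
  by (simp add: continuous_on_eq_continuous_at differentiable_imp_continuous_within trig_differentiable)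

lemma trig_sq_int: "trig L f \<Longrightarrow> sq_int L f"
  by (simp add: sq_int_continuous trig_continuous)

lemma trig_periodic:
  assumes "0 < L" "trig L f" shows "periodic L f"
  using assms(2)
proof (induction rule: trig.induct)
  case (cos k a)
  show ?case unfolding periodic_def
  proof (intro allI)
    fix x i
    obtain m :: int where m: "k $ i = 2 * pi * m / L" using cos by (auto simp: Lat_def)
    have "k \<bullet> (x + L *\<^sub>R axis i 1) = k \<bullet> x + 2 * pi * m"
      using m assms(1) by (simp add: inner_add_right inner_axis)
    then show "a * cos (k \<bullet> (x + L *\<^sub>R axis i 1)) = a * cos (k \<bullet> x)" by (metis sin_cos_eq_iff)
  qed
next
  case (sin k a)
  show ?case unfolding periodic_def
  proof (intro allI)
    fix x i
    obtain m :: int where m: "k $ i = 2 * pi * m / L" using sin by (auto simp: Lat_def)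
    have "k \<bullet> (x + L *\<^sub>R axis i 1) = k \<bullet> x + 2 * pi * m"
      using m assms(1) by (simp add: inner_add_right inner_axis)
    then show "a * sin (k \<bullet> (x + L *\<^sub>R axis i 1)) = a * sin (k \<bullet> x)" by (metis sin_cos_eq_iff)
  qed
qed (simp add: periodic_def)

lemma trig_test: assumes "0 < L" "trig L f" shows "test L f"
proof -
  have "Ck n f" for n using assms(2)
    by (induction n arbitrary: f) (auto simp: trig_continuous trig_differentiable trig_pd)
  then show ?thesis using trig_periodic assms by (simp add: test_def)
qed

lemma pd_cmult:
  assumes "f differentiable (at x)" shows "pd i (\<lambda>x. c * f x) x = c * pd i f x"
  using pd_eq[OF has_derivative_mult_right[OF assms[unfolded frechet_derivative_works], of c], of i]
  by (simp add: pd_def)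

lemma pd_add:
  assumes "f differentiable (at x)" "g differentiable (at x)"
  shows "pd i (\<lambda>x. f x + g x) x = pd i f x + pd i g x"
  using pd_eq[OF has_derivative_add[OF assms[unfolded frechet_derivative_works]], of i]
  by (simp add: pd_def)

lemma pd_mult:
  assumes "f differentiable (at x)" "g differentiable (at x)"
  shows "pd i (\<lambda>x. f x * g x) x = f x * pd i g x + pd i f x * g x"
  using pd_eq[OF has_derivative_mult[OF assms[unfolded frechet_derivative_works]], of i]
  by (simp add: pd_def)

lemma pd_sum:
  assumes "\<And>j. j \<in> I \<Longrightarrow> f j differentiable (at x)"
  shows "pd i (\<lambda>x. \<Sum>j\<in>I. f j x) x = (\<Sum>j\<in>I. pd i (f j) x)"
proof -
  have "((\<lambda>x. \<Sum>j\<in>I. f j x) has_derivative (\<lambda>h. \<Sum>j\<in>I. frechet_derivative (f j) (at x) h)) (at x)"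
    using assms by (intro has_derivative_sum) (simp add: frechet_derivative_works[symmetric])
  from pd_eq[OF this] show ?thesis by (simp add: pd_def)
qed

lemma pd_cos: "pd i (\<lambda>x. cos (k \<bullet> x)) x = - k $ i * sin (k \<bullet> x)"
  by (subst pd_eq[where D="\<lambda>h. - (k \<bullet> h) * sin (k \<bullet> x)"])
     (auto intro!: derivative_eq_intros simp: inner_axis)

lemma pd_sin: "pd i (\<lambda>x. sin (k \<bullet> x)) x = k $ i * cos (k \<bullet> x)"
  by (subst pd_eq[where D="\<lambda>h. (k \<bullet> h) * cos (k \<bullet> x)"])
     (auto intro!: derivative_eq_intros simp: inner_axis)

text \<open>Integration by parts: the derivative of the periodic product f g integrates to zero, so
  no boundary term appears.\<close>

lemma ip_pd_trig:
  assumes L: "0 < L" and f: "trig L f" and g: "test L g"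
  shows "ip L (pd i f) g = - ip L f (pd i g)"
proof -
  have g1: "\<And>x. g differentiable (at x)" "continuous_on UNIV (pd i g)" "periodic L g"
    using g unfolding test_def by (metis Ck.simps(2), metis Ck.simps, blast)
  have cg: "continuous_on UNIV g"
    using g1 by (simp add: continuous_on_eq_continuous_at differentiable_imp_continuous_within)
  have eq: "pd i (\<lambda>x. f x * g x) = (\<lambda>x. f x * pd i g x + pd i f x * g x)"
    using pd_mult[OF trig_differentiable[OF f] g1(1)] by blast
  have sq: "sq_int L f" "sq_int L (pd i f)" "sq_int L g" "sq_int L (pd i g)"
    using trig_sq_int[OF f] trig_sq_int[OF trig_pd[OF f]] sq_int_continuous[OF cg] sq_int_continuous[OF g1(2)] by auto
  have "(\<integral>x. pd i (\<lambda>x. f x * g x) x \<partial>cell L) = 0"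
  proof (rule integral_pd_periodic[OF L])
    show "periodic L (\<lambda>x. f x * g x)"
      using trig_periodic[OF L f] g1(3) by (simp add: periodic_def)
    show "(\<lambda>x. f x * g x) differentiable (at x)" for x
      using trig_differentiable[OF f] g1(1) by (auto intro: derivative_intros)
    show "continuous_on UNIV (pd i (\<lambda>x. f x * g x))"
      unfolding eq by (intro continuous_intros trig_continuous[OF f] trig_continuous[OF trig_pd[OF f]] cg g1)
  qed
  then have "ip L f (pd i g) + ip L (pd i f) g = 0"
    unfolding eq ip_def using sq by (simp add: sq_int_mult_integrable)
  then show ?thesis by simp
qed

section \<open>Density of the trigonometric polynomials\<close>

definition trig_approx :: "real \<Rightarrow> (pt \<Rightarrow> real) \<Rightarrow> bool" where
  "trig_approx L f \<longleftrightarrow> sq_int L f \<and>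
     (\<forall>e>0. \<exists>p. trig L p \<and> ip L (\<lambda>x. f x - p x) (\<lambda>x. f x - p x) < e)"

lemma trig_approxD:
  assumes "trig_approx L f" "e > 0"
  obtains p where "trig L p" "ip L (\<lambda>x. f x - p x) (\<lambda>x. f x - p x) < e"
  using assms unfolding trig_approx_def by blast

lemma trig_approxI:
  assumes "sq_int L f" "\<And>e. e > 0 \<Longrightarrow> \<exists>g. trig_approx L g \<and> ip L (\<lambda>x. f x - g x) (\<lambda>x. f x - g x) < e"
  shows "trig_approx L f"
  unfolding trig_approx_def
proof (intro conjI allI impI assms(1))
  fix e :: real assume "e > 0"
  \<comment> \<open>A quarter for each error, since the squared triangle inequality doubles
    both.\<close>
  then obtain g where g: "trig_approx L g" "ip L (\<lambda>x. f x - g x) (\<lambda>x. f x - g x) < e / 4"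
    using assms(2)[of "e / 4"] by auto
  obtain p where p: "trig L p" "ip L (\<lambda>x. g x - p x) (\<lambda>x. g x - p x) < e / 4"
    using trig_approxD[OF g(1), of "e / 4"] \<open>e > 0\<close> by auto
  have "ip L (\<lambda>x. (f x - g x) + (g x - p x)) (\<lambda>x. (f x - g x) + (g x - p x))
      \<le> 2 * ip L (\<lambda>x. f x - g x) (\<lambda>x. f x - g x) + 2 * ip L (\<lambda>x. g x - p x) (\<lambda>x. g x - p x)"
    using assms(1) g(1) trig_sq_int[OF p(1)] by (intro ip_sum_sq_le sq_int_diff) (auto simp: trig_approx_def)
  then show "\<exists>p. trig L p \<and> ip L (\<lambda>x. f x - p x) (\<lambda>x. f x - p x) < e"
    using g p by (intro exI[of _ p]) simp
qed

lemma trig_approx_limit: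
  assumes "sq_int L f" "\<And>n. trig_approx L (g n)"
    "(\<lambda>n. ip L (\<lambda>x. f x - g n x) (\<lambda>x. f x - g n x)) \<longlonglongrightarrow> 0"
  shows "trig_approx L f"
proof (rule trig_approxI[OF assms(1)])
  fix e :: real assume "e > 0"
  then have ev: "\<forall>\<^sub>F n in sequentially. ip L (\<lambda>x. f x - g n x) (\<lambda>x. f x - g n x) < e"
    using order_tendstoD(2)[OF assms(3)] by blast
  then show "\<exists>g. trig_approx L g \<and> ip L (\<lambda>x. f x - g x) (\<lambda>x. f x - g x) < e"
  proof -
    from eventually_happens[OF ev] obtain n where "ip L (\<lambda>x. f x - g n x) (\<lambda>x. f x - g n x) < e" by auto
    then show ?thesis using assms(2) by blast
  qed
qed

lemma trig_trig_approx: "trig L p \<Longrightarrow> trig_approx L p"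
  unfolding trig_approx_def by (auto intro!: trig_sq_int exI[of _ p])

lemma trig_approx_add:
  assumes "trig_approx L f" "trig_approx L g" shows "trig_approx L (\<lambda>x. f x + g x)"
  unfolding trig_approx_def
proof (intro conjI allI impI)
  have fg: "sq_int L f" "sq_int L g" using assms by (auto simp: trig_approx_def)
  then show "sq_int L (\<lambda>x. f x + g x)" by (rule sq_int_add)
  fix e :: real assume "e > 0"
  then have "e / 4 > 0" by simp
  obtain p where p: "trig L p" "ip L (\<lambda>x. f x - p x) (\<lambda>x. f x - p x) < e / 4"
    using trig_approxD[OF assms(1) \<open>e / 4 > 0\<close>] by blast
  obtain q where q: "trig L q" "ip L (\<lambda>x. g x - q x) (\<lambda>x. g x - q x) < e / 4"
    using trig_approxD[OF assms(2) \<open>e / 4 > 0\<close>] by blast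
  have "ip L (\<lambda>x. (f x - p x) + (g x - q x)) (\<lambda>x. (f x - p x) + (g x - q x)) < e"
    using ip_sum_sq_le[OF sq_int_diff[OF fg(1) trig_sq_int[OF p(1)]] sq_int_diff[OF fg(2) trig_sq_int[OF q(1)]]] p q
    by linarith
  then show "\<exists>p. trig L p \<and> ip L (\<lambda>x. f x + g x - p x) (\<lambda>x. f x + g x - p x) < e"
    using trig.add[OF p(1) q(1)] by (intro exI[of _ "\<lambda>x. p x + q x"]) (simp add: algebra_simps)
qed

lemma trig_approx_cmult:
  assumes "trig_approx L f" shows "trig_approx L (\<lambda>x. c * f x)"
  unfolding trig_approx_def
proof (intro conjI allI impI)
  show "sq_int L (\<lambda>x. c * f x)" using assms by (auto simp: trig_approx_def intro: sq_int_cmult)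
  fix e :: real assume "e > 0"
  \<comment> \<open>The denominator exceeds the square of c, which avoids a separate case c =
    0.\<close>
  then have "e / (c\<^sup>2 + 1) > 0" by (simp add: add_nonneg_pos)
  then obtain p where p: "trig L p" "ip L (\<lambda>x. f x - p x) (\<lambda>x. f x - p x) < e / (c\<^sup>2 + 1)"
    using trig_approxD[OF assms] by blast
  let ?a = "ip L (\<lambda>x. f x - p x) (\<lambda>x. f x - p x)"
  have "?a * (c\<^sup>2 + 1) < e" using p(2) by (simp add: pos_less_divide_eq add_nonneg_pos)
  moreover have "c * (c * ?a) = ?a * (c\<^sup>2 + 1) - ?a" by (simp add: power2_eq_square algebra_simps)
  ultimately have "c * (c * ?a) < e" using ip_nonneg[of L "\<lambda>x. f x - p x"] by linarith
  then have "ip L (\<lambda>x. c * f x - c * p x) (\<lambda>x. c * f x - c * p x) < e"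
    by (simp flip: right_diff_distrib)
  then show "\<exists>p. trig L p \<and> ip L (\<lambda>x. c * f x - p x) (\<lambda>x. c * f x - p x) < e"
    using trig_cmult[OF p(1)] by blast
qed

text \<open>The torus embedded in R^4 as a product of two circles. Polynomials on R^4 restrict to
  trigonometric polynomials, so the polynomial Stone-Weierstrass theorem on the compact image
  becomes available.\<close>

definition tor :: "real \<Rightarrow> pt \<Rightarrow> (real \<times> real) \<times> (real \<times> real)" where
  "tor L x = ((cos (2 * pi / L * x $ 1), sin (2 * pi / L * x $ 1)), (cos (2 * pi / L * x $ 2), sin (2 * pi / L * x $ 2)))"

lemma axis_Lat: "axis i (2 * pi / L) \<in> Lat L"
  unfolding Lat_def
proof (intro CollectI allI)
  show "\<exists>m::int. axis i (2 * pi / L) $ j = 2 * pi * m / L" for j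
    by (cases "i = j") (auto simp: axis_def intro: exI[of _ "1::int"] exI[of _ "0::int"])
qed

text \<open>A linear functional on R^4 is a combination of the four coordinates, which are cosines
  and sines of the basic frequencies; constants, sums and products are closure properties.\<close>

lemma trig_tor:
  assumes "real_polynomial_function p" shows "trig L (\<lambda>x. p (tor L x))"
  using assms
proof (induction rule: real_polynomial_function.induct)
  case (linear f)
  interpret f: bounded_linear f by fact
  have t: "trig L (\<lambda>x. c * cos (2 * pi / L * x $ i))" "trig L (\<lambda>x. c * sin (2 * pi / L * x $ i))" for c i
    using trig.cos[OF axis_Lat[of i L], of c] trig.sin[OF axis_Lat[of i L], of c]
    by (simp_all add: inner_axis' mult.commute)
  have "f ((a, b), (c, d)) = f ((1,0),(0,0)) * a + f ((0,1),(0,0)) * b + f ((0,0),(1,0)) * c + f ((0,0),(0,1)) * d" for a b c d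
  proof -
    have "((a, b), (c, d)) = a *\<^sub>R ((1,0),(0,0)) + b *\<^sub>R ((0,1),(0,0)) + c *\<^sub>R ((0,0),(1,0)) + d *\<^sub>R ((0,0),(0,1))"
      by simp
    then show ?thesis by (simp only: f.add f.scaleR) (simp add: mult.commute)
  qed
  from this[of "cos (2 * pi / L * x $ 1)" "sin (2 * pi / L * x $ 1)" "cos (2 * pi / L * x $ 2)" "sin (2 * pi / L * x $ 2)" for x]
  have "(\<lambda>x. f (tor L x)) = (\<lambda>x. f ((1,0),(0,0)) * cos (2 * pi / L * x $ 1) + f ((0,1),(0,0)) * sin (2 * pi / L * x $ 1)
      + f ((0,0),(1,0)) * cos (2 * pi / L * x $ 2) + f ((0,0),(0,1)) * sin (2 * pi / L * x $ 2))"
    by (intro ext) (simp only: tor_def)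
  then show ?case by (simp only:) (intro trig.add t)
qed (auto intro: trig_const trig.add trig_mult)

text \<open>Equal cosine and sine force coordinates to differ by an integer multiple of L, and in
  the half-open cell the difference is smaller than L.\<close>

lemma tor_inj:
  assumes "0 < L" "\<And>i. 0 \<le> x $ i \<and> x $ i < L" "\<And>i. 0 \<le> y $ i \<and> y $ i < L" "tor L x = tor L y"
  shows "x = y"
proof -
  have "x $ i = y $ i" if cs: "cos (2 * pi / L * x $ i) = cos (2 * pi / L * y $ i)" "sin (2 * pi / L * x $ i) = sin (2 * pi / L * y $ i)" for i
  proof -
    obtain n :: int where "2 * pi / L * x $ i = 2 * pi / L * y $ i + 2 * pi * n"
      using cs sin_cos_eq_iff by metis
    then have "2 * pi / L * (x $ i - y $ i - n * L) = 0" using assms(1) by (simp add: field_simps)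
    then have n: "x $ i - y $ i = n * L" using assms(1) by simp
    have "\<bar>x $ i - y $ i\<bar> < L" using assms(2)[of i] assms(3)[of i] by auto
    then have "\<bar>real_of_int n\<bar> < 1" using n assms(1) by (simp add: abs_mult)
    then have "\<bar>n\<bar> < 1" by (metis of_int_abs of_int_less_1_iff)
    then show ?thesis using n by simp
  qed
  then show ?thesis using assms(4) by (simp add: tor_def vec_eq_iff forall_2)
qed

definition Dom' :: "real \<Rightarrow> pt set" where
  "Dom' L = {x. \<forall>i. 0 \<le> x $ i \<and> x $ i < L}"

lemma sets_Dom' [measurable]: "Dom' L \<in> sets borel"
  unfolding Dom'_def by measurable

lemma AE_Dom': "AE x in cell L. x \<in> Dom' L"
proof -
  have "AE x::pt in lborel. \<forall>i. x $ i \<noteq> L"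
    using AE_lborel_component_neq by (simp add: forall_2)
  then have "AE x in lborel. x \<in> Dom L \<longrightarrow> x \<in> Dom' L"
    by eventually_elim (auto simp: Dom_def Dom'_def order_le_less)
  then show ?thesis unfolding cell_def by (simp add: AE_restrict_space_iff)
qed

lemma continuous_tor: "continuous_on A (tor L)"
  unfolding tor_def by (intro continuous_intros)

lemma ip_tendsto_zero:
  assumes "f \<in> borel_measurable borel" "\<And>n. g n \<in> borel_measurable borel"
    "AE x in cell L. (\<lambda>n. g n x) \<longlonglongrightarrow> f x"
    "integrable (cell L) w" "\<And>n. AE x in cell L. (f x - g n x)\<^sup>2 \<le> w x"
  shows "(\<lambda>n. ip L (\<lambda>x. f x - g n x) (\<lambda>x. f x - g n x)) \<longlonglongrightarrow> 0"
proof -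
  note [measurable] = assms(1,2)
  have "(\<lambda>n. \<integral>x. (f x - g n x)\<^sup>2 \<partial>cell L) \<longlonglongrightarrow> (\<integral>x. 0 \<partial>cell L)"
  proof (rule integral_dominated_convergence[where w=w])
    show "AE x in cell L. (\<lambda>n. (f x - g n x)\<^sup>2) \<longlonglongrightarrow> 0"
      using assms(3)
    proof eventually_elim
      case (elim x)
      then have "(\<lambda>n. (f x - g n x)\<^sup>2) \<longlonglongrightarrow> (f x - f x)\<^sup>2" by (intro tendsto_intros)
      then show ?case by simp
    qed
    show "(\<lambda>x. (f x - g n x)\<^sup>2) \<in> borel_measurable (cell L)" for n
      by (rule measurable_cell) measurable
  qed (use assms(4,5) in auto)
  then show ?thesis by (simp add: ip_def power2_eq_square)
qed

text \<open>The functions \<open>F n\<close> are continuous on R^4 and decrease to the indicator of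
  \<open>C\<close>, the image of K. Stone-Weierstrass replaces them by polynomials with error
  1/(n+1), which pull back to trigonometric polynomials. Injectivity of \<open>tor\<close> on the
  half-open cell ensures that the limit is the indicator of K itself.\<close>

lemma trig_approx_indicator_compact:
  assumes L: "0 < L" and K: "compact K" "K \<subseteq> Dom' L"
  shows "trig_approx L (indicator K)"
proof (cases "K = {}")
  case True
  then show ?thesis using trig_trig_approx[OF trig_const[of L 0]] by (simp add: indicator_def[abs_def])
next
  case False
  define C where "C = tor L ` K"
  define F where "F n z = max 0 (1 - real n * infdist z C)" for n z
  have C: "closed C" "C \<noteq> {}"
    using False K by (auto simp: C_def intro!: compact_imp_closed compact_continuous_image continuous_tor)
  have "\<exists>g. real_polynomial_function g \<and> (\<forall>z\<in>tor L ` Dom L. \<bar>F n z - g z\<bar> < 1 / real (Suc n))" for n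
  proof -
    have "compact (tor L ` Dom L)" by (intro compact_continuous_image continuous_tor compact_Dom)
    moreover have "continuous_on (tor L ` Dom L) (F n)"
      unfolding F_def by (intro continuous_intros)
    ultimately show ?thesis
      using Stone_Weierstrass_real_polynomial_function[of "tor L ` Dom L" "F n" "1 / real (Suc n)"]
      by (metis of_nat_0_less_iff zero_less_Suc zero_less_divide_1_iff)
  qed
  then obtain g where g: "\<And>n. real_polynomial_function (g n)"
    "\<And>n x. x \<in> Dom L \<Longrightarrow> \<bar>F n (tor L x) - g n (tor L x)\<bar> < 1 / real (Suc n)"
    by (metis imageI)
  define p where "p n x = g n (tor L x)" for n x
  have p: "trig L (p n)" for n unfolding p_def by (rule trig_tor[OF g(1)])
  have Kb: "K \<in> sets borel" using K(1) by (simp add: compact_imp_closed)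
  have F01: "0 \<le> F n z" "F n z \<le> 1" for n z
    by (auto simp: F_def infdist_nonneg)
  show ?thesis
  proof (rule trig_approx_limit[where g=p])
    show "sq_int L (indicator K)"
      by (rule sq_int_bounded[where B=1]) (use Kb in simp, simp add: indicator_def)
    show "trig_approx L (p n)" for n by (rule trig_trig_approx[OF p])
    show "(\<lambda>n. ip L (\<lambda>x. indicator K x - p n x) (\<lambda>x. indicator K x - p n x)) \<longlonglongrightarrow> 0"
    \<comment> \<open>The dominating constant: indicator and \<open>F n\<close> both lie in [0,1],
      and \<open>p n\<close> is within 1 of \<open>F n\<close>, so the difference is at most
      2.\<close>
    proof (rule ip_tendsto_zero[where w="\<lambda>_. 4"])
      show "AE x in cell L. (\<lambda>n. p n x) \<longlonglongrightarrow> indicator K x"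
        using AE_Dom'
      proof eventually_elim
        case (elim x)
        then have x: "x \<in> Dom L" by (auto simp: Dom'_def Dom_def less_imp_le)
        have "(\<lambda>n. F n (tor L x)) \<longlonglongrightarrow> indicator K x"
        proof (cases "x \<in> K")
          case True
          then show ?thesis by (simp add: F_def C_def)
        next
          case nK: False
          have "tor L x \<notin> C"
          proof
            assume "tor L x \<in> C"
            then obtain y where y: "y \<in> K" "tor L x = tor L y" by (auto simp: C_def)
            have "x = y" by (rule tor_inj[OF L _ _ y(2)]) (use elim K(2) y(1) in \<open>auto simp: Dom'_def\<close>)
            then show False using y nK by simp
          qed
          then have pos: "infdist (tor L x) C > 0" using C by (simp add: infdist_pos_not_in_closed)
          obtain N where N: "1 < real N * infdist (tor L x) C"
            using reals_Archimedean3[OF pos] by blast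
          have "F n (tor L x) = 0" if "n \<ge> N" for n
          proof -
            have "real N * infdist (tor L x) C \<le> real n * infdist (tor L x) C"
              using that by (intro mult_right_mono) (auto simp: infdist_nonneg)
            then show ?thesis using N by (simp add: F_def)
          qed
          then have "eventually (\<lambda>n. F n (tor L x) = 0) sequentially"
            by (auto simp: eventually_sequentially)
          then show ?thesis using nK by (simp add: tendsto_eventually)
        qed
        moreover have "(\<lambda>n. p n x - F n (tor L x)) \<longlonglongrightarrow> 0"
        proof (rule Lim_null_comparison)
          show "\<forall>\<^sub>F n in sequentially. norm (p n x - F n (tor L x)) \<le> 1 / real (Suc n)"
            using g(2)[OF x] by (intro always_eventually allI) (simp add: p_def abs_minus_commute less_imp_le)
          show "(\<lambda>n. 1 / real (Suc n)) \<longlonglongrightarrow> 0" using LIMSEQ_Suc[OF lim_const_over_n[of 1]] by simp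
        qed
        ultimately show ?case by (rule Lim_transform)
      qed
      show "AE x in cell L. (indicator K x - p n x)\<^sup>2 \<le> 4" for n
      proof (rule AE_I2)
        fix x assume "x \<in> space (cell L)"
        then have "\<bar>F n (tor L x) - p n x\<bar> < 1 / real (Suc n)" using g(2) by (simp add: p_def)
        also have "\<dots> \<le> 1" by simp
        finally have "\<bar>indicator K x - p n x\<bar> \<le> 2" using F01[of n "tor L x"] by (auto simp: indicator_def)
        then show "(indicator K x - p n x)\<^sup>2 \<le> 4" using power_mono[of "\<bar>indicator K x - p n x\<bar>" 2 2] by simp
      qed
      show "integrable (cell L) (\<lambda>_. 4 :: real)" by (rule finite_measure.integrable_const[OF finite_measure_cell])
      show "p n \<in> borel_measurable borel" for n by (rule borel_measurable_continuous_onI[OF trig_continuous[OF p]])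
    qed (use Kb in simp)
  qed
qed

text \<open>Inner regularity of Lebesgue measure reduces the claim to compact sets.\<close>

lemma trig_approx_indicator:
  assumes L: "0 < L" and A [measurable]: "A \<in> sets borel"
  shows "trig_approx L (indicator A)"
proof (rule trig_approxI)
  show "sq_int L (indicator A)"
    by (rule sq_int_bounded[where B=1]) (simp, simp add: indicator_def)
  fix e :: real assume "e > 0"
  \<comment> \<open>Passing to the half-open cell costs a null set. It makes the closed set K
    bounded, hence compact, and places it where \<open>tor\<close> is injective.\<close>
  have "A \<inter> Dom' L \<in> sets lebesgue" using A by auto
  then obtain K where K: "closed K" "K \<subseteq> A \<inter> Dom' L" "emeasure lebesgue (A \<inter> Dom' L - K) < ennreal e"
    using sets_lebesgue_inner_closed[OF _ \<open>e > 0\<close>] by metis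
  have Kb [measurable]: "K \<in> sets borel" using K(1) by simp
  have "compact K"
  proof -
    have "K \<subseteq> Dom L" using K(2) by (auto simp: Dom_def Dom'_def less_imp_le)
    then show ?thesis by (metis Int_absorb1 compact_Dom compact_Int_closed K(1))
  qed
  have "ip L (\<lambda>x. indicator A x - indicator K x) (\<lambda>x. indicator A x - indicator K x)
      = (\<integral>x. indicator (A \<inter> Dom' L - K) x \<partial>cell L)"
    unfolding ip_def
  proof (rule integral_cong_AE)
    show "AE x in cell L. (indicator A x - indicator K x) * (indicator A x - indicator K x) = (indicator (A \<inter> Dom' L - K) x :: real)"
      using AE_Dom' by eventually_elim (use K(2) in \<open>auto simp: indicator_def\<close>)
  qed (rule measurable_cell, measurable)+
  also have "\<dots> = (\<integral>x. indicator (A \<inter> Dom' L - K) x \<partial>lborel)"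
  proof -
    have "indicator (Dom L) x * indicator (A \<inter> Dom' L - K) x = (indicator (A \<inter> Dom' L - K) x :: real)" for x
      by (auto simp: indicator_def Dom_def Dom'_def less_imp_le)
    then show ?thesis unfolding cell_def by (subst integral_restrict_space) (simp_all only: real_scaleR_def sets_Dom sets.Int_space_eq2 sets_lborel space_lborel)
  qed
  also have "\<dots> = measure lborel (A \<inter> Dom' L - K)" by simp
  also have "\<dots> < e"
  proof -
    have "emeasure lborel (A \<inter> Dom' L - K) < ennreal e" using K(3) by simp
    then have "enn2real (emeasure lborel (A \<inter> Dom' L - K)) < e"
      using \<open>e > 0\<close> by (cases "emeasure lborel (A \<inter> Dom' L - K)") (auto simp: ennreal_less_iff)
    then show ?thesis by (simp only: measure_def)
  qed
  finally show "\<exists>g. trig_approx L g \<and> ip L (\<lambda>x. indicator A x - g x) (\<lambda>x. indicator A x - g x) < e"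
    using trig_approx_indicator_compact[OF L \<open>compact K\<close>] K(2) by blast
qed

text \<open>Square integrability is a premise inside the induction formula: it cannot be assumed for
  the simple pieces, but passes down to them, because nonnegative summands and increasing
  approximants lie below the function.\<close>

lemma trig_approx_nonneg:
  assumes L: "0 < L" and f: "f \<in> borel_measurable borel" "\<And>x. 0 \<le> f x"
  shows "sq_int L f \<longrightarrow> trig_approx L f"
  using f
proof (induction rule: borel_measurable_induct_real)
  case (set A)
  then show ?case using trig_approx_indicator[OF L] by simp
next
  case (mult u c)
  show ?case
  \<comment> \<open>For c = 0 the premise carries no information on u, so the induction hypothesis
    is out of reach.\<close>
  proof (cases "c = 0")
    case True
    then show ?thesis using trig_trig_approx[OF trig_const[of L 0]] by simp
  next
    case False
    show ?thesis
    proof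
      assume "sq_int L (\<lambda>x. c * u x)"
      from sq_int_cmult[OF this, of "1 / c"] False have "sq_int L u" by simp
      with mult show "trig_approx L (\<lambda>x. c * u x)" by (simp add: trig_approx_cmult)
    qed
  qed
next
  case (add u v)
  have *: "sq_int L g" if "g \<in> borel_measurable borel" "\<And>x. 0 \<le> g x" "\<And>x. g x \<le> v x + u x" "sq_int L (\<lambda>x. v x + u x)" for g
    unfolding sq_int_iff
  proof
    show "integrable (cell L) (\<lambda>x. (g x)\<^sup>2)"
    proof (rule Bochner_Integration.integrable_bound)
      show "integrable (cell L) (\<lambda>x. (v x + u x)\<^sup>2)" using that(4) by (simp add: sq_int_iff)
      show "AE x in cell L. norm ((g x)\<^sup>2) \<le> norm ((v x + u x)\<^sup>2)"
        using that(2,3) by (intro AE_I2) (simp add: power_mono)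
      show "(\<lambda>x. (g x)\<^sup>2) \<in> borel_measurable (cell L)" using that(1) by (intro measurable_cell) measurable
    qed
  qed fact
  show ?case
  proof
    assume sq: "sq_int L (\<lambda>x. v x + u x)"
    have "sq_int L u" "sq_int L v"
      by (rule *[OF _ _ _ sq]; use add in simp)+
    then show "trig_approx L (\<lambda>x. v x + u x)" using add by (intro trig_approx_add) simp_all
  qed
next
  case (seq U)
  show ?case
  proof
    assume sq: "sq_int L f"
    have le: "U i x \<le> f x" for i x
      using seq by (intro incseq_le) (auto simp: incseq_def le_fun_def)
    have sqU: "(U i x)\<^sup>2 \<le> (f x)\<^sup>2" for i x using le seq(2) by (simp add: power_mono)
    have "sq_int L (U i)" for i
      unfolding sq_int_iff
    proof
      show "integrable (cell L) (\<lambda>x. (U i x)\<^sup>2)"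
      proof (rule Bochner_Integration.integrable_bound)
        show "integrable (cell L) (\<lambda>x. (f x)\<^sup>2)" using sq by (simp add: sq_int_iff)
        show "AE x in cell L. norm ((U i x)\<^sup>2) \<le> norm ((f x)\<^sup>2)"
          using sqU by (intro AE_I2) simp
        show "(\<lambda>x. (U i x)\<^sup>2) \<in> borel_measurable (cell L)" using seq(1) by (intro measurable_cell) measurable
      qed
    qed (rule seq)
    then have "trig_approx L (U i)" for i using seq by blast
    then show "trig_approx L f"
    proof (rule trig_approx_limit[OF sq])
      show "(\<lambda>n. ip L (\<lambda>x. f x - U n x) (\<lambda>x. f x - U n x)) \<longlonglongrightarrow> 0"
      proof (rule ip_tendsto_zero[where w="\<lambda>x. (f x)\<^sup>2"])
        show "AE x in cell L. (f x - U n x)\<^sup>2 \<le> (f x)\<^sup>2" for n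
          using le seq(2) by (intro AE_I2 power_mono) auto
        show "AE x in cell L. (\<lambda>n. U n x) \<longlonglongrightarrow> f x" using seq by (intro AE_I2) simp
        show "integrable (cell L) (\<lambda>x. (f x)\<^sup>2)" using sq by (simp add: sq_int_iff)
      qed (use seq f in simp_all)
    qed
  qed
qed

theorem trig_dense:
  assumes L: "0 < L" and f: "sq_int L f"
  shows "trig_approx L f"
proof -
  have m [measurable]: "f \<in> borel_measurable borel" using f by (simp add: sq_int_iff)
  have *: "sq_int L g" if [measurable]: "g \<in> borel_measurable borel" and "\<And>x. \<bar>g x\<bar> \<le> \<bar>f x\<bar>" for g
    unfolding sq_int_iff
  proof
    show "integrable (cell L) (\<lambda>x. (g x)\<^sup>2)"
    proof (rule Bochner_Integration.integrable_bound)
      show "integrable (cell L) (\<lambda>x. (f x)\<^sup>2)" using f by (simp add: sq_int_iff)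
      show "AE x in cell L. norm ((g x)\<^sup>2) \<le> norm ((f x)\<^sup>2)"
        using power_mono[OF that(2) abs_ge_zero, of _ 2] by (intro AE_I2) simp
    qed (rule measurable_cell, measurable)
  qed fact
  have "sq_int L (\<lambda>x. max 0 (f x))" "sq_int L (\<lambda>x. max 0 (- f x))"
    by (rule *; simp)+
  then have "trig_approx L (\<lambda>x. max 0 (f x))" "trig_approx L (\<lambda>x. max 0 (- f x))"
    using trig_approx_nonneg[OF L, of "\<lambda>x. max 0 (f x)"] trig_approx_nonneg[OF L, of "\<lambda>x. max 0 (- f x)"] by auto
  then have "trig_approx L (\<lambda>x. max 0 (f x) + (-1) * max 0 (- f x))"
    by (intro trig_approx_add trig_approx_cmult)
  moreover have "(\<lambda>x. max 0 (f x) + (-1) * max 0 (- f x)) = f" by (auto simp: max_def)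
  ultimately show ?thesis by simp
qed

section \<open>Fourier truncation\<close>

text \<open>The cut-off is on the squared length of k, so that r is directly comparable with
  eigenvalues of A.\<close>

definition Lam :: "real \<Rightarrow> real \<Rightarrow> pt set" where
  "Lam L r = {k \<in> Lat L. k \<bullet> k \<le> r}"

definition fc :: "real \<Rightarrow> (pt \<Rightarrow> real) \<Rightarrow> pt \<Rightarrow> real" where
  "fc L f k = ip L f (\<lambda>x. cos (k \<bullet> x))"

definition fs :: "real \<Rightarrow> (pt \<Rightarrow> real) \<Rightarrow> pt \<Rightarrow> real" where
  "fs L f k = ip L f (\<lambda>x. sin (k \<bullet> x))"

text \<open>The sum contains both $k$ and $-k$, hence the factor $1/L^2$ also for $k \neq 0$.\<close>

definition fmul :: "real \<Rightarrow> real \<Rightarrow> (real \<Rightarrow> real) \<Rightarrow> (pt \<Rightarrow> real) \<Rightarrow> pt \<Rightarrow> real" where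
  "fmul L r m f x = (\<Sum>k\<in>Lam L r. m (k \<bullet> k) / L\<^sup>2 * (fc L f k * cos (k \<bullet> x) + fs L f k * sin (k \<bullet> x)))"

abbreviation fpart :: "real \<Rightarrow> real \<Rightarrow> (pt \<Rightarrow> real) \<Rightarrow> pt \<Rightarrow> real" where
  "fpart L r \<equiv> fmul L r (\<lambda>_. 1)"

section \<open>Counting lattice points\<close>

definition lpt :: "real \<Rightarrow> int \<times> int \<Rightarrow> pt" where
  "lpt L = (\<lambda>(a, b). vector [2 * pi / L * a, 2 * pi / L * b])"

lemma lpt_inner: "lpt L (a, b) \<bullet> lpt L (a, b) = (2 * pi / L)\<^sup>2 * (a\<^sup>2 + b\<^sup>2)"
  by (simp add: lpt_def inner_vec_def sum_2 power2_eq_square algebra_simps add_divide_distrib)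

lemma Lat_lpt: "0 < L \<Longrightarrow> k \<in> Lat L \<Longrightarrow> \<exists>a b. k = lpt L (a, b)"
proof -
  assume "k \<in> Lat L"
  then obtain a b :: int where "k $ 1 = 2 * pi * a / L" "k $ 2 = 2 * pi * b / L"
    unfolding Lat_def by blast
  then have "k = lpt L (a, b)" by (simp add: lpt_def vec_eq_iff forall_2)
  then show ?thesis by blast
qed

lemma Lam_subset:
  assumes L: "0 < L"
  obtains M :: nat where "Lam L r \<subseteq> lpt L ` ({- int M..int M} \<times> {- int M..int M})"
proof -
  obtain M :: nat where M: "r / (2 * pi / L)\<^sup>2 < real M" using reals_Archimedean2 by blast
  have c: "(2 * pi / L)\<^sup>2 > 0" using L by simp
  show ?thesis
  proof (rule that[of M], rule subsetI)
    fix k assume k: "k \<in> Lam L r"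
    then obtain a b where ab: "k = lpt L (a, b)" using Lat_lpt[OF L, of k] unfolding Lam_def by blast
    have "(2 * pi / L)\<^sup>2 * (real_of_int a ^ 2 + real_of_int b ^ 2) \<le> r" using k unfolding ab Lam_def by (simp add: lpt_inner)
    then have "real_of_int a ^ 2 + real_of_int b ^ 2 \<le> r / (2 * pi / L)\<^sup>2"
      using c by (simp add: pos_le_divide_eq mult.commute)
    then have "real_of_int a ^ 2 + real_of_int b ^ 2 < real M" using M by linarith
    then have "real_of_int (a\<^sup>2 + b\<^sup>2) < real_of_int (int M)" by simp
    then have ab2: "a\<^sup>2 + b\<^sup>2 < int M" by (simp only: of_int_less_iff)
    have ge: "\<bar>z\<bar> \<le> z\<^sup>2" for z :: int
    proof (cases "z = 0")
      case False
      then have "1 \<le> \<bar>z\<bar>" by linarith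
      from mult_left_mono[OF this, of "\<bar>z\<bar>"] show ?thesis by (simp add: power2_eq_square flip: abs_mult)
    qed simp
    have "\<bar>a\<bar> \<le> int M" "\<bar>b\<bar> \<le> int M"
      using ab2 ge[of a] ge[of b] zero_le_power2[of a] zero_le_power2[of b] by linarith+
    then show "k \<in> lpt L ` ({- int M..int M} \<times> {- int M..int M})" unfolding ab by (intro imageI) auto
  qed
qed

lemma finite_Lam [simp]: assumes "0 < L" shows "finite (Lam L r)"
proof -
  obtain M :: nat where "Lam L r \<subseteq> lpt L ` ({- int M..int M} \<times> {- int M..int M})" using Lam_subset[OF assms] .
  then show ?thesis by (rule finite_subset) simp
qed

text \<open>The term -4/(M+1) makes the induction close: the two new summands are bounded by
  4/((M+1)(M+2)), which telescopes. At M = 0 both sides equal 1.\<close>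

lemma sum_inverse_square_int: "(\<Sum>a\<in>{- int M..int M}. 1 / (1 + (real_of_int a)\<^sup>2)) \<le> 5 - 4 / (real M + 1)"
proof (induction M)
  case (Suc M)
  have "{- int (Suc M)..int (Suc M)} = insert (- int (Suc M)) (insert (int (Suc M)) {- int M..int M})" by auto
  then have "(\<Sum>a\<in>{- int (Suc M)..int (Suc M)}. 1 / (1 + (real_of_int a)\<^sup>2))
      = 2 / (1 + (real M + 1)\<^sup>2) + (\<Sum>a\<in>{- int M..int M}. 1 / (1 + (real_of_int a)\<^sup>2))"
    by (simp add: power2_eq_square algebra_simps)
  also have "\<dots> \<le> 2 / (1 + (real M + 1)\<^sup>2) + (5 - 4 / (real M + 1))" using Suc by simp
  also have "\<dots> \<le> 5 - 4 / (real (Suc M) + 1)"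
  proof -
    have "2 / (1 + (real M + 1)\<^sup>2) \<le> 4 / ((real M + 1) * (real M + 2))"
    proof (rule mult_imp_div_pos_le)
      have "2 * ((real M + 1) * (real M + 2)) \<le> 4 * (1 + (real M + 1)\<^sup>2)"
        by (simp add: power2_eq_square algebra_simps)
      then show "2 \<le> 4 / ((real M + 1) * (real M + 2)) * (1 + (real M + 1)\<^sup>2)"
        by (simp add: pos_le_divide_eq)
    qed (simp add: add_pos_nonneg)
    also have "\<dots> = 4 / (real M + 1) - 4 / (real M + 2)" by (simp add: field_simps)
    finally show ?thesis by (simp add: add.commute)
  qed
  finally show ?case .
qed simp

text \<open>Summability of |k|^{-4} in the plane, uniformly in r. Since a^2 + b^2 \<ge> 1 off the
  origin, (1 + a^2)(1 + b^2) \<le> 4 (a^2 + b^2)^2. The double sum then factors into two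
  one-dimensional sums of size at most 5, which gives 4 * 25 = 100.\<close>

lemma sum_Lam_bound:
  assumes L: "0 < L"
  shows "(\<Sum>k\<in>Lam L r - {0}. 1 / (k \<bullet> k)\<^sup>2) \<le> 100 / (2 * pi / L) ^ 4"
proof -
  obtain M :: nat where M: "Lam L r \<subseteq> lpt L ` ({- int M..int M} \<times> {- int M..int M})" using Lam_subset[OF L] .
  let ?Q = "{- int M..int M}" and ?c = "2 * pi / L"
  define w where "w = (\<lambda>a::int. 1 / (1 + (real_of_int a)\<^sup>2))"
  have c: "?c > 0" using L by simp
  have inj: "inj_on (lpt L) A" for A
    using L by (auto simp: inj_on_def lpt_def vec_eq_iff forall_2)
  have z: "lpt L (0, 0) = 0" by (simp add: lpt_def vec_eq_iff forall_2)
  have "(\<Sum>k\<in>Lam L r - {0}. 1 / (k \<bullet> k)\<^sup>2) \<le> (\<Sum>k\<in>lpt L ` (?Q \<times> ?Q - {(0, 0)}). 1 / (k \<bullet> k)\<^sup>2)"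
  proof (rule sum_mono2)
    show "Lam L r - {0} \<subseteq> lpt L ` (?Q \<times> ?Q - {(0, 0)})"
    proof
      fix k assume k: "k \<in> Lam L r - {0}"
      then obtain p where "p \<in> ?Q \<times> ?Q" "k = lpt L p" using M by blast
      with k z show "k \<in> lpt L ` (?Q \<times> ?Q - {(0, 0)})" by (cases "p = (0, 0)") auto
    qed
  qed auto
  also have "\<dots> = (\<Sum>p\<in>?Q \<times> ?Q - {(0, 0)}. 1 / (lpt L p \<bullet> lpt L p)\<^sup>2)"
    by (simp add: sum.reindex[OF inj])
  also have "\<dots> \<le> (\<Sum>p\<in>?Q \<times> ?Q - {(0, 0)}. 4 / ?c ^ 4 * (w (fst p) * w (snd p)))"
  proof (rule sum_mono)
    fix p assume p: "p \<in> ?Q \<times> ?Q - {(0, 0)}"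
    obtain a b where ab: "p = (a, b)" by force
    define s where "s = (real_of_int a)\<^sup>2 + (real_of_int b)\<^sup>2"
    have "a\<^sup>2 + b\<^sup>2 \<noteq> 0" using p ab by (simp add: sum_power2_eq_zero_iff)
    then have "1 \<le> a\<^sup>2 + b\<^sup>2" using zero_le_power2[of a] zero_le_power2[of b] by linarith
    then have "real_of_int 1 \<le> real_of_int (a\<^sup>2 + b\<^sup>2)" by (simp only: of_int_le_iff)
    then have s1: "1 \<le> s" by (simp add: s_def)
    have "(1 + (real_of_int a)\<^sup>2) * (1 + (real_of_int b)\<^sup>2) \<le> (1 + s) * (1 + s)"
      by (intro mult_mono) (auto simp: s_def)
    also have "\<dots> \<le> (2 * s) * (2 * s)" using s1 by (intro mult_mono) auto
    finally have *: "(1 + (real_of_int a)\<^sup>2) * (1 + (real_of_int b)\<^sup>2) \<le> 4 * s\<^sup>2" by (simp add: power2_eq_square)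
    have pos: "0 < (1 + (real_of_int a)\<^sup>2) * (1 + (real_of_int b)\<^sup>2)"
      by (intro mult_pos_pos) (auto intro: add_pos_nonneg)
    have "1 / (lpt L p \<bullet> lpt L p)\<^sup>2 = 1 / (?c ^ 4 * s\<^sup>2)"
      unfolding ab lpt_inner s_def by (simp add: power_mult_distrib power_divide flip: power_mult)
    also have "\<dots> = 4 / ?c ^ 4 * (1 / (4 * s\<^sup>2))" by simp
    also have "\<dots> \<le> 4 / ?c ^ 4 * (1 / ((1 + (real_of_int a)\<^sup>2) * (1 + (real_of_int b)\<^sup>2)))"
      using * pos c s1 by (intro mult_left_mono divide_left_mono mult_pos_pos[OF _ pos]) auto
    finally show "1 / (lpt L p \<bullet> lpt L p)\<^sup>2 \<le> 4 / ?c ^ 4 * (w (fst p) * w (snd p))"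
      by (simp add: w_def ab)
  qed
  also have "\<dots> \<le> (\<Sum>p\<in>?Q \<times> ?Q. 4 / ?c ^ 4 * (w (fst p) * w (snd p)))"
    using c by (intro sum_mono2) (auto simp: w_def intro!: mult_nonneg_nonneg divide_nonneg_nonneg add_nonneg_nonneg)
  also have "\<dots> = 4 / ?c ^ 4 * (sum w ?Q * sum w ?Q)"
    unfolding sum_product sum.cartesian_product split_def by (simp only: sum_distrib_left)
  also have "\<dots> \<le> 4 / ?c ^ 4 * (5 * 5)"
  proof (intro mult_left_mono mult_mono)
    have "sum w ?Q \<le> 5 - 4 / (real M + 1)" unfolding w_def by (rule sum_inverse_square_int)
    also have "\<dots> \<le> 5" by simp
    finally show "sum w ?Q \<le> 5" "sum w ?Q \<le> 5" by auto
    show "0 \<le> sum w ?Q" by (intro sum_nonneg) (simp add: w_def)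
  qed (use c in auto)
  finally show ?thesis by simp
qed

section \<open>Orthogonality of the waves and Fourier coefficients\<close>

lemma measure_cell: assumes "0 < L" shows "(\<integral>x. 1 \<partial>cell L) = L\<^sup>2"
proof -
  have ne: "cbox (0::pt) (\<chi> i. L) \<noteq> {}" using assms by (simp add: interval_ne_empty_cart)
  have "(\<integral>x. 1 \<partial>cell L) = measure lborel (Dom L)"
    unfolding cell_def by (subst integral_restrict_space) auto
  also have "\<dots> = L\<^sup>2"
    using content_cbox_cart[OF ne] by (simp add: Dom_cbox)
  finally show ?thesis .
qed

text \<open>A wave with some k_i \<noteq> 0 is, up to the factor k_i, a partial derivative of a
  periodic function.\<close>

lemma integral_cell_trig:
  assumes L: "0 < L" and k: "k \<in> Lat L"
  shows "(\<integral>x. cos (k \<bullet> x) \<partial>cell L) = (if k = 0 then L\<^sup>2 else 0)" "(\<integral>x. sin (k \<bullet> x) \<partial>cell L) = 0"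
proof -
  have *: "(\<integral>x. cos (k \<bullet> x) \<partial>cell L) = 0 \<and> (\<integral>x. sin (k \<bullet> x) \<partial>cell L) = 0" if k0: "k \<noteq> 0"
  proof -
    obtain i where i: "k $ i \<noteq> 0" using k0 unfolding vec_eq_iff zero_index by blast
    have z: "(\<integral>x. pd i f x \<partial>cell L) = 0" if "trig L f" for f
      using that by (intro integral_pd_periodic[OF L] trig_periodic[OF L] trig_differentiable trig_continuous trig_pd)
    show ?thesis
      using z[OF trig_sin1[OF k]] z[OF trig_cos1[OF k]] i by (simp add: pd_sin pd_cos)
  qed
  then show "(\<integral>x. cos (k \<bullet> x) \<partial>cell L) = (if k = 0 then L\<^sup>2 else 0)" "(\<integral>x. sin (k \<bullet> x) \<partial>cell L) = 0"
    using measure_cell[OF L] by (cases "k = 0"; simp)+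
qed

lemma sq_int_cos [simp]: "sq_int L (\<lambda>x. cos (k \<bullet> x))" and sq_int_sin [simp]: "sq_int L (\<lambda>x. sin (k \<bullet> x))"
  by (auto intro!: sq_int_continuous continuous_intros)

lemma integrable_cos [simp]: "integrable (cell L) (\<lambda>x. cos (k \<bullet> x))" and integrable_sin [simp]: "integrable (cell L) (\<lambda>x. sin (k \<bullet> x))"
  by (auto intro!: integrable_cell_continuous continuous_intros)

text \<open>The waves for k and -k have the same cosine and opposite sines, hence two Kronecker
  terms. They coincide at k = m = 0, where they give the full area for the cosine and 0 for the
  sine.\<close>

lemma ip_trig:
  assumes L: "0 < L" and k: "k \<in> Lat L" and m: "m \<in> Lat L"
  shows "ip L (\<lambda>x. cos (k \<bullet> x)) (\<lambda>x. cos (m \<bullet> x)) = L\<^sup>2 / 2 * ((if k = m then 1 else 0) + (if k = - m then 1 else 0))"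
    and "ip L (\<lambda>x. sin (k \<bullet> x)) (\<lambda>x. sin (m \<bullet> x)) = L\<^sup>2 / 2 * ((if k = m then 1 else 0) - (if k = - m then 1 else 0))"
    and "ip L (\<lambda>x. sin (k \<bullet> x)) (\<lambda>x. cos (m \<bullet> x)) = 0"
    and "ip L (\<lambda>x. cos (k \<bullet> x)) (\<lambda>x. sin (m \<bullet> x)) = 0"
proof -
  have e: "cos (k \<bullet> x) * cos (m \<bullet> x) = 1/2 * cos ((k - m) \<bullet> x) + 1/2 * cos ((k + m) \<bullet> x)"
    "sin (k \<bullet> x) * sin (m \<bullet> x) = 1/2 * cos ((k - m) \<bullet> x) - 1/2 * cos ((k + m) \<bullet> x)"
    "sin (k \<bullet> x) * cos (m \<bullet> x) = 1/2 * sin ((k - m) \<bullet> x) + 1/2 * sin ((k + m) \<bullet> x)"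
    "cos (k \<bullet> x) * sin (m \<bullet> x) = 1/2 * sin ((k + m) \<bullet> x) - 1/2 * sin ((k - m) \<bullet> x)" for x
    by (simp_all add: inner_add_left inner_diff_left cos_add cos_diff sin_add sin_diff field_simps)
  note I = integral_cell_trig[OF L Lat_add[OF k m]] integral_cell_trig[OF L Lat_diff[OF k m]]
  have [simp]: "k - m = 0 \<longleftrightarrow> k = m" "k + m = 0 \<longleftrightarrow> k = - m" by (simp_all add: eq_neg_iff_add_eq_0)
  show "ip L (\<lambda>x. cos (k \<bullet> x)) (\<lambda>x. cos (m \<bullet> x)) = L\<^sup>2 / 2 * ((if k = m then 1 else 0) + (if k = - m then 1 else 0))"
    unfolding ip_def e by (simp add: I)
  show "ip L (\<lambda>x. sin (k \<bullet> x)) (\<lambda>x. sin (m \<bullet> x)) = L\<^sup>2 / 2 * ((if k = m then 1 else 0) - (if k = - m then 1 else 0))"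
    unfolding ip_def e by (simp add: I)
  show "ip L (\<lambda>x. sin (k \<bullet> x)) (\<lambda>x. cos (m \<bullet> x)) = 0"
    unfolding ip_def e by (simp add: I)
  show "ip L (\<lambda>x. cos (k \<bullet> x)) (\<lambda>x. sin (m \<bullet> x)) = 0"
    unfolding ip_def e by (simp add: I)
qed

lemma Lam_Lat: "k \<in> Lam L r \<Longrightarrow> k \<in> Lat L"
  by (simp add: Lam_def)

lemma fc_uminus: "fc L f (- k) = fc L f k" and fs_uminus: "fs L f (- k) = - fs L f k"
  by (simp_all add: fc_def fs_def ip_def)

lemma trig_fmul: "trig L (fmul L r m f)"
  unfolding fmul_def by (intro trig_sum trig_cmult trig.add trig_cos1 trig_sin1) (auto intro: Lam_Lat)

lemma sq_int_fmul [simp]: "sq_int L (fmul L r m f)"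
  by (rule trig_sq_int[OF trig_fmul])

lemma ip_fmul:
  assumes "sq_int L g"
  shows "ip L (fmul L r m f) g = (\<Sum>k\<in>Lam L r. m (k \<bullet> k) / L\<^sup>2 * (fc L f k * fc L g k + fs L f k * fs L g k))"
proof -
  have "ip L (fmul L r m f) g = (\<Sum>k\<in>Lam L r. ip L (\<lambda>x. m (k \<bullet> k) / L\<^sup>2 * (fc L f k * cos (k \<bullet> x) + fs L f k * sin (k \<bullet> x))) g)"
    unfolding fmul_def by (rule ip_sum_left) (intro sq_int_cmult sq_int_add sq_int_cos sq_int_sin assms)+
  also have "\<dots> = (\<Sum>k\<in>Lam L r. m (k \<bullet> k) / L\<^sup>2 * (fc L f k * fc L g k + fs L f k * fs L g k))"
    by (intro sum.cong refl, subst ip_cmult_left, subst ip_add_left)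
       (auto intro!: sq_int_cmult assms simp: fc_def fs_def ip_commute[of L g])
  finally show ?thesis .
qed

text \<open>The summands j = k and j = -k contribute one half each, and the parity of the
  coefficients makes them equal. For k = 0 the two halves come from the same summand.\<close>

lemma fc_fmul:
  assumes L: "0 < L" and k: "k \<in> Lat L"
  shows "fc L (fmul L r m f) k = (if k \<bullet> k \<le> r then m (k \<bullet> k) * fc L f k else 0)"
    and "fs L (fmul L r m f) k = (if k \<bullet> k \<le> r then m (k \<bullet> k) * fs L f k else 0)"
proof -
  have mem: "k \<in> Lam L r \<longleftrightarrow> k \<bullet> k \<le> r" "- k \<in> Lam L r \<longleftrightarrow> k \<bullet> k \<le> r"
    using k Lat_uminus by (auto simp: Lam_def)
  have L2: "L\<^sup>2 \<noteq> 0" using L by simp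
  have kk: "j = - k \<longleftrightarrow> k = - j" for j by auto
  have "fc L (fmul L r m f) k = (\<Sum>j\<in>Lam L r. m (j \<bullet> j) / L\<^sup>2 * (fc L f j * (L\<^sup>2 / 2 * ((if k = j then 1 else 0) + (if k = - j then 1 else 0)))))"
    unfolding fc_def[of L "fmul L r m f"] ip_fmul[OF sq_int_cos]
    by (intro sum.cong refl) (simp add: fc_def[of L "\<lambda>x. cos (k \<bullet> x)"] fs_def[of L "\<lambda>x. cos (k \<bullet> x)"] ip_trig[OF L k] Lam_Lat)
  also have "\<dots> = (\<Sum>j\<in>Lam L r. (if k = j then m (j \<bullet> j) * fc L f j / 2 else 0) + (if - k = j then m (j \<bullet> j) * fc L f j / 2 else 0))"
    using L2 by (intro sum.cong refl) auto
  also have "\<dots> = (if k \<bullet> k \<le> r then m (k \<bullet> k) * fc L f k else 0)"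
    using L by (simp add: sum.distrib sum.delta mem fc_uminus)
  finally show "fc L (fmul L r m f) k = (if k \<bullet> k \<le> r then m (k \<bullet> k) * fc L f k else 0)" .
  have "fs L (fmul L r m f) k = (\<Sum>j\<in>Lam L r. m (j \<bullet> j) / L\<^sup>2 * (fs L f j * (L\<^sup>2 / 2 * ((if k = j then 1 else 0) - (if k = - j then 1 else 0)))))"
    unfolding fs_def[of L "fmul L r m f"] ip_fmul[OF sq_int_sin]
    by (intro sum.cong refl) (simp add: fc_def[of L "\<lambda>x. sin (k \<bullet> x)"] fs_def[of L "\<lambda>x. sin (k \<bullet> x)"] ip_trig[OF L k] Lam_Lat)
  also have "\<dots> = (\<Sum>j\<in>Lam L r. (if k = j then m (j \<bullet> j) * fs L f j / 2 else 0) - (if - k = j then m (j \<bullet> j) * fs L f j / 2 else 0))"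
    using L2 by (intro sum.cong refl) auto
  also have "\<dots> = (if k \<bullet> k \<le> r then m (k \<bullet> k) * fs L f k else 0)"
    using L by (simp add: sum_subtractf sum.delta mem fs_uminus)
  finally show "fs L (fmul L r m f) k = (if k \<bullet> k \<le> r then m (k \<bullet> k) * fs L f k else 0)" .
qed

lemma ip_fmul_fmul:
  assumes L: "0 < L" and f: "sq_int L f" and g: "sq_int L g"
  shows "ip L (fmul L r m f) (fmul L r m' g) = ip L (fmul L r (\<lambda>s. m s * m' s) f) g"
  unfolding ip_fmul[OF sq_int_fmul] ip_fmul[OF g]
  by (intro sum.cong refl) (auto simp: fc_fmul[OF L] Lam_def algebra_simps)

lemma ip_fmul_left_right:
  assumes "sq_int L f" "sq_int L g" shows "ip L (fmul L r m f) g = ip L f (fmul L r m g)"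
  unfolding ip_commute[of L f] ip_fmul[OF assms(1)] ip_fmul[OF assms(2)] by (simp add: algebra_simps)

lemma fpart_orthogonal:
  assumes L: "0 < L" and f: "sq_int L f"
  shows "ip L (\<lambda>x. f x - fpart L r f x) (fpart L r f) = 0"
  using ip_fmul_fmul[OF L f f, of r "\<lambda>_. 1" "\<lambda>_. 1"]
  by (simp add: ip_diff_left f ip_commute[of L f])

text \<open>The residual after truncation has nonnegative square norm and is orthogonal to the
  truncation. The bound is uniform in r and turns weak derivatives into summability
  statements.\<close>

lemma Bessel_Fourier:
  assumes L: "0 < L" and f: "sq_int L f"
  shows "(\<Sum>k\<in>Lam L r. ((fc L f k)\<^sup>2 + (fs L f k)\<^sup>2) / L\<^sup>2) \<le> ip L f f"
proof -
  let ?S = "fpart L r f"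
  have "0 \<le> ip L (\<lambda>x. f x - ?S x) (\<lambda>x. f x - ?S x)" by simp
  also have "\<dots> = ip L (\<lambda>x. f x - ?S x) f"
    using fpart_orthogonal[OF L f, of r] by (subst ip_diff_right) (auto intro!: sq_int_diff f)
  also have "\<dots> = ip L f f - ip L ?S f" by (simp add: ip_diff_left f)
  also have "ip L ?S f = (\<Sum>k\<in>Lam L r. ((fc L f k)\<^sup>2 + (fs L f k)\<^sup>2) / L\<^sup>2)"
    unfolding ip_fmul[OF f] by (intro sum.cong refl) (simp add: power2_eq_square)
  finally show ?thesis by simp
qed

lemma fpart_residual_trig:
  assumes L: "0 < L" and f: "sq_int L f" and p: "trig L p"
  shows "\<exists>r0. \<forall>r\<ge>r0. ip L (\<lambda>x. f x - fpart L r f x) p = 0"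
  using p
proof (induction rule: trig.induct)
  case (cos k a)
  have "ip L (\<lambda>x. f x - fpart L r f x) (\<lambda>x. a * cos (k \<bullet> x)) = a * (fc L f k - fc L (fpart L r f) k)" for r
    by (simp add: ip_diff_left f fc_def)
  then show ?case by (intro exI[of _ "k \<bullet> k"] allI impI) (simp only: fc_fmul(1)[OF L cos], simp)
next
  case (sin k a)
  have "ip L (\<lambda>x. f x - fpart L r f x) (\<lambda>x. a * sin (k \<bullet> x)) = a * (fs L f k - fs L (fpart L r f) k)" for r
    by (simp add: ip_diff_left f fs_def)
  then show ?case by (intro exI[of _ "k \<bullet> k"] allI impI) (simp only: fc_fmul(2)[OF L sin], simp)
next
  case (add p q)
  then obtain r1 r2 where "\<forall>r\<ge>r1. ip L (\<lambda>x. f x - fpart L r f x) p = 0" "\<forall>r\<ge>r2. ip L (\<lambda>x. f x - fpart L r f x) q = 0" by blast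
  then show ?case using add.hyps
    by (intro exI[of _ "max r1 r2"]) (auto simp: ip_add_right trig_sq_int sq_int_diff f)
qed

text \<open>For large n the residual d is orthogonal to a fixed approximant p and always to the
  truncation, so |d|^2 = (d, f - p). Cauchy-Schwarz then bounds |d| by |f - p|.\<close>

theorem fpart_tendsto:
  assumes L: "0 < L" and f: "sq_int L f"
  shows "(\<lambda>n. ip L (\<lambda>x. f x - fpart L (real n) f x) (\<lambda>x. f x - fpart L (real n) f x)) \<longlonglongrightarrow> 0"
proof (rule LIMSEQ_I)
  fix e :: real assume "e > 0"
  obtain p where p: "trig L p" "ip L (\<lambda>x. f x - p x) (\<lambda>x. f x - p x) < e"
    using trig_approxD[OF trig_dense[OF L f] \<open>e > 0\<close>] .
  obtain r0 where r0: "\<And>r. r \<ge> r0 \<Longrightarrow> ip L (\<lambda>x. f x - fpart L r f x) p = 0"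
    using fpart_residual_trig[OF L f p(1)] by blast
  obtain n0 :: nat where n0: "r0 \<le> real n0" using real_arch_simple by blast
  have "ip L (\<lambda>x. f x - fpart L (real n) f x) (\<lambda>x. f x - fpart L (real n) f x) < e" if "n \<ge> n0" for n
  proof -
    let ?d = "\<lambda>x. f x - fpart L (real n) f x"
    have sq: "sq_int L p" "sq_int L ?d" using p(1) f by (auto intro: trig_sq_int sq_int_diff)
    have "ip L ?d p = 0" using that n0 by (intro r0) simp
    then have "ip L ?d (\<lambda>x. f x - p x) = ip L ?d f" using sq f by (simp add: ip_diff_right)
    also have "\<dots> = ip L ?d ?d"
      using fpart_orthogonal[OF L f, of "real n"] sq f by (simp add: ip_diff_right[of L f])
    finally have eq: "ip L ?d (\<lambda>x. f x - p x) = ip L ?d ?d" .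
    have "(ip L ?d ?d)\<^sup>2 \<le> ip L ?d ?d * ip L (\<lambda>x. f x - p x) (\<lambda>x. f x - p x)"
      using ip_Cauchy_Schwarz[OF sq(2) sq_int_diff[OF f sq(1)]] by (simp only: eq)
    then have "ip L ?d ?d \<le> ip L (\<lambda>x. f x - p x) (\<lambda>x. f x - p x)"
      using ip_nonneg[of L ?d] ip_nonneg[of L "\<lambda>x. f x - p x"]
      by (cases "ip L ?d ?d = 0") (auto simp: power2_eq_square)
    then show ?thesis using p(2) by simp
  qed
  then show "\<exists>no. \<forall>n\<ge>no. norm (ip L (\<lambda>x. f x - fpart L (real n) f x) (\<lambda>x. f x - fpart L (real n) f x) - 0) < e"
    by auto
qed

text \<open>If all frequencies lie on the sphere |k|^2 = s, truncations beyond s no longer change,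
  while they converge to f; so f equals this truncation in L^2. The conclusion is stated through
  inner products because f is determined only up to null sets.\<close>

lemma fpart_ident_of_support:
  assumes L: "0 < L" and f: "sq_int L f"
    and supp: "\<And>k. k \<in> Lat L \<Longrightarrow> k \<bullet> k \<noteq> s \<Longrightarrow> fc L f k = 0 \<and> fs L f k = 0"
    and g: "sq_int L g" and r: "s \<le> r"
  shows "ip L (fpart L r f) g = ip L f g"
proof -
  have eq: "fpart L r' f = fpart L r f" if "s \<le> r'" for r'
  proof
    fix x
    have *: "fpart L r'' f x = (\<Sum>k\<in>Lam L s. 1 / L\<^sup>2 * (fc L f k * cos (k \<bullet> x) + fs L f k * sin (k \<bullet> x)))" if "s \<le> r''" for r''
      unfolding fmul_def
    proof (rule sum.mono_neutral_right)
      show "Lam L s \<subseteq> Lam L r''" using that by (auto simp: Lam_def)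
      show "\<forall>i\<in>Lam L r'' - Lam L s. 1 / L\<^sup>2 * (fc L f i * cos (i \<bullet> x) + fs L f i * sin (i \<bullet> x)) = 0"
      proof
        fix i assume "i \<in> Lam L r'' - Lam L s"
        then have "fc L f i = 0 \<and> fs L f i = 0" by (intro supp) (auto simp: Lam_def)
        then show "1 / L\<^sup>2 * (fc L f i * cos (i \<bullet> x) + fs L f i * sin (i \<bullet> x)) = 0" by simp
      qed
    qed (simp add: L)
    show "fpart L r' f x = fpart L r f x" using *[OF that] *[OF r] by simp
  qed
  obtain n0 :: nat where n0: "s \<le> real n0" using real_arch_simple by blast
  let ?d = "\<lambda>x. f x - fpart L r f x"
  have "\<forall>\<^sub>F n in sequentially. ip L (\<lambda>x. f x - fpart L (real n) f x) (\<lambda>x. f x - fpart L (real n) f x) = ip L ?d ?d"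
    unfolding eventually_sequentially
  proof (intro exI[of _ n0] allI impI)
    fix n assume "n0 \<le> n"
    then have "s \<le> real n" using n0 by linarith
    from eq[OF this] show "ip L (\<lambda>x. f x - fpart L (real n) f x) (\<lambda>x. f x - fpart L (real n) f x) = ip L ?d ?d" by simp
  qed
  then have "ip L ?d ?d = 0"
    using LIMSEQ_unique[OF fpart_tendsto[OF L f] tendsto_eventually] by auto
  then have "(ip L ?d g)\<^sup>2 \<le> 0"
    using ip_Cauchy_Schwarz[of L ?d g] f g by (simp add: sq_int_diff)
  then have "ip L ?d g = 0" by simp
  then show ?thesis using f g by (simp add: ip_diff_left)
qed

section \<open>Weak derivatives on the Fourier side\<close>

lemma test_cos: "0 < L \<Longrightarrow> k \<in> Lat L \<Longrightarrow> test L (\<lambda>x. cos (k \<bullet> x))"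
  and test_sin: "0 < L \<Longrightarrow> k \<in> Lat L \<Longrightarrow> test L (\<lambda>x. sin (k \<bullet> x))"
  by (auto intro: trig_test trig_cos1 trig_sin1)

lemma weak_pd_ip: "weak_pd L i f g \<longleftrightarrow> (\<forall>\<phi>. test L \<phi> \<longrightarrow> ip L f (pd i \<phi>) = - ip L g \<phi>)"
  by (simp add: weak_pd_def LINT_Dom ip_def)

lemma pd_cos_fun: "pd i (\<lambda>x. cos (k \<bullet> x)) = (\<lambda>x. - k $ i * sin (k \<bullet> x))"
  and pd_sin_fun: "pd i (\<lambda>x. sin (k \<bullet> x)) = (\<lambda>x. k $ i * cos (k \<bullet> x))"
  by (auto simp: pd_cos pd_sin)

text \<open>Cosine and sine waves are admissible test functions. This is the real form of
  multiplying the k-th coefficient by the imaginary number i k_i: cosine and sine parts are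
  exchanged.\<close>

lemma fc_weak_pd:
  assumes L: "0 < L" and k: "k \<in> Lat L" and w: "weak_pd L i f g"
  shows "fc L g k = k $ i * fs L f k" "fs L g k = - k $ i * fc L f k"
proof -
  have "ip L f (pd i (\<lambda>x. cos (k \<bullet> x))) = - fc L g k" "ip L f (pd i (\<lambda>x. sin (k \<bullet> x))) = - fs L g k"
    using w test_cos[OF L k] test_sin[OF L k] unfolding weak_pd_ip fc_def fs_def by blast+
  then have "ip L f (\<lambda>x. - k $ i * sin (k \<bullet> x)) = - fc L g k" "ip L f (\<lambda>x. k $ i * cos (k \<bullet> x)) = - fs L g k"
    by (simp_all only: pd_cos_fun pd_sin_fun)
  then show "fc L g k = k $ i * fs L f k" "fs L g k = - k $ i * fc L f k"
    unfolding ip_cmult_right by (simp_all add: fc_def fs_def)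
qed

lemma pd_fmul_expand:
  "pd i (fmul L r m f) x = (\<Sum>k\<in>Lam L r. m (k \<bullet> k) / L\<^sup>2 * (k $ i * fs L f k * cos (k \<bullet> x) - k $ i * fc L f k * sin (k \<bullet> x)))"
proof -
  have "((fmul L r m f) has_derivative (\<lambda>h. \<Sum>k\<in>Lam L r. m (k \<bullet> k) / L\<^sup>2 * (fc L f k * (- (k \<bullet> h) * sin (k \<bullet> x)) + fs L f k * ((k \<bullet> h) * cos (k \<bullet> x))))) (at x)"
    unfolding fmul_def[abs_def]
  proof (rule has_derivative_sum)
    show "((\<lambda>x. c * (a * cos (k \<bullet> x) + b * sin (k \<bullet> x))) has_derivative
        (\<lambda>h. c * (a * (- (k \<bullet> h) * sin (k \<bullet> x)) + b * ((k \<bullet> h) * cos (k \<bullet> x))))) (at x)" for a b c k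
      by (auto intro!: derivative_eq_intros)
  qed
  from pd_eq[OF this, of i] show ?thesis by (simp add: inner_axis algebra_simps)
qed

text \<open>Truncation commutes with differentiation. Hence the classical gradient of a truncated
  field is the truncation of the weak gradient and converges to it in L^2.\<close>

lemma pd_fmul:
  assumes L: "0 < L" and w: "weak_pd L i f g"
  shows "pd i (fmul L r m f) = fmul L r m g"
proof
  fix x
  show "pd i (fmul L r m f) x = fmul L r m g x"
    unfolding pd_fmul_expand unfolding fmul_def
    by (intro sum.cong refl) (simp add: fc_weak_pd[OF L _ w] Lam_Lat)
qed

lemma weak_pd_trig: assumes "0 < L" "trig L f" shows "weak_pd L i f (pd i f)"
  unfolding weak_pd_ip using ip_pd_trig[OF assms] by simp

lemma Laplacian_fmul:
  assumes L: "0 < L"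
  shows "(\<Sum>i\<in>UNIV. pd i (pd i (fmul L r m f)) x) = - fmul L r (\<lambda>s. s * m s) f x"
proof -
  have c: "fc L (pd i (fmul L r m f)) k = k $ i * (m (k \<bullet> k) * fs L f k)"
    "fs L (pd i (fmul L r m f)) k = - k $ i * (m (k \<bullet> k) * fc L f k)" if "k \<in> Lam L r" for k i
    using fc_weak_pd[OF L _ weak_pd_trig[OF L trig_fmul, of i r m f]] fc_fmul[OF L, of _ r m f] that
    by (auto simp: Lam_def)
  have "pd i (pd i (fmul L r m f)) x = (\<Sum>k\<in>Lam L r. - (k $ i)\<^sup>2 * (m (k \<bullet> k) / L\<^sup>2 * (fc L f k * cos (k \<bullet> x) + fs L f k * sin (k \<bullet> x))))" for i
  proof -
    \<comment> \<open>The first derivative is again band-limited, hence its own truncation; in this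
      form the expansion of a derivative can be used a second time.\<close>
    have "pd i (fmul L r m f) = fpart L r (pd i (fmul L r m f))"
    proof
      fix x show "pd i (fmul L r m f) x = fpart L r (pd i (fmul L r m f)) x"
        unfolding fmul_def[of L r "\<lambda>_. 1"] unfolding pd_fmul_expand[of i L r m f x]
        by (intro sum.cong refl) (simp add: c algebra_simps)
    qed
    then have "pd i (pd i (fmul L r m f)) x = pd i (fpart L r (pd i (fmul L r m f))) x" by simp
    also have "\<dots> = (\<Sum>k\<in>Lam L r. - (k $ i)\<^sup>2 * (m (k \<bullet> k) / L\<^sup>2 * (fc L f k * cos (k \<bullet> x) + fs L f k * sin (k \<bullet> x))))"
      unfolding pd_fmul_expand[of i L r "\<lambda>_. 1" "pd i (fmul L r m f)" x]
      by (intro sum.cong refl) (simp add: c power2_eq_square algebra_simps)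
    finally show ?thesis .
  qed
  then have "(\<Sum>i\<in>UNIV. pd i (pd i (fmul L r m f)) x) = (\<Sum>k\<in>Lam L r. \<Sum>i\<in>UNIV. - (k $ i)\<^sup>2 * (m (k \<bullet> k) / L\<^sup>2 * (fc L f k * cos (k \<bullet> x) + fs L f k * sin (k \<bullet> x))))"
    by (simp add: sum.swap[of _ "Lam L r"])
  also have "\<dots> = - fmul L r (\<lambda>s. s * m s) f x"
    unfolding fmul_def sum_negf[symmetric] sum_distrib_right[symmetric]
    by (intro sum.cong refl) (simp add: inner_vec_def sum_negf power2_eq_square)
  finally show ?thesis .
qed

section \<open>Regularity and the advection term\<close>

lemma ip_mono:
  assumes "f \<in> borel_measurable borel" "sq_int L g" "AE x in cell L. \<bar>f x\<bar> \<le> \<bar>g x\<bar>"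
  shows "sq_int L f" "ip L f f \<le> ip L g g"
proof -
  have sq: "AE x in cell L. (f x)\<^sup>2 \<le> (g x)\<^sup>2"
    using assms(3) by eventually_elim (simp add: abs_le_square_iff)
  have m: "(\<lambda>x. (f x)\<^sup>2) \<in> borel_measurable (cell L)"
    using assms(1) by (intro measurable_cell) measurable
  have g: "integrable (cell L) (\<lambda>x. (g x)\<^sup>2)" using assms(2) by (simp add: sq_int_iff)
  have f: "integrable (cell L) (\<lambda>x. (f x)\<^sup>2)"
    by (rule Bochner_Integration.integrable_bound[OF g m]) (use sq in simp)
  then show "sq_int L f" using assms(1) by (simp add: sq_int_iff)
  show "ip L f f \<le> ip L g g"
    unfolding ip_def power2_eq_square[symmetric] by (rule integral_mono_AE[OF f g sq])
qed

lemma ip_mult_bounded: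
  assumes "sq_int L f" "h \<in> borel_measurable borel" "AE x in cell L. \<bar>h x\<bar> \<le> B"
  shows "ip L (\<lambda>x. h x * f x) (\<lambda>x. h x * f x) \<le> B\<^sup>2 * ip L f f"
proof -
  have "ip L (\<lambda>x. h x * f x) (\<lambda>x. h x * f x) \<le> ip L (\<lambda>x. B * f x) (\<lambda>x. B * f x)"
  proof (rule ip_mono)
    show "(\<lambda>x. h x * f x) \<in> borel_measurable borel" using assms(2) sq_int_measurable[OF assms(1)] by measurable
    show "AE x in cell L. \<bar>h x * f x\<bar> \<le> \<bar>B * f x\<bar>"
      using assms(3) by eventually_elim (auto simp: abs_mult intro!: mult_right_mono)
  qed (rule sq_int_cmult[OF assms(1)])
  then show ?thesis by (simp add: power2_eq_square mult.assoc)
qed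

text \<open>The Laplacian is recorded by its Fourier coefficients, the form in which Bessel's
  inequality yields square-summability with weight |k|^4.\<close>

definition weak_Lap :: "real \<Rightarrow> (pt \<Rightarrow> real) \<Rightarrow> (pt \<Rightarrow> real) \<Rightarrow> bool" where
  "weak_Lap L f l \<longleftrightarrow> sq_int L l \<and>
     (\<forall>k\<in>Lat L. fc L l k = - (k \<bullet> k) * fc L f k \<and> fs L l k = - (k \<bullet> k) * fs L f k)"

lemma W2s_weak_Lap:
  assumes L: "0 < L" and "W2s L f" shows "\<exists>l. weak_Lap L f l"
proof -
  obtain g where g: "\<And>i. W1s L (g i)" "\<And>i. weak_pd L i f (g i)" using assms unfolding W2s_def by metis
  then have "\<forall>i. \<exists>h. sq_int L h \<and> weak_pd L i (g i) h" unfolding W1s_def by blast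
  then obtain h where h: "\<And>i. sq_int L (h i)" "\<And>i. weak_pd L i (g i) (h i)" by metis
  have e: "fc L (h i) k = - (k $ i)\<^sup>2 * fc L f k" "fs L (h i) k = - (k $ i)\<^sup>2 * fs L f k" if k: "k \<in> Lat L" for i k
    using fc_weak_pd[OF L k g(2)[of i]] fc_weak_pd[OF L k h(2)[of i]] by (simp_all add: power2_eq_square)
  have "weak_Lap L f (\<lambda>x. \<Sum>i\<in>UNIV. h i x)"
    unfolding weak_Lap_def
  proof (intro conjI ballI)
    show "sq_int L (\<lambda>x. \<Sum>i\<in>UNIV. h i x)" by (rule sq_int_sum) (rule h)
    fix k assume k: "k \<in> Lat L"
    have "fc L (\<lambda>x. \<Sum>i\<in>UNIV. h i x) k = (\<Sum>i\<in>UNIV. fc L (h i) k)"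
      unfolding fc_def by (rule ip_sum_left) (simp_all add: h)
    also have "\<dots> = - (k \<bullet> k) * fc L f k"
      by (simp add: e[OF k] inner_vec_def sum_negf sum_distrib_right power2_eq_square)
    finally show "fc L (\<lambda>x. \<Sum>i\<in>UNIV. h i x) k = - (k \<bullet> k) * fc L f k" .
    have "fs L (\<lambda>x. \<Sum>i\<in>UNIV. h i x) k = (\<Sum>i\<in>UNIV. fs L (h i) k)"
      unfolding fs_def by (rule ip_sum_left) (simp_all add: h)
    also have "\<dots> = - (k \<bullet> k) * fs L f k"
      by (simp add: e[OF k] inner_vec_def sum_negf sum_distrib_right power2_eq_square)
    finally show "fs L (\<lambda>x. \<Sum>i\<in>UNIV. h i x) k = - (k \<bullet> k) * fs L f k" .
  qed
  then show ?thesis by blast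
qed

lemma sum_square_Lap_le:
  assumes L: "0 < L" and l: "weak_Lap L f l"
  shows "(\<Sum>k\<in>Lam L r. (k \<bullet> k)\<^sup>2 * ((fc L f k)\<^sup>2 + (fs L f k)\<^sup>2) / L\<^sup>2) \<le> ip L l l"
proof -
  have "(\<Sum>k\<in>Lam L r. (k \<bullet> k)\<^sup>2 * ((fc L f k)\<^sup>2 + (fs L f k)\<^sup>2) / L\<^sup>2)
      = (\<Sum>k\<in>Lam L r. ((fc L l k)\<^sup>2 + (fs L l k)\<^sup>2) / L\<^sup>2)"
    using l by (intro sum.cong refl) (auto simp: weak_Lap_def Lam_def power_mult_distrib distrib_left)
  also have "\<dots> \<le> ip L l l" using l by (intro Bessel_Fourier[OF L]) (auto simp: weak_Lap_def)
  finally show ?thesis .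
qed

text \<open>The heart of the embedding of W^{2,2} into bounded functions: |c| \<le> |k|^4 c^2 +
  |k|^{-4}/4, where the first part is summed by the norm of the Laplacian and the second by
  convergence of the lattice sum. The zero frequency is kept apart.\<close>

lemma sum_abs_coeff_bound:
  assumes L: "0 < L" and l: "weak_Lap L f l"
  shows "\<exists>C. \<forall>r. (\<Sum>k\<in>Lam L r. (\<bar>fc L f k\<bar> + \<bar>fs L f k\<bar>) / L\<^sup>2) \<le> C"
proof (intro exI allI)
  fix r
  let ?a = "\<lambda>k. \<bar>fc L f k\<bar> + \<bar>fs L f k\<bar>"
  let ?w = "\<lambda>k. (k \<bullet> k)\<^sup>2 * ((fc L f k)\<^sup>2 + (fs L f k)\<^sup>2)"
  have "(\<Sum>k\<in>Lam L r. ?a k / L\<^sup>2) \<le> (\<Sum>k\<in>Lam L r. (?w k / L\<^sup>2 + (if k = 0 then ?a 0 / L\<^sup>2 else 0)) + (if k = 0 then 0 else 1 / (k \<bullet> k)\<^sup>2 / L\<^sup>2))"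
  proof (rule sum_mono)
    fix k
    show "?a k / L\<^sup>2 \<le> (?w k / L\<^sup>2 + (if k = 0 then ?a 0 / L\<^sup>2 else 0)) + (if k = 0 then 0 else 1 / (k \<bullet> k)\<^sup>2 / L\<^sup>2)"
    proof (cases "k = 0")
      case False
      then have s: "k \<bullet> k > 0" by simp
      have *: "4 * \<bar>c\<bar> \<le> 4 * ((k \<bullet> k)\<^sup>2 * c\<^sup>2) + 1 / (k \<bullet> k)\<^sup>2" for c
        using sum_squares_bound[of "2 * ((k \<bullet> k) * \<bar>c\<bar>)" "1 / (k \<bullet> k)"] s
        by (simp add: power_mult_distrib power_divide)
      have "?a k \<le> ?w k + 1 / (k \<bullet> k)\<^sup>2"
        using *[of "fc L f k"] *[of "fs L f k"] zero_le_power2[of "1 / (k \<bullet> k)"]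
        unfolding distrib_left power_divide power_one by linarith
      then have "?a k / L\<^sup>2 \<le> (?w k + 1 / (k \<bullet> k)\<^sup>2) / L\<^sup>2" by (rule divide_right_mono) simp
      then show ?thesis using False by (simp add: add_divide_distrib)
    qed simp
  qed
  also have "\<dots> \<le> (ip L l l + ?a 0 / L\<^sup>2) + 100 / (2 * pi / L) ^ 4 / L\<^sup>2"
  proof -
    have "(\<Sum>k\<in>Lam L r. ?w k / L\<^sup>2) \<le> ip L l l" by (rule sum_square_Lap_le[OF L l])
    moreover have "(\<Sum>k\<in>Lam L r. if k = 0 then ?a 0 / L\<^sup>2 else 0) \<le> ?a 0 / L\<^sup>2"
      using L by (simp add: sum.delta)
    moreover have "(\<Sum>k\<in>Lam L r. if k = 0 then 0 else 1 / (k \<bullet> k)\<^sup>2 / L\<^sup>2) \<le> 100 / (2 * pi / L) ^ 4 / L\<^sup>2"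
    proof -
      have "(\<Sum>k\<in>Lam L r. if k = 0 then 0 else 1 / (k \<bullet> k)\<^sup>2 / L\<^sup>2) = (\<Sum>k\<in>Lam L r - {0}. 1 / (k \<bullet> k)\<^sup>2) / L\<^sup>2"
        unfolding sum_divide_distrib using L by (intro sum.mono_neutral_cong_right) auto
      then show ?thesis using divide_right_mono[OF sum_Lam_bound[OF L, of r], of "L\<^sup>2"] by simp
    qed
    ultimately show ?thesis unfolding sum.distrib by linarith
  qed
  finally show "(\<Sum>k\<in>Lam L r. ?a k / L\<^sup>2) \<le> (ip L l l + ?a 0 / L\<^sup>2) + 100 / (2 * pi / L) ^ 4 / L\<^sup>2" .
qed

text \<open>Absolutely summable coefficients make the truncations uniformly Cauchy, with
  \<open>\<epsilon> n\<close> the tail of the coefficient sums. Convergence in L^2 identifies the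
  uniform limit with f almost everywhere.\<close>

lemma fpart_uniform:
  assumes L: "0 < L" and f: "sq_int L f" and l: "weak_Lap L f l"
  obtains \<epsilon> where "\<epsilon> \<longlonglongrightarrow> 0" "\<And>n. AE x in cell L. \<bar>f x - fpart L (real n) f x\<bar> \<le> \<epsilon> n"
proof -
  define a where "a k = (\<bar>fc L f k\<bar> + \<bar>fs L f k\<bar>) / L\<^sup>2" for k
  define A where "A n = (\<Sum>k\<in>Lam L (real n). a k)" for n :: nat
  have a0: "0 \<le> a k" for k by (simp add: a_def)
  have sub: "Lam L (real m) \<subseteq> Lam L (real n)" if "m \<le> n" for m n
    using that by (auto simp: Lam_def)
  have Adiff: "A n - A m = (\<Sum>k\<in>Lam L (real n) - Lam L (real m). a k)" if "m \<le> n" for m n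
    unfolding A_def using L sub[OF that] by (simp add: sum_diff)
  have inc: "incseq A"
    unfolding incseq_def
  proof (intro allI impI)
    fix m n :: nat assume "m \<le> n"
    then show "A m \<le> A n" using Adiff[OF \<open>m \<le> n\<close>] sum_nonneg[of "Lam L (real n) - Lam L (real m)" a] a0 by simp
  qed
  obtain C where "\<And>n. A n \<le> C" using sum_abs_coeff_bound[OF L l] unfolding A_def a_def by blast
  then obtain A' where A': "A \<longlonglongrightarrow> A'" "\<And>n. A n \<le> A'" using incseq_convergent[OF inc] by blast
  define \<epsilon> where "\<epsilon> n = A' - A n" for n
  have S: "\<bar>fpart L (real m) f x - fpart L (real n) f x\<bar> \<le> \<epsilon> n" if "n \<le> m" for m n x
  proof -
    have "fpart L (real m) f x - fpart L (real n) f x = (\<Sum>k\<in>Lam L (real m) - Lam L (real n). 1 / L\<^sup>2 * (fc L f k * cos (k \<bullet> x) + fs L f k * sin (k \<bullet> x)))"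
      unfolding fmul_def using L sub[OF that] by (simp add: sum_diff)
    also have "\<bar>\<dots>\<bar> \<le> (\<Sum>k\<in>Lam L (real m) - Lam L (real n). a k)"
    proof (rule order_trans[OF sum_abs], rule sum_mono)
      fix k
      have "\<bar>fc L f k * cos (k \<bullet> x) + fs L f k * sin (k \<bullet> x)\<bar> \<le> \<bar>fc L f k\<bar> * \<bar>cos (k \<bullet> x)\<bar> + \<bar>fs L f k\<bar> * \<bar>sin (k \<bullet> x)\<bar>"
        by (rule order_trans[OF abs_triangle_ineq]) (simp add: abs_mult)
      also have "\<dots> \<le> \<bar>fc L f k\<bar> * 1 + \<bar>fs L f k\<bar> * 1" by (intro add_mono mult_left_mono) auto
      finally show "\<bar>1 / L\<^sup>2 * (fc L f k * cos (k \<bullet> x) + fs L f k * sin (k \<bullet> x))\<bar> \<le> a k"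
        by (simp add: a_def abs_mult divide_right_mono)
    qed
    also have "\<dots> \<le> \<epsilon> n" using A'(2)[of m] Adiff[OF that] by (simp add: \<epsilon>_def)
    finally show ?thesis .
  qed
  show ?thesis
  proof (rule that[of \<epsilon>])
    show "\<epsilon> \<longlonglongrightarrow> 0" unfolding \<epsilon>_def using tendsto_diff[OF tendsto_const A'(1), of A'] by simp
    fix n
    \<comment> \<open>The amount by which the claimed bound fails. It lies below |f - S_m f| for
      every truncation S_m with m \<ge> n, hence its L^2 norm is 0.\<close>
    define h where "h x = max 0 (\<bar>f x - fpart L (real n) f x\<bar> - \<epsilon> n)" for x
    have m [measurable]: "f \<in> borel_measurable borel" "fpart L (real n) f \<in> borel_measurable borel"
      using f by (auto simp: sq_int_measurable[OF sq_int_fmul] dest: sq_int_measurable)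
    have hm: "h \<in> borel_measurable borel" unfolding h_def by measurable
    have le: "sq_int L h \<and> ip L h h \<le> ip L (\<lambda>x. f x - fpart L (real m) f x) (\<lambda>x. f x - fpart L (real m) f x)" if "n \<le> m" for m
    proof -
      have "\<bar>h x\<bar> \<le> \<bar>f x - fpart L (real m) f x\<bar>" for x
        using S[OF that, of x] unfolding h_def by linarith
      then have ae: "AE x in cell L. \<bar>h x\<bar> \<le> \<bar>f x - fpart L (real m) f x\<bar>" by simp
      show ?thesis using ip_mono[OF hm sq_int_diff[OF f sq_int_fmul] ae] by blast
    qed
    have "ip L h h \<le> 0"
      by (rule LIMSEQ_le_const[OF fpart_tendsto[OF L f]]) (use le in blast)
    then have "ip L h h = 0" using ip_nonneg[of L h] by linarith
    then have "AE x in cell L. h x = 0" using le[of n] by (intro ip_AE_zero) auto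
    then show "AE x in cell L. \<bar>f x - fpart L (real n) f x\<bar> \<le> \<epsilon> n"
      by eventually_elim (simp add: h_def max_def split: if_splits)
  qed
qed

text \<open>f stays within \<open>\<epsilon> 0\<close> of a truncation, which is continuous and so
  bounded on the compact cell.\<close>

lemma weak_Lap_AE_bounded:
  assumes L: "0 < L" and f: "sq_int L f" and l: "weak_Lap L f l"
  obtains B where "AE x in cell L. \<bar>f x\<bar> \<le> B"
proof -
  obtain \<epsilon> where e: "\<And>n. AE x in cell L. \<bar>f x - fpart L (real n) f x\<bar> \<le> \<epsilon> n"
    using fpart_uniform[OF L f l] by metis
  obtain B where B: "\<And>x. x \<in> Dom L \<Longrightarrow> \<bar>fpart L (real 0) f x\<bar> \<le> B"
    using continuous_Dom_bounded[OF trig_continuous[OF trig_fmul]] by blast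
  have "AE x in cell L. \<bar>f x\<bar> \<le> B + \<epsilon> 0"
    using e[of 0] AE_space[of "cell L"]
  proof eventually_elim
    case (elim x)
    then show ?case using B[of x] by simp
  qed
  then show ?thesis by (rule that)
qed

section \<open>Cancellation of advection against the Laplacian for smooth fields\<close>

lemma pd_const [simp]: "pd i (\<lambda>x. c) x = 0"
  by (subst pd_eq[where D="\<lambda>h. 0"]) auto

lemma trig_pd_commute: "trig L f \<Longrightarrow> pd i (pd j f) x = pd j (pd i f) x"
proof (induction arbitrary: x rule: trig.induct)
  case (cos k a)
  have *: "pd i (pd j (\<lambda>x. a * cos (k \<bullet> x))) x = - a * k $ i * k $ j * cos (k \<bullet> x)" for i j x
  proof -
    have "pd j (\<lambda>x. a * cos (k \<bullet> x)) = (\<lambda>x. (- a * k $ j) * sin (k \<bullet> x))"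
      by (rule ext, subst pd_cmult) (simp_all add: pd_cos trig_differentiable[OF trig_cos1[OF cos]])
    then show ?thesis by (simp only:, subst pd_cmult) (simp_all add: pd_sin trig_differentiable[OF trig_sin1[OF cos]])
  qed
  show ?case by (simp add: *)
next
  case (sin k a)
  have *: "pd i (pd j (\<lambda>x. a * sin (k \<bullet> x))) x = - a * k $ i * k $ j * sin (k \<bullet> x)" for i j x
  proof -
    have "pd j (\<lambda>x. a * sin (k \<bullet> x)) = (\<lambda>x. (a * k $ j) * cos (k \<bullet> x))"
      by (rule ext, subst pd_cmult) (simp_all add: pd_sin trig_differentiable[OF trig_sin1[OF sin]])
    then show ?thesis by (simp only:, subst pd_cmult) (simp_all add: pd_cos trig_differentiable[OF trig_cos1[OF sin]])
  qed
  show ?case by (simp add: *)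
next
  case (add f g)
  have *: "pd i (pd j (\<lambda>x. f x + g x)) x = pd i (pd j f) x + pd i (pd j g) x" for i j x
  proof -
    have "pd j (\<lambda>x. f x + g x) = (\<lambda>x. pd j f x + pd j g x)"
      by (rule ext, rule pd_add) (auto intro: trig_differentiable add.hyps)
    then show ?thesis using add.hyps by (simp add: pd_add trig_differentiable[of L] trig_pd)
  qed
  show ?case by (simp add: * add.IH)
qed

text \<open>In two dimensions a trace-free gradient $G$ satisfies $\mathrm{tr}(G G G^T) = 0$; this is
  what makes the integrand below a divergence.\<close>

lemma integral_advection_Laplacian:
  assumes L: "0 < L" and w: "\<And>k. trig L (w k)" and div: "\<And>x. (\<Sum>i\<in>UNIV. pd i (w i) x) = 0"
  shows "(\<Sum>k\<in>UNIV. ip L (\<lambda>x. \<Sum>i\<in>UNIV. w i x * pd i (w k) x) (\<lambda>x. \<Sum>j\<in>UNIV. pd j (pd j (w k)) x)) = (0::real)"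
proof -
  have t [intro]: "trig L (pd i (w k))" "trig L (pd j (pd i (w k)))" for i j k by (auto intro: trig_pd w)
  have d [simp]: "w k differentiable (at x)" "pd i (w k) differentiable (at x)" for i k x
    by (rule trig_differentiable, auto intro: w)+
  \<comment> \<open>The vector field (w.grad w) . d_j w - w_j |grad w|^2 / 2. In its divergence the
    terms with mixed second derivatives cancel and the second one contributes div w = 0. What
    remains, besides the desired integrand, is the cubic trace of the gradient.\<close>
  define W :: "2 \<Rightarrow> pt \<Rightarrow> real" where
    "W j = (\<lambda>x. \<Sum>k\<in>UNIV. \<Sum>i\<in>UNIV. w i x * pd i (w k) x * pd j (w k) x + (- 1/2) * (w j x * (pd i (w k) x * pd i (w k) x)))" for j
  have W: "trig L (W j)" for j
    unfolding W_def by (intro trig_sum trig.add trig_mult trig_cmult w t)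
  have pdW: "pd j (W j) x = (\<Sum>k\<in>UNIV. \<Sum>i\<in>UNIV.
      pd j (w i) x * pd i (w k) x * pd j (w k) x + w i x * pd j (pd i (w k)) x * pd j (w k) x + w i x * pd i (w k) x * pd j (pd j (w k)) x
      - 1/2 * (pd j (w j) x * (pd i (w k) x)\<^sup>2) - w j x * pd i (w k) x * pd j (pd i (w k)) x)" for j x
  proof -
    have "pd j (\<lambda>x. w i x * pd i (w k) x * pd j (w k) x + (- 1/2) * (w j x * (pd i (w k) x * pd i (w k) x))) x =
      pd j (w i) x * pd i (w k) x * pd j (w k) x + w i x * pd j (pd i (w k)) x * pd j (w k) x + w i x * pd i (w k) x * pd j (pd j (w k)) x
      - 1/2 * (pd j (w j) x * (pd i (w k) x)\<^sup>2) - w j x * pd i (w k) x * pd j (pd i (w k)) x" for i k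
      by (simp only: pd_add pd_mult pd_const d differentiable_add differentiable_mult differentiable_const)
         (simp add: power2_eq_square algebra_simps)
    moreover have "(\<lambda>x. w i x * pd i (w k) x * pd j (w k) x + (- 1/2) * (w j x * (pd i (w k) x * pd i (w k) x))) differentiable (at x)" for i k
      by (intro differentiable_add differentiable_mult differentiable_const d)
    ultimately show ?thesis unfolding W_def
      by (subst pd_sum, intro differentiable_sum ballI, simp, blast)
         (intro sum.cong refl, subst pd_sum, blast, simp only:)
  qed
  \<comment> \<open>Eliminating one diagonal entry of the gradient turns the vanishing of the cubic
    trace into a polynomial identity that simplification can check.\<close>
  have div0: "pd 2 (w 2) x = - pd 1 (w 1) x" for x using div[of x] by (simp add: sum_2)
  have eq: "(\<Sum>k\<in>UNIV. (\<Sum>i\<in>UNIV. w i x * pd i (w k) x) * (\<Sum>j\<in>UNIV. pd j (pd j (w k)) x)) = (\<Sum>j\<in>UNIV. pd j (W j) x)" for x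
    unfolding pdW sum_2 div0 trig_pd_commute[OF w, of 2 1] by (simp add: algebra_simps power2_eq_square)
  have sq: "sq_int L (\<lambda>x. \<Sum>i\<in>UNIV. w i x * pd i (w k) x)" "sq_int L (\<lambda>x. \<Sum>j\<in>UNIV. pd j (pd j (w k)) x)" for k
    by (intro trig_sq_int trig_sum trig_mult w t)+
  have "(\<Sum>k\<in>UNIV. ip L (\<lambda>x. \<Sum>i\<in>UNIV. w i x * pd i (w k) x) (\<lambda>x. \<Sum>j\<in>UNIV. pd j (pd j (w k)) x))
      = (\<integral>x. (\<Sum>k\<in>UNIV. (\<Sum>i\<in>UNIV. w i x * pd i (w k) x) * (\<Sum>j\<in>UNIV. pd j (pd j (w k)) x)) \<partial>cell L)"
    unfolding ip_def by (rule Bochner_Integration.integral_sum[symmetric]) (rule sq_int_mult_integrable[OF sq])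
  also have "\<dots> = (\<Sum>j\<in>UNIV. \<integral>x. pd j (W j) x \<partial>cell L)"
    unfolding eq by (rule Bochner_Integration.integral_sum) (intro integrable_cell_continuous trig_continuous[OF trig_pd[OF W]])
  also have "\<dots> = 0"
    by (intro sum.neutral ballI integral_pd_periodic[OF L] trig_periodic[OF L W] trig_differentiable[OF W] trig_continuous[OF trig_pd[OF W]])
  finally show ?thesis .
qed

section \<open>Divergence-free fields\<close>

definition sqf :: "real \<Rightarrow> field \<Rightarrow> bool" where
  "sqf L u \<longleftrightarrow> (\<forall>k. sq_int L (\<lambda>x. u x $ k))"

lemma sqfD: "sqf L u \<Longrightarrow> sq_int L (\<lambda>x. u x $ k)"
  by (simp add: sqf_def)

lemma l2inner_ip:
  assumes "sqf L u" "sqf L v"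
  shows "l2inner L u v = (\<Sum>k\<in>UNIV. ip L (\<lambda>x. u x $ k) (\<lambda>x. v x $ k))"
  unfolding l2inner_def LINT_Dom inner_vec_def inner_real_def ip_def
  by (rule Bochner_Integration.integral_sum) (use assms in \<open>auto intro: sq_int_mult_integrable sqfD\<close>)

lemma sqf_add: "sqf L u \<Longrightarrow> sqf L v \<Longrightarrow> sqf L (\<lambda>x. u x + v x)"
  and sqf_diff: "sqf L u \<Longrightarrow> sqf L v \<Longrightarrow> sqf L (\<lambda>x. u x - v x)"
  and sqf_scale: "sqf L u \<Longrightarrow> sqf L (\<lambda>x. c *\<^sub>R u x)"
  by (auto simp: sqf_def intro!: sq_int_add sq_int_diff sq_int_cmult)

lemma sqf_zero [simp]: "sqf L (\<lambda>x. 0)"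
  by (simp add: sqf_def)

lemma sqf_sum: "(\<And>j. j \<in> J \<Longrightarrow> sqf L (u j)) \<Longrightarrow> sqf L (\<lambda>x. \<Sum>j\<in>J. u j x)"
  by (induction J rule: infinite_finite_induct) (auto intro: sqf_add)

lemma l2inner_commute: "l2inner L u v = l2inner L v u"
  by (simp add: l2inner_def inner_commute)

lemma l2inner_add:
  assumes "sqf L u" "sqf L v" "sqf L w"
  shows "l2inner L (\<lambda>x. u x + v x) w = l2inner L u w + l2inner L v w"
  using assms by (simp add: l2inner_ip sqf_add ip_add_left sqfD sum.distrib)

lemma l2inner_diff:
  assumes "sqf L u" "sqf L v" "sqf L w"
  shows "l2inner L (\<lambda>x. u x - v x) w = l2inner L u w - l2inner L v w"
  using assms by (simp add: l2inner_ip sqf_diff ip_diff_left sqfD sum_subtractf)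

lemma l2inner_scale: "l2inner L (\<lambda>x. c *\<^sub>R u x) w = c * l2inner L u w"
  by (simp add: l2inner_def LINT_Dom)

lemma l2inner_sum:
  assumes "\<And>j. j \<in> J \<Longrightarrow> sqf L (u j)" "sqf L w"
  shows "l2inner L (\<lambda>x. \<Sum>j\<in>J. u j x) w = (\<Sum>j\<in>J. l2inner L (u j) w)"
  using assms(1)
proof (induction J rule: infinite_finite_induct)
  case (insert j J)
  then show ?case using l2inner_add[of L "u j" "\<lambda>x. \<Sum>j\<in>J. u j x" w] assms(2)
    by (simp add: sqf_sum)
qed (simp_all add: l2inner_def LINT_Dom)

lemma l2inner_nonneg [simp]: "0 \<le> l2inner L u u"
  by (simp add: l2inner_def LINT_Dom)

lemma Bessel_l2inner:
  assumes J: "finite J" and z: "\<And>j. j \<in> J \<Longrightarrow> sqf L (z j)" and v: "sqf L v"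
    and orth: "\<And>i j. l2inner L (z i) (z j) = (if i = j then 1 else (0::real))"
  shows "(\<Sum>j\<in>J. (l2inner L v (z j))\<^sup>2) \<le> l2inner L v v"
proof -
  let ?p = "\<lambda>x. \<Sum>j\<in>J. l2inner L v (z j) *\<^sub>R z j x"
  have p: "sqf L ?p" by (intro sqf_sum sqf_scale z)
  have ipw: "l2inner L ?p w = (\<Sum>j\<in>J. l2inner L v (z j) * l2inner L (z j) w)" if "sqf L w" for w
    using that z by (simp add: l2inner_sum sqf_scale l2inner_scale)
  have pz: "l2inner L ?p (z j) = l2inner L v (z j)" if "j \<in> J" for j
    using J that z by (simp add: ipw orth if_distrib sum.delta cong: if_cong)
  have "l2inner L ?p ?p = (\<Sum>j\<in>J. l2inner L v (z j) * l2inner L ?p (z j))"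
    by (subst ipw[OF p]) (simp only: l2inner_commute[of L "z _"])
  also have "\<dots> = (\<Sum>j\<in>J. (l2inner L v (z j))\<^sup>2)" by (simp add: pz power2_eq_square)
  finally have pp: "l2inner L ?p ?p = (\<Sum>j\<in>J. (l2inner L v (z j))\<^sup>2)" .
  have pv: "l2inner L ?p v = (\<Sum>j\<in>J. (l2inner L v (z j))\<^sup>2)"
    by (subst ipw[OF v]) (simp add: l2inner_commute[of L "z _"] power2_eq_square)
  have "0 \<le> l2inner L (\<lambda>x. v x - ?p x) (\<lambda>x. v x - ?p x)" by simp
  also have "\<dots> = l2inner L v (\<lambda>x. v x - ?p x) - l2inner L ?p (\<lambda>x. v x - ?p x)"
    by (rule l2inner_diff) (intro v p sqf_diff)+
  also have "\<dots> = l2inner L v v - l2inner L ?p v - (l2inner L v ?p - l2inner L ?p ?p)"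
    unfolding l2inner_commute[of L v "\<lambda>x. v x - ?p x"] l2inner_commute[of L ?p "\<lambda>x. v x - ?p x"]
    by (simp only: l2inner_diff[OF v p v] l2inner_diff[OF v p p])
  finally show ?thesis using pp pv l2inner_commute[of L v ?p] by simp
qed

definition divfree :: "real \<Rightarrow> field \<Rightarrow> bool" where
  "divfree L u \<longleftrightarrow> (\<forall>\<phi>. test L \<phi> \<longrightarrow> (\<Sum>i\<in>UNIV. ip L (\<lambda>x. u x $ i) (pd i \<phi>)) = 0)"

lemma test_pd_sq_int: "test L \<phi> \<Longrightarrow> sq_int L (pd i \<phi>)"
  unfolding test_def by (metis Ck.simps sq_int_continuous)

text \<open>Membership in H component by component, so that the scalar Fourier calculus applies. The
  vector mean value may be split because a square-integrable field is integrable on the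
  cell.\<close>

lemma Hsp_iff:
  "Hsp L u \<longleftrightarrow> periodic L u \<and> sqf L u \<and> (\<forall>k. ip L (\<lambda>x. u x $ k) (\<lambda>x. 1) = 0) \<and> divfree L u"
proof -
  have m: "u \<in> borel_measurable borel \<longleftrightarrow> (\<forall>k. (\<lambda>x. u x $ k) \<in> borel_measurable borel)"
    by (subst borel_measurable_euclidean_space) (auto simp: Basis_vec_def inner_axis)
  have n2: "(norm (u x))\<^sup>2 = (\<Sum>k\<in>UNIV. (u x $ k)\<^sup>2)" for x
    unfolding power2_norm_eq_inner inner_vec_def by (simp add: power2_eq_square)
  have sq: "u \<in> borel_measurable lborel \<and> set_integrable lborel (Dom L) (\<lambda>x. (norm (u x))\<^sup>2) \<longleftrightarrow> sqf L u"
  proof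
    assume *: "u \<in> borel_measurable lborel \<and> set_integrable lborel (Dom L) (\<lambda>x. (norm (u x))\<^sup>2)"
    then have mk: "(\<lambda>x. u x $ k) \<in> borel_measurable borel" for k using m by simp
    show "sqf L u" unfolding sqf_def sq_int_iff
    proof (intro allI conjI mk)
      fix k
      show "integrable (cell L) (\<lambda>x. (u x $ k)\<^sup>2)"
      proof (rule Bochner_Integration.integrable_bound)
        show "integrable (cell L) (\<lambda>x. (norm (u x))\<^sup>2)" using * by (simp add: set_integrable_Dom)
        show "(\<lambda>x. (u x $ k)\<^sup>2) \<in> borel_measurable (cell L)" using mk by (intro measurable_cell) measurable
        show "AE x in cell L. norm ((u x $ k)\<^sup>2) \<le> norm ((norm (u x))\<^sup>2)"
          using power_mono[OF component_le_norm_cart[of "u _" k] abs_ge_zero, of _ 2] by (intro AE_I2) simp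
      qed
    qed
  next
    assume *: "sqf L u"
    then have "u \<in> borel_measurable borel" unfolding m by (auto dest: sqfD sq_int_measurable)
    moreover have "integrable (cell L) (\<lambda>x. (norm (u x))\<^sup>2)"
      unfolding n2 using * by (intro Bochner_Integration.integrable_sum) (simp add: sqf_def sq_int_iff)
    ultimately show "u \<in> borel_measurable lborel \<and> set_integrable lborel (Dom L) (\<lambda>x. (norm (u x))\<^sup>2)"
      by (simp add: set_integrable_Dom)
  qed
  have mean: "(LINT x:Dom L|lborel. u x) = 0 \<longleftrightarrow> (\<forall>k. ip L (\<lambda>x. u x $ k) (\<lambda>x. 1) = 0)" if "sqf L u"
  proof -
    have um: "u \<in> borel_measurable borel" using that unfolding m by (auto dest: sqfD sq_int_measurable)
    have "integrable (cell L) u"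
    proof (rule Bochner_Integration.integrable_bound)
      show "integrable (cell L) (\<lambda>x. \<Sum>k\<in>UNIV. \<bar>u x $ k * 1\<bar>)"
        using that by (intro Bochner_Integration.integrable_sum integrable_abs sq_int_mult_integrable sqfD) simp_all
      show "AE x in cell L. norm (u x) \<le> norm (\<Sum>k\<in>UNIV. \<bar>u x $ k * 1\<bar>)"
        using norm_le_l1_cart[of "u _"] by (intro AE_I2) (simp add: sum_nonneg)
    qed (rule measurable_cell[OF um])
    from integral_bounded_linear[OF bounded_linear_vec_nth this]
    show ?thesis by (simp add: LINT_Dom vec_eq_iff ip_def)
  qed
  have dv: "(\<forall>\<phi>. test L \<phi> \<longrightarrow> (LINT x:Dom L|lborel. (\<Sum>i\<in>UNIV. u x $ i * pd i \<phi> x)) = 0) \<longleftrightarrow> divfree L u" if "sqf L u"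
  proof -
    have "(LINT x:Dom L|lborel. (\<Sum>i\<in>UNIV. u x $ i * pd i \<phi> x)) = (\<Sum>i\<in>UNIV. ip L (\<lambda>x. u x $ i) (pd i \<phi>))" if "test L \<phi>" for \<phi>
      unfolding LINT_Dom ip_def
      by (rule Bochner_Integration.integral_sum) (intro sq_int_mult_integrable sqfD[OF \<open>sqf L u\<close>] test_pd_sq_int[OF that])
    then show ?thesis by (simp add: divfree_def)
  qed
  show ?thesis unfolding Hsp_def L2per_def using sq mean dv by blast
qed

lemma Hsp_sqf: "Hsp L u \<Longrightarrow> sqf L u"
  by (simp add: Hsp_iff)

lemma Hsp_scale: "Hsp L u \<Longrightarrow> Hsp L (\<lambda>x. c *\<^sub>R u x)"
  by (auto simp: Hsp_iff periodic_def sqf_scale divfree_def simp flip: sum_distrib_left)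

lemma Hsp_add: "Hsp L u \<Longrightarrow> Hsp L v \<Longrightarrow> Hsp L (\<lambda>x. u x + v x)"
  by (auto simp: Hsp_iff periodic_def sqf_add divfree_def ip_add_left sqfD test_pd_sq_int sum.distrib)

lemma Hsp_zero: "Hsp L (\<lambda>x. 0)"
  by (auto simp: Hsp_iff periodic_def divfree_def)

lemma Hsp_sum: "(\<And>j. j \<in> J \<Longrightarrow> Hsp L (u j)) \<Longrightarrow> Hsp L (\<lambda>x. \<Sum>j\<in>J. u j x)"
  by (induction J rule: infinite_finite_induct) (auto intro: Hsp_add Hsp_zero)

lemma Hsp_diff: "Hsp L u \<Longrightarrow> Hsp L v \<Longrightarrow> Hsp L (\<lambda>x. u x - v x)"
  using Hsp_add[OF _ Hsp_scale[of L v "-1"], of u] by simp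

text \<open>The spectral multiplier m(A) restricted to A \<le> r, written on the Fourier side;
  \<open>spectral_sum\<close> justifies this reading.\<close>

definition vmul :: "real \<Rightarrow> real \<Rightarrow> (real \<Rightarrow> real) \<Rightarrow> field \<Rightarrow> field" where
  "vmul L r m u x = (\<chi> k. fmul L r m (\<lambda>x. u x $ k) x)"

lemma vmul_nth [simp]: "vmul L r m u x $ k = fmul L r m (\<lambda>x. u x $ k) x"
  by (simp add: vmul_def)

lemma sqf_vmul [simp]: "sqf L (vmul L r m u)"
  by (simp add: sqf_def)

text \<open>Testing the weak divergence with waves says that the coefficient vector at k is
  orthogonal to k. A multiplier that depends on k alone preserves this, and for the smooth result
  the divergence vanishes pointwise.\<close>

lemma divfree_vmul:
  assumes L: "0 < L" and u: "Hsp L u"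
  shows "(\<Sum>i\<in>UNIV. pd i (fmul L r m (\<lambda>x. u x $ i)) x) = 0"
proof -
  have c: "(\<Sum>i\<in>UNIV. k $ i * fs L (\<lambda>x. u x $ i) k) = 0" "(\<Sum>i\<in>UNIV. k $ i * fc L (\<lambda>x. u x $ i) k) = 0"
    if k: "k \<in> Lat L" for k
  proof -
    have "(\<Sum>i\<in>UNIV. ip L (\<lambda>x. u x $ i) (pd i (\<lambda>x. cos (k \<bullet> x)))) = 0"
      "(\<Sum>i\<in>UNIV. ip L (\<lambda>x. u x $ i) (pd i (\<lambda>x. sin (k \<bullet> x)))) = 0"
      using u test_cos[OF L k] test_sin[OF L k] unfolding Hsp_iff divfree_def by blast+
    then show "(\<Sum>i\<in>UNIV. k $ i * fs L (\<lambda>x. u x $ i) k) = 0" "(\<Sum>i\<in>UNIV. k $ i * fc L (\<lambda>x. u x $ i) k) = 0"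
      unfolding pd_cos_fun pd_sin_fun ip_cmult_right fs_def fc_def by (simp_all add: sum_negf)
  qed
  have "(\<Sum>i\<in>UNIV. pd i (fmul L r m (\<lambda>x. u x $ i)) x)
    = (\<Sum>k\<in>Lam L r. \<Sum>i\<in>UNIV. m (k \<bullet> k) / L\<^sup>2 * (k $ i * fs L (\<lambda>x. u x $ i) k * cos (k \<bullet> x) - k $ i * fc L (\<lambda>x. u x $ i) k * sin (k \<bullet> x)))"
    unfolding pd_fmul_expand by (rule sum.swap)
  also have "\<dots> = (\<Sum>k\<in>Lam L r. m (k \<bullet> k) / L\<^sup>2 * ((\<Sum>i\<in>UNIV. k $ i * fs L (\<lambda>x. u x $ i) k) * cos (k \<bullet> x) - (\<Sum>i\<in>UNIV. k $ i * fc L (\<lambda>x. u x $ i) k) * sin (k \<bullet> x)))"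
    by (simp only: sum_distrib_left[symmetric] sum_distrib_right[symmetric] sum_subtractf)
  also have "\<dots> = 0" by (intro sum.neutral ballI) (simp add: c Lam_Lat)
  finally show ?thesis .
qed

text \<open>Truncations stay in H, where completeness of the eigenbasis can be invoked.\<close>

lemma Hsp_vmul:
  assumes L: "0 < L" and u: "Hsp L u" shows "Hsp L (vmul L r m u)"
  unfolding Hsp_iff
proof (intro conjI allI)
  show "periodic L (vmul L r m u)"
    using trig_periodic[OF L trig_fmul] by (simp add: periodic_def vec_eq_iff)
  fix k
  have "fc L (fmul L r m (\<lambda>x. u x $ k)) 0 = 0"
  proof -
    have "fc L (\<lambda>x. u x $ k) 0 = 0" using u by (simp add: Hsp_iff fc_def)
    then show ?thesis by (simp add: fc_fmul[OF L])
  qed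
  then show "ip L (\<lambda>x. vmul L r m u x $ k) (\<lambda>x. 1) = 0" by (simp add: fc_def)
next
  show "divfree L (vmul L r m u)"
    unfolding divfree_def
  proof (intro allI impI)
    fix \<phi> assume t: "test L \<phi>"
    have sq: "sq_int L \<phi>"
      using t unfolding test_def by (metis Ck.simps(1) sq_int_continuous)
    have "(\<Sum>i\<in>UNIV. ip L (\<lambda>x. vmul L r m u x $ i) (pd i \<phi>)) = (\<Sum>i\<in>UNIV. - ip L (pd i (fmul L r m (\<lambda>x. u x $ i))) \<phi>)"
      using ip_pd_trig[OF L trig_fmul t] by simp
    also have "\<dots> = - ip L (\<lambda>x. \<Sum>i\<in>UNIV. pd i (fmul L r m (\<lambda>x. u x $ i)) x) \<phi>"
      unfolding sum_negf by (subst ip_sum_left) (auto intro!: trig_sq_int trig_pd trig_fmul sq)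
    also have "\<dots> = 0" by (simp add: divfree_vmul[OF L u])
    finally show "(\<Sum>i\<in>UNIV. ip L (\<lambda>x. vmul L r m u x $ i) (pd i \<phi>)) = 0" .
  qed
qed simp

section \<open>Spectral sums\<close>

locale stokes_basis =
  fixes L :: real and \<zeta> :: "nat \<Rightarrow> field" and lam :: "nat \<Rightarrow> real"
  assumes L: "0 < L" and basis: "eigenbasis L \<zeta> lam"
begin

lemma lam_pos: "0 < lam j" and lam_mono: "i \<le> j \<Longrightarrow> lam i \<le> lam j"
  using basis unfolding eigenbasis_def by (auto simp: mono_def intro: less_le_trans)

lemma DomA_\<zeta>: "DomA L (\<zeta> j)"
  using basis by (simp add: eigenbasis_def eigenfun_def)

lemma orthonormal: "l2inner L (\<zeta> i) (\<zeta> j) = (if i = j then 1 else 0)"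
  using basis by (simp add: eigenbasis_def)

lemma complete: "Hsp L u \<Longrightarrow> (\<And>j. l2inner L u (\<zeta> j) = 0) \<Longrightarrow> l2inner L u u = 0"
  using basis by (simp add: eigenbasis_def)

lemma Hsp_\<zeta>: "Hsp L (\<zeta> j)"
  using DomA_\<zeta> by (simp add: DomA_def)

lemma sqf_\<zeta> [simp]: "sqf L (\<zeta> j)"
  by (rule Hsp_sqf[OF Hsp_\<zeta>])

lemma W12_of_W22: "W22 L u \<Longrightarrow> W12 L u"
  unfolding W22_def W12_def W2s_def W1s_def by metis

lemma Vsp_of_DomA: "DomA L u \<Longrightarrow> Vsp L u"
  by (simp add: DomA_def Vsp_def W12_of_W22)

lemma Vsp_\<zeta>: "Vsp L (\<zeta> j)"
  by (rule Vsp_of_DomA[OF DomA_\<zeta>])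

text \<open>A wave of frequency k is an eigenfunction of the Laplacian with eigenvalue -|k|^2;
  tested with it, the equation for \<open>\<zeta> j\<close> forces the coefficient at k to vanish
  unless |k|^2 = \<open>lam j\<close>.\<close>

lemma Fourier_support_\<zeta>:
  assumes k: "k \<in> Lat L" "k \<bullet> k \<noteq> lam j"
  shows "fc L (\<lambda>x. \<zeta> j x $ i) k = 0 \<and> fs L (\<lambda>x. \<zeta> j x $ i) k = 0"
proof -
  have e: "ip L (\<lambda>x. \<zeta> j x $ i) (\<lambda>x. \<Sum>l\<in>UNIV. pd l (pd l \<phi>) x) = - lam j * ip L (\<lambda>x. \<zeta> j x $ i) \<phi>" if "test L \<phi>" for \<phi>
    using basis that by (simp add: eigenbasis_def eigenfun_def LINT_Dom ip_def)
  have "(\<lambda>x. \<Sum>l\<in>UNIV. pd l (pd l (\<lambda>x. cos (k \<bullet> x))) x) = (\<lambda>x. - (k \<bullet> k) * cos (k \<bullet> x))"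
  proof
    fix x
    have "pd l (pd l (\<lambda>x. cos (k \<bullet> x))) x = - (k $ l * k $ l) * cos (k \<bullet> x)" for l
      unfolding pd_cos_fun by (subst pd_cmult) (simp_all add: trig_differentiable[OF trig_sin1[OF k(1)]] pd_sin)
    then show "(\<Sum>l\<in>UNIV. pd l (pd l (\<lambda>x. cos (k \<bullet> x))) x) = - (k \<bullet> k) * cos (k \<bullet> x)"
      by (simp add: sum_2 inner_vec_def[of k k] algebra_simps)
  qed
  with e[OF test_cos[OF L k(1)]] have "- (k \<bullet> k) * fc L (\<lambda>x. \<zeta> j x $ i) k = - lam j * fc L (\<lambda>x. \<zeta> j x $ i) k"
    unfolding fc_def by (simp only: ip_cmult_right)
  moreover have "(\<lambda>x. \<Sum>l\<in>UNIV. pd l (pd l (\<lambda>x. sin (k \<bullet> x))) x) = (\<lambda>x. - (k \<bullet> k) * sin (k \<bullet> x))"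
  proof
    fix x
    have "pd l (pd l (\<lambda>x. sin (k \<bullet> x))) x = - (k $ l * k $ l) * sin (k \<bullet> x)" for l
      unfolding pd_sin_fun by (subst pd_cmult) (simp_all add: trig_differentiable[OF trig_cos1[OF k(1)]] pd_cos)
    then show "(\<Sum>l\<in>UNIV. pd l (pd l (\<lambda>x. sin (k \<bullet> x))) x) = - (k \<bullet> k) * sin (k \<bullet> x)"
      by (simp add: sum_2 inner_vec_def[of k k] algebra_simps)
  qed
  with e[OF test_sin[OF L k(1)]] have "- (k \<bullet> k) * fs L (\<lambda>x. \<zeta> j x $ i) k = - lam j * fs L (\<lambda>x. \<zeta> j x $ i) k"
    unfolding fs_def by (simp only: ip_cmult_right)
  ultimately show ?thesis using k(2) by simp
qed

text \<open>Only frequencies with |k|^2 = \<open>lam j\<close> contribute, and on them the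
  multiplier is the constant \<open>m (lam j)\<close>.\<close>

lemma ip_fmul_\<zeta>:
  assumes f: "sq_int L f"
  shows "ip L (fmul L r m f) (\<lambda>x. \<zeta> j x $ i) = (if lam j \<le> r then m (lam j) * ip L f (\<lambda>x. \<zeta> j x $ i) else 0)"
proof -
  let ?g = "\<lambda>x. \<zeta> j x $ i"
  have g: "sq_int L ?g" by (rule sqfD[OF sqf_\<zeta>])
  have z: "fc L ?g k = 0 \<and> fs L ?g k = 0" if "k \<in> Lam L r" "k \<bullet> k \<noteq> lam j" for k
    using Fourier_support_\<zeta> that by (simp add: Lam_def)
  show ?thesis
  proof (cases "lam j \<le> r")
    case True
    have "ip L (fmul L r m f) ?g = (\<Sum>k\<in>Lam L r. m (lam j) * (1 / L\<^sup>2 * (fc L f k * fc L ?g k + fs L f k * fs L ?g k)))"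
      unfolding ip_fmul[OF g]
    proof (intro sum.cong refl)
      fix k assume k: "k \<in> Lam L r"
      show "m (k \<bullet> k) / L\<^sup>2 * (fc L f k * fc L ?g k + fs L f k * fs L ?g k) = m (lam j) * (1 / L\<^sup>2 * (fc L f k * fc L ?g k + fs L f k * fs L ?g k))"
        using z[OF k] by (cases "k \<bullet> k = lam j") auto
    qed
    also have "\<dots> = m (lam j) * ip L (fpart L r f) ?g" unfolding ip_fmul[OF g] by (simp only: sum_distrib_left)
    also have "ip L (fpart L r f) ?g = ip L (fpart L r ?g) f"
      unfolding ip_fmul_left_right[OF f g] by (rule ip_commute)
    also have "\<dots> = ip L ?g f"
      by (rule fpart_ident_of_support[OF L g _ f True]) (rule Fourier_support_\<zeta>)
    finally show ?thesis using True by (simp add: ip_commute)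
  next
    case False
    then have "ip L (fmul L r m f) ?g = 0"
      unfolding ip_fmul[OF g] using z by (intro sum.neutral ballI) (auto simp: Lam_def)
    then show ?thesis using False by simp
  qed
qed

lemma l2inner_vmul_\<zeta>:
  assumes u: "sqf L u"
  shows "l2inner L (vmul L r m u) (\<zeta> j) = (if lam j \<le> r then m (lam j) * l2inner L u (\<zeta> j) else 0)"
  by (simp add: l2inner_ip u ip_fmul_\<zeta> sqfD sum_distrib_left)

text \<open>\<open>eigenbasis\<close> asks only that \<open>lam\<close> be monotone, so its
  divergence has to be proved. Eigenfunctions with \<open>lam j\<close> \<le> r live on finitely
  many waves: each contributes 1 to the total sum of squared coefficients, whereas Bessel bounds the
  contribution of every wave over all j.\<close>

lemma finite_lam_le: "finite {j. lam j \<le> r}"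
proof (rule ccontr)
  assume inf: "infinite {j. lam j \<le> r}"
  define B where "B = (\<Sum>i\<in>(UNIV::2 set). \<Sum>k\<in>Lam L r. (ip L (\<lambda>x. cos (k \<bullet> x)) (\<lambda>x. cos (k \<bullet> x)) + ip L (\<lambda>x. sin (k \<bullet> x)) (\<lambda>x. sin (k \<bullet> x))) / L\<^sup>2)"
  have card: "real (card J) \<le> B" if J: "finite J" "J \<subseteq> {j. lam j \<le> r}" for J
  proof -
    \<comment> \<open>A scalar wave placed in component i turns the scalar Fourier coefficient into
      an inner product of fields, to which Bessel's inequality for the orthonormal
      \<open>\<zeta>\<close> applies.\<close>
    have comp: "ip L (\<lambda>x. \<zeta> j x $ i) h = l2inner L (\<lambda>x. axis i (h x)) (\<zeta> j)" for i j h
      by (simp add: l2inner_def LINT_Dom ip_def inner_axis' mult.commute)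
    have sqa: "sqf L (\<lambda>x. axis i (h x))" if "sq_int L h" for i h
      unfolding sqf_def
    proof
      fix l show "sq_int L (\<lambda>x. axis i (h x) $ l)"
        using that by (cases "i = l") (auto simp: axis_def)
    qed
    have B1: "(\<Sum>j\<in>J. (ip L (\<lambda>x. \<zeta> j x $ i) h)\<^sup>2) \<le> ip L h h" if "sq_int L h" for i h
    proof -
      have "(\<Sum>j\<in>J. (l2inner L (\<lambda>x. axis i (h x)) (\<zeta> j))\<^sup>2) \<le> l2inner L (\<lambda>x. axis i (h x)) (\<lambda>x. axis i (h x))"
        by (rule Bessel_l2inner[OF J(1) _ sqa[OF that]]) (auto simp: orthonormal)
      also have "\<dots> = ip L h h" by (simp add: l2inner_def LINT_Dom ip_def inner_axis_axis)
      finally show ?thesis by (simp add: comp)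
    qed
    have one: "1 = (\<Sum>i\<in>UNIV. \<Sum>k\<in>Lam L r. ((fc L (\<lambda>x. \<zeta> j x $ i) k)\<^sup>2 + (fs L (\<lambda>x. \<zeta> j x $ i) k)\<^sup>2) / L\<^sup>2)" if "j \<in> J" for j
    proof -
      have "1 = l2inner L (\<zeta> j) (\<zeta> j)" by (simp add: orthonormal)
      also have "\<dots> = (\<Sum>i\<in>UNIV. ip L (fpart L r (\<lambda>x. \<zeta> j x $ i)) (\<lambda>x. \<zeta> j x $ i))"
        using that J(2) by (auto simp: l2inner_ip ip_fmul_\<zeta> sqfD)
      also have "\<dots> = (\<Sum>i\<in>UNIV. \<Sum>k\<in>Lam L r. ((fc L (\<lambda>x. \<zeta> j x $ i) k)\<^sup>2 + (fs L (\<lambda>x. \<zeta> j x $ i) k)\<^sup>2) / L\<^sup>2)"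
        by (intro sum.cong refl, subst ip_fmul) (auto simp: sqfD power2_eq_square)
      finally show ?thesis .
    qed
    have "real (card J) = (\<Sum>j\<in>J. 1)" by simp
    also have "\<dots> = (\<Sum>j\<in>J. \<Sum>i\<in>UNIV. \<Sum>k\<in>Lam L r. ((fc L (\<lambda>x. \<zeta> j x $ i) k)\<^sup>2 + (fs L (\<lambda>x. \<zeta> j x $ i) k)\<^sup>2) / L\<^sup>2)"
      by (rule sum.cong[OF refl one])
    also have "\<dots> = (\<Sum>i\<in>UNIV. \<Sum>k\<in>Lam L r. \<Sum>j\<in>J. ((fc L (\<lambda>x. \<zeta> j x $ i) k)\<^sup>2 + (fs L (\<lambda>x. \<zeta> j x $ i) k)\<^sup>2) / L\<^sup>2)"
      by (subst sum.swap, intro sum.cong refl, rule sum.swap)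
    also have "\<dots> \<le> B"
      unfolding B_def
    proof (intro sum_mono)
      fix i :: 2 and k
      have "(\<Sum>j\<in>J. ((fc L (\<lambda>x. \<zeta> j x $ i) k)\<^sup>2 + (fs L (\<lambda>x. \<zeta> j x $ i) k)\<^sup>2) / L\<^sup>2)
          = ((\<Sum>j\<in>J. (fc L (\<lambda>x. \<zeta> j x $ i) k)\<^sup>2) + (\<Sum>j\<in>J. (fs L (\<lambda>x. \<zeta> j x $ i) k)\<^sup>2)) / L\<^sup>2"
        by (simp only: sum.distrib sum_divide_distrib[symmetric])
      also have "\<dots> \<le> (ip L (\<lambda>x. cos (k \<bullet> x)) (\<lambda>x. cos (k \<bullet> x)) + ip L (\<lambda>x. sin (k \<bullet> x)) (\<lambda>x. sin (k \<bullet> x))) / L\<^sup>2"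
        unfolding fc_def fs_def by (intro divide_right_mono add_mono B1) simp_all
      finally show "(\<Sum>j\<in>J. ((fc L (\<lambda>x. \<zeta> j x $ i) k)\<^sup>2 + (fs L (\<lambda>x. \<zeta> j x $ i) k)\<^sup>2) / L\<^sup>2) \<le> \<dots>" .
    qed
    finally show ?thesis .
  qed
  obtain n :: nat where n: "B < real n" using reals_Archimedean2 by blast
  obtain J where "J \<subseteq> {j. lam j \<le> r}" "finite J" "card J = n"
    using infinite_arbitrarily_large[OF inf] by blast
  then show False using card[of J] n by simp
qed

text \<open>The truncated field minus its expansion in the eigenbasis lies in H and is orthogonal to
  every \<open>\<zeta> j\<close>, so completeness makes it null. Here v ranges over all
  square-integrable fields, because v will be the advection term, which is not
  divergence-free.\<close>

lemma spectral_sum: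
  assumes u: "Hsp L u" and v: "sqf L v"
  shows "(\<Sum>j | lam j \<le> r. m (lam j) * l2inner L u (\<zeta> j) * l2inner L v (\<zeta> j)) = l2inner L v (vmul L r m u)"
proof -
  let ?J = "{j. lam j \<le> r}"
  let ?p = "\<lambda>x. \<Sum>j\<in>?J. (m (lam j) * l2inner L u (\<zeta> j)) *\<^sub>R \<zeta> j x"
  let ?w = "\<lambda>x. vmul L r m u x - ?p x"
  have Hp: "Hsp L ?p" by (intro Hsp_sum Hsp_scale Hsp_\<zeta>)
  have Hw: "Hsp L ?w" by (intro Hsp_diff Hsp_vmul[OF L u] Hp)
  have pz: "l2inner L ?p w = (\<Sum>j\<in>?J. m (lam j) * l2inner L u (\<zeta> j) * l2inner L (\<zeta> j) w)" if "sqf L w" for w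
    using that by (simp add: l2inner_sum sqf_scale l2inner_scale)
  have "l2inner L ?w (\<zeta> j) = 0" for j
  proof -
    have "l2inner L ?p (\<zeta> j) = (\<Sum>i\<in>?J. if i = j then m (lam j) * l2inner L u (\<zeta> j) else 0)"
      by (subst pz) (auto intro!: sum.cong simp: orthonormal)
    also have "\<dots> = (if lam j \<le> r then m (lam j) * l2inner L u (\<zeta> j) else 0)"
      using finite_lam_le by (simp add: sum.delta)
    finally show ?thesis
      using Hsp_sqf[OF Hp] by (simp add: l2inner_diff l2inner_vmul_\<zeta> Hsp_sqf[OF u])
  qed
  then have w0: "l2inner L ?w ?w = 0" by (rule complete[OF Hw])
  have sqw: "sqf L ?w" by (rule Hsp_sqf[OF Hw])
  \<comment> \<open>The difference \<open>?w\<close> has norm zero but need not vanish pointwise;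
    Cauchy-Schwarz removes it from the pairing.\<close>
  have "ip L (\<lambda>x. v x $ k) (\<lambda>x. ?w x $ k) = 0" for k
  proof -
    have "(\<Sum>k\<in>UNIV. ip L (\<lambda>x. ?w x $ k) (\<lambda>x. ?w x $ k)) = 0"
      using w0 by (simp only: l2inner_ip[OF sqw sqw])
    then have "ip L (\<lambda>x. ?w x $ k) (\<lambda>x. ?w x $ k) = 0"
      by (subst (asm) sum_nonneg_eq_0_iff) (auto simp del: vector_minus_component)
    then have "(ip L (\<lambda>x. v x $ k) (\<lambda>x. ?w x $ k))\<^sup>2 \<le> 0"
      using ip_Cauchy_Schwarz[OF sqfD[OF v] sqfD[OF sqw], of k k] by (simp del: vector_minus_component)
    then show ?thesis by simp
  qed
  then have "l2inner L v ?w = 0" unfolding l2inner_ip[OF v sqw] by (rule sum.neutral[rule_format])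
  then have "l2inner L v (vmul L r m u) = l2inner L ?p v"
    using l2inner_diff[OF sqf_vmul Hsp_sqf[OF Hp] v] by (simp add: l2inner_commute[of L v])
  also have "\<dots> = (\<Sum>j\<in>?J. m (lam j) * l2inner L u (\<zeta> j) * l2inner L v (\<zeta> j))"
    by (subst pz[OF v]) (simp only: l2inner_commute[of L v])
  finally show ?thesis by simp
qed

text \<open>Monotonicity of \<open>lam\<close> puts every initial segment of indices inside some
  spectral ball, where Fourier truncation gives the bound.\<close>

lemma summable_spectral:
  fixes x :: "nat \<Rightarrow> real"
  assumes "\<And>j. 0 \<le> x j" "\<And>r. (\<Sum>j | lam j \<le> r. x j) \<le> C"
  shows "summable x"
proof (rule summableI_nonneg_bounded)
  fix n
  have "(\<Sum>j<n. x j) \<le> (\<Sum>j | lam j \<le> lam n. x j)"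
    by (rule sum_mono2[OF finite_lam_le]) (auto simp: lam_mono assms(1))
  also have "\<dots> \<le> C" by (rule assms(2))
  finally show "(\<Sum>j<n. x j) \<le> C" .
qed (rule assms(1))

lemma ip_fmul_self:
  assumes "sq_int L f"
  shows "ip L f (fmul L r m f) = (\<Sum>k\<in>Lam L r. m (k \<bullet> k) * ((fc L f k)\<^sup>2 + (fs L f k)\<^sup>2) / L\<^sup>2)"
  unfolding ip_commute[of L f] ip_fmul[OF assms] by (simp add: power2_eq_square)

text \<open>On the Fourier side the truncated sum is the sum of squared coefficients of all weak
  derivatives, which Bessel bounds by the Dirichlet energy.\<close>

lemma summable_V:
  assumes u: "Vsp L u" shows "summable (\<lambda>j. lam j * (l2inner L u (\<zeta> j))\<^sup>2)"
proof -
  have H: "Hsp L u" and W: "\<And>k. W1s L (\<lambda>x. u x $ k)" using u by (auto simp: Vsp_def W12_def)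
  then have "\<forall>k i. \<exists>g. sq_int L g \<and> weak_pd L i (\<lambda>x. u x $ k) g" unfolding W1s_def by blast
  then obtain g where g: "\<And>k i. sq_int L (g k i)" "\<And>k i. weak_pd L i (\<lambda>x. u x $ k) (g k i)" by metis
  have sq: "sqf L u" by (rule Hsp_sqf[OF H])
  show ?thesis
  proof (rule summable_spectral)
    fix r
    have "(\<Sum>j | lam j \<le> r. lam j * (l2inner L u (\<zeta> j))\<^sup>2) = l2inner L u (vmul L r (\<lambda>s. s) u)"
      using spectral_sum[OF H sq, of "\<lambda>s. s" r] by (simp add: power2_eq_square mult.assoc)
    also have "\<dots> = (\<Sum>k\<in>UNIV. \<Sum>\<kappa>\<in>Lam L r. (\<kappa> \<bullet> \<kappa>) * ((fc L (\<lambda>x. u x $ k) \<kappa>)\<^sup>2 + (fs L (\<lambda>x. u x $ k) \<kappa>)\<^sup>2) / L\<^sup>2)"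
      by (simp add: l2inner_ip sq ip_fmul_self sqfD)
    also have "\<dots> = (\<Sum>k\<in>UNIV. \<Sum>i\<in>UNIV. \<Sum>\<kappa>\<in>Lam L r. ((fc L (g k i) \<kappa>)\<^sup>2 + (fs L (g k i) \<kappa>)\<^sup>2) / L\<^sup>2)"
    proof (rule sum.cong[OF refl], subst sum.swap, rule sum.cong[OF refl])
      fix k \<kappa> assume "\<kappa> \<in> Lam L r"
      then have l: "\<kappa> \<in> Lat L" by (rule Lam_Lat)
      show "\<kappa> \<bullet> \<kappa> * ((fc L (\<lambda>x. u x $ k) \<kappa>)\<^sup>2 + (fs L (\<lambda>x. u x $ k) \<kappa>)\<^sup>2) / L\<^sup>2 = (\<Sum>i\<in>UNIV. ((fc L (g k i) \<kappa>)\<^sup>2 + (fs L (g k i) \<kappa>)\<^sup>2) / L\<^sup>2)"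
        unfolding fc_weak_pd[OF L l g(2)]
        by (simp add: inner_vec_def sum_2 add_divide_distrib[symmetric] power2_eq_square algebra_simps)
    qed
    also have "\<dots> \<le> (\<Sum>k\<in>UNIV. \<Sum>i\<in>UNIV. ip L (g k i) (g k i))"
      by (intro sum_mono Bessel_Fourier[OF L g(1)])
    finally show "(\<Sum>j | lam j \<le> r. lam j * (l2inner L u (\<zeta> j))\<^sup>2) \<le> (\<Sum>k\<in>UNIV. \<Sum>i\<in>UNIV. ip L (g k i) (g k i))" .
  qed (simp add: less_imp_le[OF lam_pos])
qed

section \<open>Orthogonality of the nonlinearity and Au for u in the domain of A\<close>

definition wLap :: "field \<Rightarrow> 2 \<Rightarrow> pt \<Rightarrow> real" where
  "wLap u k = (SOME l. weak_Lap L (\<lambda>x. u x $ k) l)"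

lemma weak_Lap_wLap: assumes "DomA L u" shows "weak_Lap L (\<lambda>x. u x $ k) (wLap u k)"
proof -
  have "\<exists>l. weak_Lap L (\<lambda>x. u x $ k) l"
    using assms W2s_weak_Lap[OF L] unfolding DomA_def W22_def by blast
  then show ?thesis unfolding wLap_def by (rule someI_ex)
qed

lemma summable_DomA:
  assumes u: "DomA L u" shows "summable (\<lambda>j. (lam j)\<^sup>2 * (l2inner L u (\<zeta> j))\<^sup>2)"
proof -
  have H: "Hsp L u" using u by (simp add: DomA_def)
  note l = weak_Lap_wLap[OF u]
  have sq: "sqf L u" by (rule Hsp_sqf[OF H])
  show ?thesis
  proof (rule summable_spectral)
    fix r
    have "(\<Sum>j | lam j \<le> r. (lam j)\<^sup>2 * (l2inner L u (\<zeta> j))\<^sup>2) = l2inner L u (vmul L r (\<lambda>s. s\<^sup>2) u)"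
      using spectral_sum[OF H sq, of "\<lambda>s. s\<^sup>2" r] by (simp add: power2_eq_square mult.assoc)
    also have "\<dots> = (\<Sum>k\<in>UNIV. \<Sum>\<kappa>\<in>Lam L r. (\<kappa> \<bullet> \<kappa>)\<^sup>2 * ((fc L (\<lambda>x. u x $ k) \<kappa>)\<^sup>2 + (fs L (\<lambda>x. u x $ k) \<kappa>)\<^sup>2) / L\<^sup>2)"
      by (simp add: l2inner_ip sq ip_fmul_self sqfD)
    also have "\<dots> \<le> (\<Sum>k\<in>UNIV. ip L (wLap u k) (wLap u k))"
      by (intro sum_mono sum_square_Lap_le[OF L l])
    finally show "(\<Sum>j | lam j \<le> r. (lam j)\<^sup>2 * (l2inner L u (\<zeta> j))\<^sup>2) \<le> (\<Sum>k\<in>UNIV. ip L (wLap u k) (wLap u k))" .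
  qed simp
qed

lemma weak_pd_wgrad:
  assumes "DomA L u"
  shows "sq_int L (wgrad L u k i)" "weak_pd L i (\<lambda>x. u x $ k) (wgrad L u k i)"
proof -
  have "\<exists>g. sq_int L g \<and> weak_pd L i (\<lambda>x. u x $ k) g"
    using Vsp_of_DomA[OF assms] by (simp add: Vsp_def W12_def W1s_def)
  from someI_ex[OF this] show "sq_int L (wgrad L u k i)" "weak_pd L i (\<lambda>x. u x $ k) (wgrad L u k i)"
    unfolding wgrad_def by auto
qed

lemma ip_sq_tendsto_add:
  assumes "\<And>n. sq_int L (f n)" "\<And>n. sq_int L (g n)"
    and "(\<lambda>n. ip L (f n) (f n)) \<longlonglongrightarrow> 0" "(\<lambda>n. ip L (g n) (g n)) \<longlonglongrightarrow> 0"
  shows "(\<lambda>n::nat. ip L (\<lambda>x. f n x + g n x) (\<lambda>x. f n x + g n x)) \<longlonglongrightarrow> 0"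
proof (rule tendsto_sandwich[OF always_eventually always_eventually])
  show "\<forall>n. 0 \<le> ip L (\<lambda>x. f n x + g n x) (\<lambda>x. f n x + g n x)" by simp
  show "\<forall>n. ip L (\<lambda>x. f n x + g n x) (\<lambda>x. f n x + g n x) \<le> 2 * ip L (f n) (f n) + 2 * ip L (g n) (g n)"
    using assms(1,2) ip_sum_sq_le by blast
  show "(\<lambda>n. 2 * ip L (f n) (f n) + 2 * ip L (g n) (g n)) \<longlonglongrightarrow> 0"
    using tendsto_add[OF tendsto_mult_left[OF assms(3), of 2] tendsto_mult_left[OF assms(4), of 2]] by simp
qed simp

lemma ip_fpart_le:
  assumes "sq_int L f" shows "ip L (fpart L r f) (fpart L r f) \<le> ip L f f"
proof -
  have "ip L (fpart L r f) (fpart L r f) = ip L f (fpart L r f)"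
    using ip_fmul_fmul[OF L assms assms, of r "\<lambda>_. 1" "\<lambda>_. 1"] by (simp add: ip_commute)
  also have "\<dots> \<le> ip L f f"
    unfolding ip_fmul_self[OF assms] using Bessel_Fourier[OF L assms] by simp
  finally show ?thesis .
qed

text \<open>Split f G - S f S G = f (G - S G) + (f - S f) S G, with S the truncation. The first part
  is small since f is bounded and S G converges in L^2, the second since S f converges uniformly and
  S G stays bounded in L^2; G itself need not be bounded.\<close>

lemma advection_tendsto:
  assumes f: "sq_int L f" and l: "weak_Lap L f l" and G: "sq_int L G"
  shows "sq_int L (\<lambda>x. f x * G x)"
    and "(\<lambda>n. ip L (\<lambda>x. f x * G x - fpart L (real n) f x * fpart L (real n) G x)
                 (\<lambda>x. f x * G x - fpart L (real n) f x * fpart L (real n) G x)) \<longlonglongrightarrow> 0"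
proof -
  obtain \<epsilon> where e: "\<epsilon> \<longlonglongrightarrow> 0" "\<And>n. AE x in cell L. \<bar>f x - fpart L (real n) f x\<bar> \<le> \<epsilon> n"
    using fpart_uniform[OF L f l] by blast
  obtain B where B: "AE x in cell L. \<bar>f x\<bar> \<le> B" using weak_Lap_AE_bounded[OF L f l] .
  have fm: "f \<in> borel_measurable borel" by (rule sq_int_measurable[OF f])
  show fG: "sq_int L (\<lambda>x. f x * G x)" by (rule sq_int_mult_bounded[OF G fm B])
  have dm: "(\<lambda>x. f x - fpart L (real n) f x) \<in> borel_measurable borel" for n
    by (rule sq_int_measurable[OF sq_int_diff[OF f sq_int_fmul]])
  define p where "p n = (\<lambda>x. f x * (G x - fpart L (real n) G x))" for n
  define s where "s n = (\<lambda>x. (f x - fpart L (real n) f x) * fpart L (real n) G x)" for n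
  have p: "sq_int L (p n)" for n unfolding p_def by (rule sq_int_mult_bounded[OF sq_int_diff[OF G sq_int_fmul] fm B])
  have s: "sq_int L (s n)" for n unfolding s_def by (rule sq_int_mult_bounded[OF sq_int_fmul dm e(2)])
  have p0: "(\<lambda>n. ip L (p n) (p n)) \<longlonglongrightarrow> 0"
  proof (rule tendsto_sandwich[OF always_eventually always_eventually])
    show "\<forall>n. 0 \<le> ip L (p n) (p n)" by simp
    show "\<forall>n. ip L (p n) (p n) \<le> B\<^sup>2 * ip L (\<lambda>x. G x - fpart L (real n) G x) (\<lambda>x. G x - fpart L (real n) G x)"
      unfolding p_def using ip_mult_bounded[OF sq_int_diff[OF G sq_int_fmul] fm B] by blast
    show "(\<lambda>n. B\<^sup>2 * ip L (\<lambda>x. G x - fpart L (real n) G x) (\<lambda>x. G x - fpart L (real n) G x)) \<longlonglongrightarrow> 0"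
      using tendsto_mult_left[OF fpart_tendsto[OF L G], of "B\<^sup>2"] by simp
  qed simp
  have s0: "(\<lambda>n. ip L (s n) (s n)) \<longlonglongrightarrow> 0"
  proof (rule tendsto_sandwich[OF always_eventually always_eventually])
    show "\<forall>n. 0 \<le> ip L (s n) (s n)" by simp
    show "\<forall>n. ip L (s n) (s n) \<le> (\<epsilon> n)\<^sup>2 * ip L G G"
    proof
      fix n
      have "ip L (s n) (s n) \<le> (\<epsilon> n)\<^sup>2 * ip L (fpart L (real n) G) (fpart L (real n) G)"
        unfolding s_def by (rule ip_mult_bounded[OF sq_int_fmul dm e(2)])
      also have "\<dots> \<le> (\<epsilon> n)\<^sup>2 * ip L G G" by (intro mult_left_mono ip_fpart_le G) simp
      finally show "ip L (s n) (s n) \<le> (\<epsilon> n)\<^sup>2 * ip L G G" .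
    qed
    show "(\<lambda>n. (\<epsilon> n)\<^sup>2 * ip L G G) \<longlonglongrightarrow> 0"
      using tendsto_mult_right[OF tendsto_power[OF e(1), of 2], of "ip L G G"] by simp
  qed simp
  have "(\<lambda>x. f x * G x - fpart L (real n) f x * fpart L (real n) G x) = (\<lambda>x. p n x + s n x)" for n
    by (simp add: p_def s_def algebra_simps)
  then show "(\<lambda>n. ip L (\<lambda>x. f x * G x - fpart L (real n) f x * fpart L (real n) G x)
                 (\<lambda>x. f x * G x - fpart L (real n) f x * fpart L (real n) G x)) \<longlonglongrightarrow> 0"
    using ip_sq_tendsto_add[OF p s p0 s0] by simp
qed

text \<open>The sum over \<open>lam j\<close> \<le> n pairs the advection term b with the truncation
  of Au. Replacing b by the advection of the truncated field gives exactly 0 by the smooth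
  cancellation, and the error is small in L^2 while the truncations of Au stay bounded.\<close>

lemma Bform_orthogonal:
  assumes u: "DomA L u"
  shows "(\<lambda>j. lam j * l2inner L u (\<zeta> j) * Bform L u u (\<zeta> j)) sums 0"
proof -
  have H: "Hsp L u" using u by (simp add: DomA_def)
  have sq: "\<And>k. sq_int L (\<lambda>x. u x $ k)" using Hsp_sqf[OF H] by (simp add: sqfD)
  note l = weak_Lap_wLap[OF u]
  define G where "G = wgrad L u"
  have G: "sq_int L (G k i)" "weak_pd L i (\<lambda>x. u x $ k) (G k i)" for k i
    unfolding G_def using weak_pd_wgrad[OF u] by auto
  define b :: field where "b x = (\<chi> k. \<Sum>i\<in>UNIV. u x $ i * G k i x)" for x
  have bs: "sqf L b"
    unfolding sqf_def b_def by (auto intro!: sq_int_sum advection_tendsto(1)[OF sq l G(1)])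
  have Bb: "Bform L u u w = l2inner L b w" for w
    unfolding Bform_def l2inner_def inner_vec_def by (simp add: b_def G_def)
  let ?S = "\<lambda>n k. fpart L (real n) (\<lambda>x. u x $ k)"
  let ?M = "\<lambda>n k. fmul L (real n) (\<lambda>s. s) (\<lambda>x. u x $ k)"
  \<comment> \<open>The defect between the advection term of u and that of its truncation.\<close>
  define d where "d n k = (\<lambda>x. b x $ k - (\<Sum>i\<in>UNIV. ?S n i x * pd i (?S n k) x))" for n k
  have Sb: "sq_int L (\<lambda>x. \<Sum>i\<in>UNIV. ?S n i x * pd i (?S n k) x)" for n k
    by (intro trig_sq_int trig_sum trig_mult trig_fmul trig_pd)
  have ds: "sq_int L (d n k)" for n k unfolding d_def by (intro sq_int_diff sqfD[OF bs] Sb)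
  have d0: "(\<lambda>n. ip L (d n k) (d n k)) \<longlonglongrightarrow> 0" for k
  proof -
    let ?t = "\<lambda>n i x. u x $ i * G k i x - ?S n i x * fpart L (real n) (G k i) x"
    have dn: "d n k = (\<lambda>x. ?t n 1 x + ?t n 2 x)" for n
      unfolding d_def b_def pd_fmul[OF L G(2)] by (simp add: sum_2 algebra_simps)
    have t: "sq_int L (?t n i)" for n i
      by (intro sq_int_diff advection_tendsto(1)[OF sq l G(1)] trig_sq_int trig_mult trig_fmul)
    show ?thesis unfolding dn
      by (rule ip_sq_tendsto_add[OF t t]) (rule advection_tendsto(2)[OF sq l G(1)])+
  qed
  have spec: "(\<Sum>j | lam j \<le> real n. lam j * l2inner L u (\<zeta> j) * Bform L u u (\<zeta> j)) = (\<Sum>k\<in>UNIV. ip L (d n k) (?M n k))" for n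
  proof -
    have "(\<Sum>k\<in>UNIV. ip L (\<lambda>x. \<Sum>i\<in>UNIV. ?S n i x * pd i (?S n k) x) (\<lambda>x. \<Sum>j\<in>UNIV. pd j (pd j (?S n k)) x)) = (0::real)"
      by (rule integral_advection_Laplacian[OF L trig_fmul divfree_vmul[OF L H]])
    then have z: "(\<Sum>k\<in>UNIV. ip L (\<lambda>x. \<Sum>i\<in>UNIV. ?S n i x * pd i (?S n k) x) (?M n k)) = 0"
      unfolding Laplacian_fmul[OF L] by (simp add: ip_commute[of L _ "\<lambda>x. - _ x"] sum_negf ip_commute[of L "fmul L _ _ _"])
    have "(\<Sum>j | lam j \<le> real n. lam j * l2inner L u (\<zeta> j) * Bform L u u (\<zeta> j)) = l2inner L b (vmul L (real n) (\<lambda>s. s) u)"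
      unfolding Bb by (rule spectral_sum[OF H bs])
    also have "\<dots> = (\<Sum>k\<in>UNIV. ip L (\<lambda>x. b x $ k) (?M n k))"
      by (simp add: l2inner_ip bs)
    also have "\<dots> = (\<Sum>k\<in>UNIV. ip L (d n k) (?M n k)) + (\<Sum>k\<in>UNIV. ip L (\<lambda>x. \<Sum>i\<in>UNIV. ?S n i x * pd i (?S n k) x) (?M n k))"
      unfolding d_def by (simp add: ip_diff_left[OF sqfD[OF bs] Sb sq_int_fmul] flip: sum.distrib)
    finally show ?thesis unfolding z by simp
  qed
  have lim: "(\<lambda>n. \<Sum>j | lam j \<le> real n. lam j * l2inner L u (\<zeta> j) * Bform L u u (\<zeta> j)) \<longlonglongrightarrow> 0"
  proof -
    have "(\<lambda>n. ip L (d n k) (?M n k)) \<longlonglongrightarrow> 0" for k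
    proof -
      have M: "ip L (?M n k) (?M n k) \<le> ip L (wLap u k) (wLap u k)" for n
      proof -
        have "ip L (?M n k) (?M n k) = ip L (\<lambda>x. u x $ k) (fmul L (real n) (\<lambda>s. s\<^sup>2) (\<lambda>x. u x $ k))"
          using ip_fmul_fmul[OF L sq sq, of "real n" "\<lambda>s. s" k "\<lambda>s. s" k] by (simp add: ip_commute power2_eq_square)
        also have "\<dots> \<le> ip L (wLap u k) (wLap u k)"
          unfolding ip_fmul_self[OF sq] by (rule sum_square_Lap_le[OF L l])
        finally show ?thesis .
      qed
      have "(ip L (d n k) (?M n k))\<^sup>2 \<le> ip L (d n k) (d n k) * ip L (wLap u k) (wLap u k)" for n
        by (rule order_trans[OF ip_Cauchy_Schwarz[OF ds sq_int_fmul]]) (intro mult_left_mono M ip_nonneg)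
      moreover have "(\<lambda>n. ip L (d n k) (d n k) * ip L (wLap u k) (wLap u k)) \<longlonglongrightarrow> 0"
        using tendsto_mult_right[OF d0[of k], of "ip L (wLap u k) (wLap u k)"] by simp
      ultimately have "(\<lambda>n. (ip L (d n k) (?M n k))\<^sup>2) \<longlonglongrightarrow> 0"
        using Lim_null_comparison[of "\<lambda>n. (ip L (d n k) (?M n k))\<^sup>2" "\<lambda>n. ip L (d n k) (d n k) * ip L (wLap u k) (wLap u k)" sequentially]
        by (simp add: always_eventually)
      from tendsto_real_sqrt[OF this] show ?thesis by (simp add: tendsto_rabs_zero_iff)
    qed
    then have "(\<lambda>n. \<Sum>k\<in>UNIV. ip L (d n k) (?M n k)) \<longlonglongrightarrow> (\<Sum>k\<in>(UNIV::2 set). 0)" by (intro tendsto_sum)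
    then show ?thesis unfolding spec by simp
  qed
  let ?x = "\<lambda>j. lam j * l2inner L u (\<zeta> j) * Bform L u u (\<zeta> j)"
  \<comment> \<open>The cut-offs give a limit only along spectral balls. Convergence of the series
    itself is obtained from the squares of the coefficients of Au and of b, both summable.\<close>
  have "summable ?x"
  proof (rule summable_comparison_test)
    have "summable (\<lambda>j. (l2inner L b (\<zeta> j))\<^sup>2)"
      by (rule summableI_nonneg_bounded) (auto intro!: Bessel_l2inner bs simp: orthonormal)
    then show "summable (\<lambda>j. (lam j)\<^sup>2 * (l2inner L u (\<zeta> j))\<^sup>2 + (l2inner L b (\<zeta> j))\<^sup>2)"
      by (intro summable_add summable_DomA[OF u])
    have "\<bar>x * y\<bar> \<le> x\<^sup>2 + y\<^sup>2" for x y :: real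
      using sum_squares_bound[of "\<bar>x\<bar>" "\<bar>y\<bar>"] mult_nonneg_nonneg[of "\<bar>x\<bar>" "\<bar>y\<bar>"] unfolding abs_mult power2_abs by linarith
    then show "\<exists>N. \<forall>n\<ge>N. norm (?x n) \<le> (lam n)\<^sup>2 * (l2inner L u (\<zeta> n))\<^sup>2 + (l2inner L b (\<zeta> n))\<^sup>2"
      unfolding Bb real_norm_def power_mult_distrib[symmetric] by blast
  qed
  then have S: "(\<lambda>n. \<Sum>j<n. ?x j) \<longlonglongrightarrow> suminf ?x" by (rule summable_LIMSEQ)
  \<comment> \<open>As \<open>lam\<close> is monotone, spectral balls are initial segments of the
    indices, so the limit along them is the sum of the series.\<close>
  have dc: "{j. lam j \<le> r} = {..<card {j. lam j \<le> r}}" for r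
  proof -
    have "\<exists>N. {j. lam j \<le> r} = {..<N}"
    proof (cases "{j. lam j \<le> r} = {}")
      case False
      have "{j. lam j \<le> r} = {..Max {j. lam j \<le> r}}"
        using Max_in[OF finite_lam_le False] Max_ge[OF finite_lam_le] by (auto intro: order_trans[OF lam_mono])
      then show ?thesis by (metis lessThan_Suc_atMost)
    qed auto
    then show ?thesis by (metis card_lessThan)
  qed
  have "filterlim (\<lambda>n. card {j. lam j \<le> real n}) at_top sequentially"
    unfolding filterlim_at_top eventually_sequentially
  proof
    fix Z
    obtain n0 :: nat where n0: "lam Z \<le> real n0" using real_arch_simple by blast
    have "Z \<le> card {j. lam j \<le> real n}" if "n \<ge> n0" for n
    proof -
      have "{..<Z} \<subseteq> {j. lam j \<le> real n}"
      proof
        fix i assume "i \<in> {..<Z}"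
        then have "lam i \<le> lam Z" by (intro lam_mono) simp
        then show "i \<in> {j. lam j \<le> real n}" using n0 that by simp
      qed
      from card_mono[OF finite_lam_le this] show ?thesis by simp
    qed
    then show "\<exists>N. \<forall>n\<ge>N. Z \<le> card {j. lam j \<le> real n}" by blast
  qed
  from filterlim_compose[OF S this]
  have "(\<lambda>n. \<Sum>j | lam j \<le> real n. ?x j) \<longlonglongrightarrow> suminf ?x" by (subst dc)
  then have "suminf ?x = 0" using lim LIMSEQ_unique by blast
  then show ?thesis using \<open>summable ?x\<close> by (simp add: sums_iff)
qed

end

section \<open>Exponential moments of the noise\<close>

text \<open>Completing the square: the integrand is a multiple of a normal density with variance
  \<sigma>^2/D and mean B \<sigma>^2/D, where D = 1 - 2 A \<sigma>^2 > 0.\<close>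

lemma gaussian_exp_integral:
  assumes s: "0 < \<sigma>" and A: "2 * A * \<sigma>\<^sup>2 < 1"
  shows "(\<integral>\<^sup>+y. ennreal (normal_density 0 \<sigma> y) * ennreal (exp (A * y\<^sup>2 + B * y)) \<partial>lborel)
    = ennreal (exp (B\<^sup>2 * \<sigma>\<^sup>2 / (2 * (1 - 2 * A * \<sigma>\<^sup>2))) / sqrt (1 - 2 * A * \<sigma>\<^sup>2))"
proof -
  define D where "D = 1 - 2 * A * \<sigma>\<^sup>2"
  have D: "0 < D" using A by (simp add: D_def)
  define \<tau> where "\<tau> = \<sigma> / sqrt D"
  have t: "0 < \<tau>" "\<tau>\<^sup>2 = \<sigma>\<^sup>2 / D" using s D by (simp_all add: \<tau>_def power_divide)
  define C where "C = exp (B\<^sup>2 * \<sigma>\<^sup>2 / (2 * D)) / sqrt D"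
  have e: "normal_density 0 \<sigma> y * exp (A * y\<^sup>2 + B * y) = C * normal_density (B * \<tau>\<^sup>2) \<tau> y" for y
  proof -
    have e1: "- (y - 0)\<^sup>2 / (2 * \<sigma>\<^sup>2) + (A * y\<^sup>2 + B * y) = B\<^sup>2 * \<sigma>\<^sup>2 / (2 * D) + - (y - B * \<tau>\<^sup>2)\<^sup>2 / (2 * \<tau>\<^sup>2)"
    proof -
      have "- (y - 0)\<^sup>2 / (2 * \<sigma>\<^sup>2) + (A * y\<^sup>2 + B * y) = (- D * y\<^sup>2 + 2 * B * \<sigma>\<^sup>2 * y) / (2 * \<sigma>\<^sup>2)"
        using s by (simp add: D_def field_simps)
      also have "\<dots> = B\<^sup>2 * \<sigma>\<^sup>2 / (2 * D) + - (y - B * \<tau>\<^sup>2)\<^sup>2 / (2 * \<tau>\<^sup>2)"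
        unfolding t(2) using s D by (simp add: field_simps power2_eq_square)
      finally show ?thesis .
    qed
    have e2: "1 / sqrt (2 * pi * \<sigma>\<^sup>2) = 1 / sqrt D * (1 / sqrt (2 * pi * \<tau>\<^sup>2))"
      unfolding t(2) using D s by (simp add: real_sqrt_mult real_sqrt_divide)
    have "normal_density 0 \<sigma> y * exp (A * y\<^sup>2 + B * y) = 1 / sqrt (2 * pi * \<sigma>\<^sup>2) * exp (- (y - 0)\<^sup>2 / (2 * \<sigma>\<^sup>2) + (A * y\<^sup>2 + B * y))"
      unfolding normal_density_def exp_add by simp
    also have "\<dots> = C * normal_density (B * \<tau>\<^sup>2) \<tau> y"
      unfolding e1 e2 normal_density_def C_def exp_add by simp
    finally show ?thesis .
  qed
  have "(\<integral>\<^sup>+y. ennreal (normal_density 0 \<sigma> y) * ennreal (exp (A * y\<^sup>2 + B * y)) \<partial>lborel)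
      = (\<integral>\<^sup>+y. ennreal C * ennreal (normal_density (B * \<tau>\<^sup>2) \<tau> y) \<partial>lborel)"
    using D by (intro nn_integral_cong) (simp add: e C_def flip: ennreal_mult)
  also have "\<dots> = ennreal C * (\<integral>\<^sup>+y. ennreal (normal_density (B * \<tau>\<^sup>2) \<tau> y) \<partial>lborel)"
    by (rule nn_integral_cmult) measurable
  also have "(\<integral>\<^sup>+y. ennreal (normal_density (B * \<tau>\<^sup>2) \<tau> y) \<partial>lborel) = 1"
  proof -
    interpret N: prob_space "density lborel (normal_density (B * \<tau>\<^sup>2) \<tau>)"
      by (rule prob_space_normal_density[OF t(1)])
    show ?thesis using N.emeasure_space_1 by (simp add: emeasure_density)
  qed
  finally show ?thesis by (simp add: C_def D_def)
qed

text \<open>(1 + 2x)(1 - x) = 1 + x(1 - 2x) is at least 1 up to x = 1/2. This is the origin of the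
  condition 2 \<mu> K0 h \<le> 1/2 and of the factor 2 in the compensator 2 \<mu> K0 h.\<close>

lemma inverse_sqrt_le_exp:
  fixes x :: real
  assumes "0 \<le> x" "x \<le> 1/2" shows "1 / sqrt (1 - x) \<le> exp x"
proof -
  have "1 * 1 \<le> (1 + 2 * x) * (1 - x)"
    using assms mult_nonneg_nonneg[of x "1 - 2 * x"] by (simp add: algebra_simps)
  also have "\<dots> \<le> exp (2 * x) * (1 - x)"
    using assms by (intro mult_right_mono exp_ge_add_one_self) auto
  finally have "1 / (1 - x) \<le> exp (2 * x)" using assms by (simp add: pos_divide_le_eq)
  then have "sqrt (1 / (1 - x)) \<le> sqrt ((exp x)\<^sup>2)"
    by (intro real_sqrt_le_mono) (simp add: exp_double)
  then show ?thesis by (simp add: real_sqrt_divide)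
qed

context prob_space
begin

text \<open>Fubini for the joint law, which is a product measure. The target \<open>S\<close> of X
  is arbitrary, so that X can be the identity into a smaller sigma-algebra; this does the work of
  conditioning on the past.\<close>

lemma nn_integral_indep_pair:
  fixes g :: "'a \<Rightarrow> real"
  assumes X: "X \<in> measurable M S" and g: "g \<in> borel_measurable M"
    and ind: "\<And>A B. A \<in> sets S \<Longrightarrow> B \<in> sets borel \<Longrightarrow>
      prob ((X -` A \<inter> space M) \<inter> (g -` B \<inter> space M)) = prob (X -` A \<inter> space M) * prob (g -` B \<inter> space M)"
    and \<Phi>: "(\<lambda>(x, y). \<Phi> x y) \<in> borel_measurable (S \<Otimes>\<^sub>M borel)"
  shows "(\<integral>\<^sup>+\<omega>. \<Phi> (X \<omega>) (g \<omega>) \<partial>M) = (\<integral>\<^sup>+\<omega>. (\<integral>\<^sup>+y. \<Phi> (X \<omega>) y \<partial>distr M borel g) \<partial>M)"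
proof -
  have XY: "(\<lambda>x. (X x, g x)) \<in> measurable M (S \<Otimes>\<^sub>M borel)" by (rule measurable_Pair[OF X g])
  have eq: "distr M S X \<Otimes>\<^sub>M distr M borel g = distr M (S \<Otimes>\<^sub>M borel) (\<lambda>x. (X x, g x))"
  proof (rule pair_measure_eqI)
    show "sigma_finite_measure (distr M S X)" "sigma_finite_measure (distr M borel g)"
      by (intro prob_space_imp_sigma_finite prob_space_distr X g)+
    show "sets (distr M S X \<Otimes>\<^sub>M distr M borel g) = sets (distr M (S \<Otimes>\<^sub>M borel) (\<lambda>x. (X x, g x)))"
      by (simp cong: sets_pair_measure_cong)
    fix A B assume "A \<in> sets (distr M S X)" "B \<in> sets (distr M borel g)"
    then have AB: "A \<in> sets S" "B \<in> sets borel" by auto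
    have "(\<lambda>x. (X x, g x)) -` (A \<times> B) \<inter> space M = (X -` A \<inter> space M) \<inter> (g -` B \<inter> space M)" by auto
    then show "emeasure (distr M S X) A * emeasure (distr M borel g) B = emeasure (distr M (S \<Otimes>\<^sub>M borel) (\<lambda>x. (X x, g x))) (A \<times> B)"
      using ind[OF AB] AB X g XY
      by (simp add: emeasure_distr emeasure_eq_measure ennreal_mult)
  qed
  interpret N: prob_space "distr M borel g" by (rule prob_space_distr[OF g])
  have "(\<integral>\<^sup>+\<omega>. \<Phi> (X \<omega>) (g \<omega>) \<partial>M) = (\<integral>\<^sup>+z. (\<lambda>(x, y). \<Phi> x y) z \<partial>distr M (S \<Otimes>\<^sub>M borel) (\<lambda>x. (X x, g x)))"
    using X g \<Phi> by (subst nn_integral_distr) auto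
  also have "\<dots> = (\<integral>\<^sup>+z. (\<lambda>(x, y). \<Phi> x y) z \<partial>(distr M S X \<Otimes>\<^sub>M distr M borel g))" by (simp add: eq)
  also have "\<dots> = (\<integral>\<^sup>+x. (\<integral>\<^sup>+y. \<Phi> x y \<partial>distr M borel g) \<partial>distr M S X)"
    using \<Phi> by (subst N.nn_integral_fst[symmetric]) (auto cong: measurable_cong_sets)
  also have "\<dots> = (\<integral>\<^sup>+\<omega>. (\<integral>\<^sup>+y. \<Phi> (X \<omega>) y \<partial>distr M borel g) \<partial>M)"
  proof -
    have "(\<lambda>(x, y). \<Phi> x y) \<in> borel_measurable (S \<Otimes>\<^sub>M distr M borel g)"
      using \<Phi> by (simp cong: measurable_cong_sets)
    from N.borel_measurable_nn_integral[OF this]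
    show ?thesis by (intro nn_integral_distr[OF X]) simp
  qed
  finally show ?thesis .
qed

text \<open>The noise coordinates are integrated out one at a time, starting with the last. The
  bound obtained is a function of the past and is moved into \<open>f\<close>, which is why f is
  arbitrary in the induction.\<close>

lemma nn_integral_prod_indep_le:
  fixes g :: "nat \<Rightarrow> 'a \<Rightarrow> real" and \<phi> :: "nat \<Rightarrow> real \<Rightarrow> real \<Rightarrow> ennreal"
  assumes G: "subalgebra M G"
    and ind: "indep_sets (\<lambda>k. case k of None \<Rightarrow> sets G | Some j \<Rightarrow> {g j -` A \<inter> space M | A. A \<in> sets borel}) UNIV"
    and g: "\<And>j. g j \<in> borel_measurable M"
    and p: "\<And>j. p j \<in> borel_measurable G"
    and \<phi>: "\<And>j. (\<lambda>(x, y). \<phi> j x y) \<in> borel_measurable (borel \<Otimes>\<^sub>M borel)"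
    and \<psi>: "\<And>j. \<psi> j \<in> borel_measurable borel"
    and le: "\<And>j x. (\<integral>\<^sup>+y. \<phi> j x y \<partial>distr M borel (g j)) \<le> \<psi> j x"
    and f: "f \<in> borel_measurable G"
  shows "(\<integral>\<^sup>+\<omega>. f \<omega> * (\<Prod>j<n. \<phi> j (p j \<omega>) (g j \<omega>)) \<partial>M) \<le> (\<integral>\<^sup>+\<omega>. f \<omega> * (\<Prod>j<n. \<psi> j (p j \<omega>)) \<partial>M)"
  using f
proof (induction n arbitrary: f)
  case (Suc n)
  define E where "E k = (case k of None \<Rightarrow> sets G | Some j \<Rightarrow> {g j -` A \<inter> space M | A. A \<in> sets borel})" for k
  \<comment> \<open>The two blocks to be separated: the past together with the first n coordinates,
    and the coordinate n alone.\<close>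
  define I where "I b = (if b then insert None (Some ` {..<n}) else {Some n})" for b
  define S where "S = sigma (space M) (\<Union>i\<in>I True. E i)"
  have spG: "space G = space M" and sG: "sets G \<subseteq> sets M" using G by (auto simp: subalgebra_def)
  have Epow: "(\<Union>i\<in>I True. E i) \<subseteq> Pow (space M)"
    using sets.space_closed[of G] spG by (auto simp: E_def I_def split: option.splits)
  have indE: "indep_sets E (\<Union>b\<in>UNIV. I b)"
    using ind unfolding E_def[abs_def] by (rule indep_sets_mono_index[rotated]) simp
  have IE: "Int_stable (E i)" for i
  proof (cases i)
    case None then show ?thesis by (auto simp: E_def Int_stable_def)
  next
    case (Some j)
    show ?thesis unfolding Int_stable_def
    proof (intro ballI)
      fix a b assume "a \<in> E i" "b \<in> E i"
      then obtain A B where AB: "A \<in> sets borel" "B \<in> sets borel" "a = g j -` A \<inter> space M" "b = g j -` B \<inter> space M"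
        unfolding E_def Some by auto
      then have "a \<inter> b = g j -` (A \<inter> B) \<inter> space M" "A \<inter> B \<in> sets borel" by auto
      then show "a \<inter> b \<in> E i" unfolding E_def Some option.case by blast
    qed
  qed
  have dis: "disjoint_family_on I UNIV" by (auto simp: disjoint_family_on_def I_def)
  have iset: "indep_sets (\<lambda>b. sigma_sets (space M) (\<Union>i\<in>I b. E i)) UNIV"
    using indep_sets_collect_sigma[OF indE IE dis] .
  have setsS: "sets S = sigma_sets (space M) (\<Union>i\<in>I True. E i)" "space S = space M"
    using Epow by (simp_all add: S_def)
  \<comment> \<open>The identity, as a random variable with values in the sigma-algebra
    \<open>S\<close> of the first block, stands for everything already known.\<close>
  have idM: "(\<lambda>\<omega>. \<omega>) \<in> measurable M S"
  proof (rule measurableI)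
    fix A assume "A \<in> sets S"
    moreover have "sigma_sets (space M) (\<Union>i\<in>I True. E i) \<subseteq> events"
      using iset unfolding indep_sets_def by (metis UNIV_I)
    ultimately show "(\<lambda>\<omega>. \<omega>) -` A \<inter> space M \<in> sets M"
      using setsS(1) sets.Int_space_eq2 by auto
  qed (simp add: setsS)
  have iv: "prob (((\<lambda>\<omega>. \<omega>) -` A \<inter> space M) \<inter> (g n -` B \<inter> space M)) = prob ((\<lambda>\<omega>. \<omega>) -` A \<inter> space M) * prob (g n -` B \<inter> space M)"
    if A: "A \<in> sets S" and B: "B \<in> sets borel" for A B
  proof -
    have A': "(\<lambda>\<omega>. \<omega>) -` A \<inter> space M \<in> sigma_sets (space M) (\<Union>i\<in>I True. E i)"
      using A sets.sets_into_space[OF A] setsS by (simp add: Int_absorb2)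
    have B': "g n -` B \<inter> space M \<in> sigma_sets (space M) (\<Union>i\<in>I False. E i)"
      using B by (intro sigma_sets.Basic) (auto simp: I_def E_def)
    show ?thesis
      using indep_setsD[OF iset, of UNIV "case_bool ((\<lambda>\<omega>. \<omega>) -` A \<inter> space M) (g n -` B \<inter> space M)"] A' B'
      by (simp add: UNIV_bool Int_ac mult.commute)
  qed
  have GS: "h \<in> borel_measurable S" if "h \<in> borel_measurable G" for h :: "'a \<Rightarrow> 'b::topological_space"
  proof (rule measurable_mono[THEN subsetD, OF order_refl refl _ _ that])
    show "sets G \<subseteq> sets S" unfolding setsS by (auto simp: I_def E_def intro!: sigma_sets.Basic)
    show "space G = space S" using spG setsS by simp
  qed
  have gS: "g j \<in> borel_measurable S" if "j < n" for j
  proof (rule measurableI)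
    fix A :: "real set" assume "A \<in> sets borel"
    then have "g j -` A \<inter> space M \<in> E (Some j)" by (auto simp: E_def)
    then show "g j -` A \<inter> space S \<in> sets S"
      using that unfolding setsS by (auto simp: I_def intro!: sigma_sets.Basic)
  qed simp
  have \<phi>c: "(\<lambda>\<omega>. \<phi> j (a \<omega>) (c \<omega>)) \<in> borel_measurable N" if "a \<in> borel_measurable N" "c \<in> borel_measurable N" for a c j and N :: "'z measure"
    using measurable_compose[OF measurable_Pair[OF that] \<phi>[of j]] by simp
  define H where "H \<omega> = f \<omega> * (\<Prod>j<n. \<phi> j (p j \<omega>) (g j \<omega>))" for \<omega>
  have HS: "H \<in> borel_measurable S"
    unfolding H_def by (intro borel_measurable_times_ennreal borel_measurable_prod_ennreal GS Suc.prems \<phi>c p gS) auto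
  have "(\<integral>\<^sup>+\<omega>. f \<omega> * (\<Prod>j<Suc n. \<phi> j (p j \<omega>) (g j \<omega>)) \<partial>M) = (\<integral>\<^sup>+\<omega>. H \<omega> * \<phi> n (p n \<omega>) (g n \<omega>) \<partial>M)"
    by (simp add: H_def mult.assoc)
  also have "\<dots> = (\<integral>\<^sup>+\<omega>. (\<integral>\<^sup>+y. H \<omega> * \<phi> n (p n \<omega>) y \<partial>distr M borel (g n)) \<partial>M)"
  proof (rule nn_integral_indep_pair[OF idM g iv, where \<Phi>="\<lambda>\<omega> y. H \<omega> * \<phi> n (p n \<omega>) y"])
    have "(\<lambda>z. H (fst z) * \<phi> n (p n (fst z)) (snd z)) \<in> borel_measurable (S \<Otimes>\<^sub>M borel)"
      by (intro borel_measurable_times_ennreal \<phi>c measurable_compose[OF measurable_fst HS] measurable_compose[OF measurable_fst GS[OF p]] measurable_snd)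
    then show "(\<lambda>(\<omega>, y). H \<omega> * \<phi> n (p n \<omega>) y) \<in> borel_measurable (S \<Otimes>\<^sub>M borel)" by (simp add: split_def)
  qed
  also have "\<dots> \<le> (\<integral>\<^sup>+\<omega>. H \<omega> * \<psi> n (p n \<omega>) \<partial>M)"
  proof (rule nn_integral_mono)
    fix \<omega>
    have "(\<integral>\<^sup>+y. H \<omega> * \<phi> n (p n \<omega>) y \<partial>distr M borel (g n)) = H \<omega> * (\<integral>\<^sup>+y. \<phi> n (p n \<omega>) y \<partial>distr M borel (g n))"
    proof (rule nn_integral_cmult)
      show "\<phi> n (p n \<omega>) \<in> borel_measurable (distr M borel (g n))"
        unfolding measurable_distr_eq1 by (rule \<phi>c) measurable
    qed
    also have "\<dots> \<le> H \<omega> * \<psi> n (p n \<omega>)" by (intro mult_left_mono le) simp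
    finally show "(\<integral>\<^sup>+y. H \<omega> * \<phi> n (p n \<omega>) y \<partial>distr M borel (g n)) \<le> H \<omega> * \<psi> n (p n \<omega>)" .
  qed
  also have "\<dots> = (\<integral>\<^sup>+\<omega>. (f \<omega> * \<psi> n (p n \<omega>)) * (\<Prod>j<n. \<phi> j (p j \<omega>) (g j \<omega>)) \<partial>M)"
    by (simp add: H_def mult_ac)
  also have "\<dots> \<le> (\<integral>\<^sup>+\<omega>. (f \<omega> * \<psi> n (p n \<omega>)) * (\<Prod>j<n. \<psi> j (p j \<omega>)) \<partial>M)"
    by (intro Suc.IH borel_measurable_times_ennreal Suc.prems measurable_compose[OF p \<psi>])
  also have "\<dots> = (\<integral>\<^sup>+\<omega>. f \<omega> * (\<Prod>j<Suc n. \<psi> j (p j \<omega>)) \<partial>M)" by (simp add: mult_ac)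
  finally show ?case .
qed simp

text \<open>Coordinate j is the Gaussian integral with A = \<mu> w_j q_j and B = 2 \<mu> w_j x
  sqrt(q_j). All denominators 1 - 2 A h are at least 1 - 2 \<mu> K0 h, as each w_j q_j is at most
  their sum K0, so the bounds multiply to one exponential. The infinite sum is reached by Fatou's
  lemma.\<close>

lemma gaussian_noise_exp_moment:
  fixes g :: "nat \<Rightarrow> 'a \<Rightarrow> real" and f :: "'a \<Rightarrow> real"
  assumes G: "subalgebra M G"
    and ind: "indep_sets (\<lambda>k. case k of None \<Rightarrow> sets G | Some j \<Rightarrow> {g j -` A \<inter> space M | A. A \<in> sets borel}) UNIV"
    and dist: "\<And>j. distributed M lborel (g j) (\<lambda>x. ennreal (normal_density 0 (sqrt h) x))"
    and h: "0 < h" and mu: "0 < \<mu>" and w: "\<And>j. 0 \<le> w j" and q: "\<And>j. 0 \<le> q j"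
    and K: "summable (\<lambda>j. w j * q j)" and small: "2 * \<mu> * (\<Sum>j. w j * q j) * h \<le> 1/2"
    and p: "\<And>j. p j \<in> borel_measurable G"
    and p1: "\<And>\<omega>. \<omega> \<in> space M \<Longrightarrow> summable (\<lambda>j. w j * (p j \<omega>)\<^sup>2)"
    and p2: "\<And>\<omega>. \<omega> \<in> space M \<Longrightarrow> summable (\<lambda>j. q j * (w j)\<^sup>2 * (p j \<omega>)\<^sup>2)"
    and f: "f \<in> borel_measurable G" "\<And>\<omega>. 0 \<le> f \<omega>"
  shows "AE \<omega> in M. summable (\<lambda>j. w j * (sqrt (q j) * g j \<omega>)\<^sup>2)"
    and "(\<integral>\<^sup>+\<omega>. ennreal (f \<omega> * exp (\<mu> * (\<Sum>j. 2 * w j * p j \<omega> * (sqrt (q j) * g j \<omega>) + w j * (sqrt (q j) * g j \<omega>)\<^sup>2))) \<partial>M)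
      \<le> (\<integral>\<^sup>+\<omega>. ennreal (f \<omega> * exp (2 * \<mu> * h * (\<Sum>j. w j * q j)
            + 2 * \<mu>\<^sup>2 * h / (1 - 2 * \<mu> * (\<Sum>j. w j * q j) * h) * (\<Sum>j. q j * (w j)\<^sup>2 * (p j \<omega>)\<^sup>2))) \<partial>M)"
proof -
  define K0 where "K0 = (\<Sum>j. w j * q j)"
  define \<rho> where "\<rho> = 2 * \<mu> * K0 * h"
  define c where "c = 2 * \<mu>\<^sup>2 * h / (1 - \<rho>)"
  have wq: "0 \<le> w j * q j" for j using w q by simp
  have K0: "w j * q j \<le> K0" for j
    unfolding K0_def using sum_le_suminf[OF K, of "{j}"] wq by simp
  have \<rho>: "\<rho> \<le> 1/2" using small by (simp add: \<rho>_def K0_def)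
  have c0: "0 \<le> c" unfolding c_def using h \<rho> by simp
  have gm: "g j \<in> borel_measurable M" for j using dist[of j] by (simp add: distributed_def)
  have gd: "distr M borel (g j) = density lborel (\<lambda>x. ennreal (normal_density 0 (sqrt h) x))" for j
  proof -
    have "distr M borel (g j) = distr M lborel (g j)" by (rule distr_cong) simp_all
    then show ?thesis using dist[of j] by (simp add: distributed_def)
  qed
  define r where "r x j \<omega> = 2 * w j * x * (sqrt (q j) * g j \<omega>) + w j * (sqrt (q j) * g j \<omega>)\<^sup>2" for x j \<omega>
  define \<phi> where "\<phi> j x y = ennreal (exp (\<mu> * (2 * w j * x * (sqrt (q j) * y) + w j * (sqrt (q j) * y)\<^sup>2)))" for j x y
  define \<psi> where "\<psi> j x = ennreal (exp (2 * \<mu> * h * (w j * q j) + c * (q j * (w j)\<^sup>2 * x\<^sup>2)))" for j x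
  have \<phi>m: "(\<lambda>(x, y). \<phi> j x y) \<in> borel_measurable (borel \<Otimes>\<^sub>M borel)" for j
    unfolding \<phi>_def by measurable
  have \<psi>m: "\<psi> j \<in> borel_measurable borel" for j
    unfolding \<psi>_def by measurable
  have le: "(\<integral>\<^sup>+y. \<phi> j x y \<partial>distr M borel (g j)) \<le> \<psi> j x" for j x
  proof -
    define A where "A = \<mu> * w j * q j"
    define B where "B = 2 * \<mu> * w j * x * sqrt (q j)"
    define x' where "x' = 2 * A * h"
    have x'\<rho>: "0 \<le> x'" "x' \<le> \<rho>"
    proof -
      have "0 \<le> (2 * \<mu> * h) * (w j * q j)" using mu h wq[of j] by (intro mult_nonneg_nonneg[of _ "w j * q j"]) auto
      then show "0 \<le> x'" by (simp add: x'_def A_def mult_ac)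
      show "x' \<le> \<rho>" using mult_left_mono[OF K0[of j], of "2 * \<mu> * h"] mu h
        by (simp add: x'_def A_def \<rho>_def algebra_simps)
    qed
    then have x'1: "x' < 1" using \<rho> by simp
    have ex: "\<phi> j x y = ennreal (exp (A * y\<^sup>2 + B * y))" for y
      using q[of j] by (simp add: \<phi>_def A_def B_def power_mult_distrib algebra_simps)
    have "(\<integral>\<^sup>+y. \<phi> j x y \<partial>distr M borel (g j)) = (\<integral>\<^sup>+y. ennreal (normal_density 0 (sqrt h) y) * ennreal (exp (A * y\<^sup>2 + B * y)) \<partial>lborel)"
      unfolding gd ex by (subst nn_integral_density) auto
    also have "\<dots> = ennreal (exp (B\<^sup>2 * h / (2 * (1 - x'))) / sqrt (1 - x'))"
      using gaussian_exp_integral[of "sqrt h" A B] h x'1 by (simp add: x'_def)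
    also have "\<dots> \<le> ennreal (exp (2 * \<mu> * h * (w j * q j) + c * (q j * (w j)\<^sup>2 * x\<^sup>2)))"
    proof (rule ennreal_leI)
      have "B\<^sup>2 * h / (2 * (1 - x')) = 2 * \<mu>\<^sup>2 * h * (q j * (w j)\<^sup>2 * x\<^sup>2) / (1 - x')"
      proof -
        have "B\<^sup>2 * h / 2 = 2 * \<mu>\<^sup>2 * h * (q j * (w j)\<^sup>2 * x\<^sup>2)"
          using q[of j] by (simp add: B_def power_mult_distrib)
        then show ?thesis by (simp only: divide_divide_eq_left[symmetric])
      qed
      also have "\<dots> \<le> 2 * \<mu>\<^sup>2 * h * (q j * (w j)\<^sup>2 * x\<^sup>2) / (1 - \<rho>)"
        using x'\<rho> \<rho> h q[of j] by (intro divide_left_mono mult_nonneg_nonneg mult_pos_pos) auto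
      finally have 1: "B\<^sup>2 * h / (2 * (1 - x')) \<le> c * (q j * (w j)\<^sup>2 * x\<^sup>2)" by (simp add: c_def)
      have "1 / sqrt (1 - x') \<le> exp x'" using x'\<rho> \<rho> by (intro inverse_sqrt_le_exp) auto
      then have "exp (B\<^sup>2 * h / (2 * (1 - x'))) * (1 / sqrt (1 - x')) \<le> exp (c * (q j * (w j)\<^sup>2 * x\<^sup>2)) * exp x'"
        using 1 x'1 by (intro mult_mono) auto
      then show "exp (B\<^sup>2 * h / (2 * (1 - x'))) / sqrt (1 - x') \<le> exp (2 * \<mu> * h * (w j * q j) + c * (q j * (w j)\<^sup>2 * x\<^sup>2))"
        by (simp add: exp_add[symmetric] x'_def A_def algebra_simps)
    qed
    finally show ?thesis by (simp add: \<psi>_def)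
  qed
  \<comment> \<open>Kept general in the coefficients and the factor: with zero coefficients and
    factor 1 it yields summability of the squared noise, with the given ones the moment
    bound.\<close>
  have fin: "(\<integral>\<^sup>+\<omega>. ennreal (f' \<omega> * exp (\<mu> * (\<Sum>j<n. r (p' j \<omega>) j \<omega>))) \<partial>M)
      \<le> (\<integral>\<^sup>+\<omega>. ennreal (f' \<omega> * exp (2 * \<mu> * h * K0 + c * (\<Sum>j. q j * (w j)\<^sup>2 * (p' j \<omega>)\<^sup>2))) \<partial>M)"
    if p'm: "\<And>j. p' j \<in> borel_measurable G" and p's: "\<And>\<omega>. \<omega> \<in> space M \<Longrightarrow> summable (\<lambda>j. q j * (w j)\<^sup>2 * (p' j \<omega>)\<^sup>2)"
      and f': "f' \<in> borel_measurable G" "\<And>\<omega>. 0 \<le> f' \<omega>" for f' p' n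
  proof -
    have "(\<integral>\<^sup>+\<omega>. ennreal (f' \<omega> * exp (\<mu> * (\<Sum>j<n. r (p' j \<omega>) j \<omega>))) \<partial>M)
        = (\<integral>\<^sup>+\<omega>. ennreal (f' \<omega>) * (\<Prod>j<n. \<phi> j (p' j \<omega>) (g j \<omega>)) \<partial>M)"
      by (simp add: \<phi>_def r_def prod_ennreal exp_sum sum_distrib_left f'(2) ennreal_mult prod_nonneg)
    also have "\<dots> \<le> (\<integral>\<^sup>+\<omega>. ennreal (f' \<omega>) * (\<Prod>j<n. \<psi> j (p' j \<omega>)) \<partial>M)"
      by (rule nn_integral_prod_indep_le[OF G ind gm p'm \<phi>m \<psi>m le]) (use f'(1) in measurable)
    also have "\<dots> \<le> (\<integral>\<^sup>+\<omega>. ennreal (f' \<omega> * exp (2 * \<mu> * h * K0 + c * (\<Sum>j. q j * (w j)\<^sup>2 * (p' j \<omega>)\<^sup>2))) \<partial>M)"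
    proof (rule nn_integral_mono)
      fix \<omega> assume \<omega>: "\<omega> \<in> space M"
      have "(\<Sum>j<n. 2 * \<mu> * h * (w j * q j) + c * (q j * (w j)\<^sup>2 * (p' j \<omega>)\<^sup>2))
          = 2 * \<mu> * h * (\<Sum>j<n. w j * q j) + c * (\<Sum>j<n. q j * (w j)\<^sup>2 * (p' j \<omega>)\<^sup>2)"
        by (simp only: sum.distrib sum_distrib_left)
      also have "\<dots> \<le> 2 * \<mu> * h * K0 + c * (\<Sum>j. q j * (w j)\<^sup>2 * (p' j \<omega>)\<^sup>2)"
        unfolding K0_def using mu h c0 wq q
        by (intro add_mono mult_left_mono sum_le_suminf K p's \<omega>) auto
      finally have "f' \<omega> * exp (\<Sum>j<n. 2 * \<mu> * h * (w j * q j) + c * (q j * (w j)\<^sup>2 * (p' j \<omega>)\<^sup>2))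
          \<le> f' \<omega> * exp (2 * \<mu> * h * K0 + c * (\<Sum>j. q j * (w j)\<^sup>2 * (p' j \<omega>)\<^sup>2))"
        using f'(2) by (intro mult_left_mono) auto
      then show "ennreal (f' \<omega>) * (\<Prod>j<n. \<psi> j (p' j \<omega>)) \<le> ennreal (f' \<omega> * exp (2 * \<mu> * h * K0 + c * (\<Sum>j. q j * (w j)\<^sup>2 * (p' j \<omega>)\<^sup>2)))"
        by (simp add: \<psi>_def prod_ennreal exp_sum[symmetric] f'(2) flip: ennreal_mult)
    qed
    finally show ?thesis .
  qed
  have GM: "k \<in> borel_measurable M" if "k \<in> borel_measurable G" for k :: "'a \<Rightarrow> real"
    using measurable_from_subalg[OF G that] .
  define d where "d j \<omega> = w j * (sqrt (q j) * g j \<omega>)\<^sup>2" for j \<omega>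
  have dm: "d j \<in> borel_measurable M" for j unfolding d_def using gm by measurable
  have d0: "0 \<le> d j \<omega>" for j \<omega> using w by (simp add: d_def)
  \<comment> \<open>The partial exponential moments of the squares are bounded, so by monotone
    convergence their supremum has finite expectation and is finite almost surely.\<close>
  have AEsum: "AE \<omega> in M. summable (\<lambda>j. d j \<omega>)"
  proof -
    let ?Z = "\<lambda>n \<omega>. ennreal (exp (\<mu> * (\<Sum>j<n. d j \<omega>)))"
    have Zm: "?Z n \<in> borel_measurable M" for n using dm by measurable
    have "incseq ?Z"
      unfolding incseq_def le_fun_def
      using mu d0 by (auto intro!: ennreal_leI mult_left_mono sum_mono2)
    from nn_integral_monotone_convergence_SUP[OF this Zm]
    have "(\<integral>\<^sup>+\<omega>. (SUP n. ?Z n \<omega>) \<partial>M) = (SUP n. \<integral>\<^sup>+\<omega>. ?Z n \<omega> \<partial>M)" .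
    also have "\<dots> \<le> ennreal (exp (2 * \<mu> * h * K0))"
    proof (rule SUP_least)
      fix n
      show "(\<integral>\<^sup>+\<omega>. ?Z n \<omega> \<partial>M) \<le> ennreal (exp (2 * \<mu> * h * K0))"
        using fin[of "\<lambda>_ _. 0" "\<lambda>_. 1" n] by (simp add: r_def d_def emeasure_space_1)
    qed
    finally have "(\<integral>\<^sup>+\<omega>. (SUP n. ?Z n \<omega>) \<partial>M) \<noteq> \<infinity>"
      by (auto simp: top_unique)
    then have "AE \<omega> in M. (SUP n. ?Z n \<omega>) \<noteq> \<infinity>"
      by (intro nn_integral_PInf_AE borel_measurable_SUP Zm) auto
    then show ?thesis
    proof eventually_elim
      case (elim \<omega>)
      then obtain b where b: "(SUP n. ?Z n \<omega>) = ennreal b" "0 \<le> b" by (cases "SUP n. ?Z n \<omega>") auto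
      have "(\<Sum>j<n. d j \<omega>) \<le> b / \<mu>" for n
      proof -
        have "?Z n \<omega> \<le> ennreal b" unfolding b(1)[symmetric] by (rule SUP_upper) simp
        then have "exp (\<mu> * (\<Sum>j<n. d j \<omega>)) \<le> b" using b(2) by simp
        then have "\<mu> * (\<Sum>j<n. d j \<omega>) \<le> b" using exp_ge_add_one_self[of "\<mu> * (\<Sum>j<n. d j \<omega>)"] by linarith
        then show ?thesis using mu by (simp add: pos_le_divide_eq mult.commute)
      qed
      then show ?case by (intro summableI_nonneg_bounded[OF d0])
    qed
  qed
  then show "AE \<omega> in M. summable (\<lambda>j. w j * (sqrt (q j) * g j \<omega>)\<^sup>2)" by (simp add: d_def)
  let ?RHS = "\<integral>\<^sup>+\<omega>. ennreal (f \<omega> * exp (2 * \<mu> * h * K0 + c * (\<Sum>j. q j * (w j)\<^sup>2 * (p j \<omega>)\<^sup>2))) \<partial>M"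
  have um: "(\<lambda>\<omega>. ennreal (f \<omega> * exp (\<mu> * (\<Sum>j<n. r (p j \<omega>) j \<omega>)))) \<in> borel_measurable M" for n
    using GM[OF f(1)] GM[OF p] gm unfolding r_def by measurable
  have "(\<integral>\<^sup>+\<omega>. ennreal (f \<omega> * exp (\<mu> * (\<Sum>j. r (p j \<omega>) j \<omega>))) \<partial>M)
      = (\<integral>\<^sup>+\<omega>. liminf (\<lambda>n. ennreal (f \<omega> * exp (\<mu> * (\<Sum>j<n. r (p j \<omega>) j \<omega>)))) \<partial>M)"
  proof (rule nn_integral_cong_AE)
    show "AE \<omega> in M. ennreal (f \<omega> * exp (\<mu> * (\<Sum>j. r (p j \<omega>) j \<omega>))) = liminf (\<lambda>n. ennreal (f \<omega> * exp (\<mu> * (\<Sum>j<n. r (p j \<omega>) j \<omega>))))"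
      using AEsum AE_space
    proof eventually_elim
      case (elim \<omega>)
      have "summable (\<lambda>j. r (p j \<omega>) j \<omega>)"
      proof (rule summable_comparison_test)
        show "summable (\<lambda>j. w j * (p j \<omega>)\<^sup>2 + d j \<omega> + d j \<omega>)"
          by (intro summable_add p1 elim)
        have "\<bar>r (p j \<omega>) j \<omega>\<bar> \<le> w j * (p j \<omega>)\<^sup>2 + d j \<omega> + d j \<omega>" for j
        proof -
          let ?d = "sqrt (q j) * g j \<omega>"
          have "\<bar>2 * p j \<omega> * ?d\<bar> \<le> (p j \<omega>)\<^sup>2 + ?d\<^sup>2"
            using sum_squares_bound[of "p j \<omega>" ?d] sum_squares_bound[of "p j \<omega>" "- ?d"] by (simp add: abs_le_iff)
          from mult_left_mono[OF this w[of j]]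
          have "\<bar>w j * (2 * p j \<omega> * ?d)\<bar> \<le> w j * (p j \<omega>)\<^sup>2 + d j \<omega>"
            using w[of j] by (simp only: abs_mult[of "w j"] abs_of_nonneg d_def distrib_left)
          then show ?thesis
            using d0[of j \<omega>] abs_triangle_ineq[of "w j * (2 * p j \<omega> * ?d)" "d j \<omega>"]
            by (simp add: r_def d_def mult_ac)
        qed
        then show "\<exists>N. \<forall>j\<ge>N. norm (r (p j \<omega>) j \<omega>) \<le> w j * (p j \<omega>)\<^sup>2 + d j \<omega> + d j \<omega>" by auto
      qed
      then have "(\<lambda>n. \<Sum>j<n. r (p j \<omega>) j \<omega>) \<longlonglongrightarrow> (\<Sum>j. r (p j \<omega>) j \<omega>)" by (rule summable_LIMSEQ)
      then have "(\<lambda>n. ennreal (f \<omega> * exp (\<mu> * (\<Sum>j<n. r (p j \<omega>) j \<omega>)))) \<longlonglongrightarrow> ennreal (f \<omega> * exp (\<mu> * (\<Sum>j. r (p j \<omega>) j \<omega>)))"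
        by (intro tendsto_ennrealI tendsto_intros)
      from lim_imp_Liminf[OF _ this] show ?case by simp
    qed
  qed
  \<comment> \<open>Fatou in place of monotone convergence, because the cross terms have no
    sign.\<close>
  also have "\<dots> \<le> liminf (\<lambda>n. \<integral>\<^sup>+\<omega>. ennreal (f \<omega> * exp (\<mu> * (\<Sum>j<n. r (p j \<omega>) j \<omega>))) \<partial>M)"
    by (rule nn_integral_liminf[OF um])
  also have "\<dots> \<le> liminf (\<lambda>n::nat. ?RHS)"
    by (rule Liminf_mono) (intro always_eventually allI fin p p2 f)
  also have "\<dots> = ?RHS" by (simp add: Liminf_const)
  finally show "(\<integral>\<^sup>+\<omega>. ennreal (f \<omega> * exp (\<mu> * (\<Sum>j. 2 * w j * p j \<omega> * (sqrt (q j) * g j \<omega>) + w j * (sqrt (q j) * g j \<omega>)\<^sup>2))) \<partial>M)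
      \<le> (\<integral>\<^sup>+\<omega>. ennreal (f \<omega> * exp (2 * \<mu> * h * (\<Sum>j. w j * q j)
            + 2 * \<mu>\<^sup>2 * h / (1 - 2 * \<mu> * (\<Sum>j. w j * q j) * h) * (\<Sum>j. q j * (w j)\<^sup>2 * (p j \<omega>)\<^sup>2))) \<partial>M)"
    by (simp add: r_def c_def \<rho>_def K0_def)
qed

end

section \<open>The maximal inequality and the energy inequality\<close>

context prob_space
begin

text \<open>Doob's maximal inequality without conditional expectations: the supermartingale property
  is the inequality in \<open>step\<close> for all nonnegative \<open>f\<close> measurable at time
  l, and it is applied to the event that level k has not been reached so far.\<close>

lemma maximal_inequality_exp:
  fixes V :: "nat \<Rightarrow> 'a \<Rightarrow> real"
  assumes sub: "\<And>l. subalgebra M (G l)" and mono: "\<And>l. l < N \<Longrightarrow> sets (G l) \<subseteq> sets (G (Suc l))"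
    and V: "\<And>l. l \<le> N \<Longrightarrow> V l \<in> borel_measurable (G l)"
    and V0: "\<And>\<omega>. \<omega> \<in> space M \<Longrightarrow> V 0 \<omega> = 0"
    and step: "\<And>l f. l < N \<Longrightarrow> f \<in> borel_measurable (G l) \<Longrightarrow> (\<And>\<omega>. 0 \<le> f \<omega>) \<Longrightarrow>
      (\<integral>\<^sup>+\<omega>. ennreal (f \<omega> * exp (V (Suc l) \<omega>)) \<partial>M) \<le> (\<integral>\<^sup>+\<omega>. ennreal (f \<omega> * exp (V l \<omega>)) \<partial>M)"
  shows "(\<integral>\<^sup>+\<omega>. indicator {\<omega>. \<exists>l\<le>N. k \<le> V l \<omega>} \<omega> \<partial>M) \<le> ennreal (exp (- k))"
proof -
  define B where "B n = {\<omega> \<in> space M. \<forall>l\<le>n. V l \<omega> < k}" for n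
  \<comment> \<open>The process stopped on reaching level k and then set to exp k. On first passage
    exp V is at least exp k, so the expectation of Z does not increase; initially it is at most 1
    for either sign of k.\<close>
  define Z where "Z n \<omega> = ennreal (exp k * indicator (space M - B n) \<omega>) + ennreal (indicator (B n) \<omega> * exp (V n \<omega>))" for n \<omega>
  have spG: "space (G l) = space M" for l using sub[of l] by (simp add: subalgebra_def)
  have chain: "sets (G l) \<subseteq> sets (G n)" if "l \<le> n" "n \<le> N" for l n
    using that
  proof (induction n rule: dec_induct)
    case (step n)
    then show ?case using mono[of n] by auto
  qed simp
  have VG: "V l \<in> borel_measurable (G n)" if "l \<le> n" "n \<le> N" for l n
    using measurable_mono[OF order_refl refl chain[OF that]] V[of l] that spG by auto
  have BG: "B n \<in> sets (G n)" if "n \<le> N" for n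
  proof -
    have "B n = (\<Inter>l\<in>{..n}. {\<omega> \<in> space (G n). V l \<omega> < k})" by (auto simp: B_def spG)
    also have "\<dots> \<in> sets (G n)"
    proof (rule sets.finite_INT)
      fix l assume "l \<in> {..n}"
      then have [measurable]: "V l \<in> borel_measurable (G n)" using VG that by simp
      show "{\<omega> \<in> space (G n). V l \<omega> < k} \<in> sets (G n)" by measurable
    qed auto
    finally show ?thesis .
  qed
  have BM: "B n \<in> events" if "n \<le> N" for n using BG[OF that] sub[of n] by (auto simp: subalgebra_def)
  have VM: "V l \<in> borel_measurable M" if "l \<le> N" for l
    using measurable_from_subalg[OF sub V[OF that]] .
  have ind: "(\<integral>\<^sup>+\<omega>. Z n \<omega> \<partial>M) \<le> 1" if "n \<le> N" for n
    using that
  proof (induction n)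
    case 0
    have "(\<integral>\<^sup>+\<omega>. Z 0 \<omega> \<partial>M) \<le> (\<integral>\<^sup>+\<omega>. 1 \<partial>M)"
      by (rule nn_integral_mono) (auto simp: Z_def B_def V0 indicator_def)
    then show ?case by (simp add: emeasure_space_1)
  next
    case (Suc n)
    then have n: "n < N" by simp
    note [measurable] = BM[OF less_imp_le[OF n]] VM[OF less_imp_le[OF n]] VM[OF Suc.prems]
    have "(\<integral>\<^sup>+\<omega>. Z (Suc n) \<omega> \<partial>M) \<le> (\<integral>\<^sup>+\<omega>. ennreal (exp k * indicator (space M - B n) \<omega>) + ennreal (indicator (B n) \<omega> * exp (V (Suc n) \<omega>)) \<partial>M)"
    proof (rule nn_integral_mono)
      fix \<omega> assume w: "\<omega> \<in> space M"
      have Bs: "\<omega> \<in> B (Suc n) \<longleftrightarrow> \<omega> \<in> B n \<and> V (Suc n) \<omega> < k"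
        using w by (auto simp: B_def le_Suc_eq)
      show "Z (Suc n) \<omega> \<le> ennreal (exp k * indicator (space M - B n) \<omega>) + ennreal (indicator (B n) \<omega> * exp (V (Suc n) \<omega>))"
        using w Bs by (auto simp: Z_def indicator_def intro!: ennreal_leI)
    qed
    also have "\<dots> = (\<integral>\<^sup>+\<omega>. ennreal (exp k * indicator (space M - B n) \<omega>) \<partial>M) + (\<integral>\<^sup>+\<omega>. ennreal (indicator (B n) \<omega> * exp (V (Suc n) \<omega>)) \<partial>M)"
      by (rule nn_integral_add) measurable
    also have "\<dots> \<le> (\<integral>\<^sup>+\<omega>. ennreal (exp k * indicator (space M - B n) \<omega>) \<partial>M) + (\<integral>\<^sup>+\<omega>. ennreal (indicator (B n) \<omega> * exp (V n \<omega>)) \<partial>M)"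
      by (intro add_left_mono step n borel_measurable_indicator BG) (use n in auto)
    also have "\<dots> = (\<integral>\<^sup>+\<omega>. Z n \<omega> \<partial>M)"
      unfolding Z_def by (rule nn_integral_add[symmetric]) measurable
    finally show ?case using Suc by simp
  qed
  have "(\<integral>\<^sup>+\<omega>. indicator {\<omega>. \<exists>l\<le>N. k \<le> V l \<omega>} \<omega> \<partial>M) \<le> (\<integral>\<^sup>+\<omega>. ennreal (exp (- k)) * Z N \<omega> \<partial>M)"
  proof (rule nn_integral_mono)
    fix \<omega> assume w: "\<omega> \<in> space M"
    show "indicator {\<omega>. \<exists>l\<le>N. k \<le> V l \<omega>} \<omega> \<le> ennreal (exp (- k)) * Z N \<omega>"
    proof (cases "\<exists>l\<le>N. k \<le> V l \<omega>")
      case True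
      then have "\<omega> \<notin> B N" by (auto simp: B_def not_less)
      then have "ennreal (exp (- k)) * Z N \<omega> = ennreal (exp (- k) * exp k)"
        using w by (simp add: Z_def ennreal_mult)
      then show ?thesis using True by (simp add: exp_add[symmetric])
    qed simp
  qed
  also have "\<dots> = ennreal (exp (- k)) * (\<integral>\<^sup>+\<omega>. Z N \<omega> \<partial>M)"
  proof (rule nn_integral_cmult)
    note [measurable] = BM[OF order_refl] VM[OF order_refl]
    show "Z N \<in> borel_measurable M" unfolding Z_def by measurable
  qed
  also have "\<dots> \<le> ennreal (exp (- k)) * 1" by (intro mult_left_mono ind) auto
  finally show ?thesis by simp
qed

text \<open>The maximum is nonnegative because V starts at 0. Rounding it down to an integer k
  bounds exp(r max) by exp(r (k+1)) on an event of probability at most exp(-k), and these terms form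
  a geometric series of ratio exp(r - 1).\<close>

lemma exp_moment_max:
  fixes V :: "nat \<Rightarrow> 'a \<Rightarrow> real"
  assumes r: "0 < r" "r < 1"
    and V: "\<And>l. l \<le> N \<Longrightarrow> V l \<in> borel_measurable M"
    and V0: "\<And>\<omega>. \<omega> \<in> space M \<Longrightarrow> V 0 \<omega> = 0"
    and max: "\<And>k. (\<integral>\<^sup>+\<omega>. indicator {\<omega>. \<exists>l\<le>N. k \<le> V l \<omega>} \<omega> \<partial>M) \<le> ennreal (exp (- k))"
  shows "(\<integral>\<^sup>+\<omega>. ennreal (exp (r * Max ((\<lambda>l. V l \<omega>) ` {0..N}))) \<partial>M) \<le> ennreal (exp r / (1 - exp (r - 1)))"
proof -
  let ?e = "\<lambda>k::nat. ennreal (exp (r * (real k + 1)))"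
  let ?A = "\<lambda>k::nat. {\<omega>. \<exists>l\<le>N. real k \<le> V l \<omega>}"
  have Am: "(\<lambda>\<omega>. indicator (?A k) \<omega> :: ennreal) \<in> borel_measurable M" for k
  proof -
    have "{\<omega> \<in> space M. \<exists>l\<le>N. real k \<le> V l \<omega>} = (\<Union>l\<in>{..N}. {\<omega> \<in> space M. real k \<le> V l \<omega>})" by auto
    also have "\<dots> \<in> events"
    proof (rule sets.finite_UN)
      fix l assume "l \<in> {..N}"
      then have [measurable]: "V l \<in> borel_measurable M" using V by simp
      show "{\<omega> \<in> space M. real k \<le> V l \<omega>} \<in> events" by measurable
    qed simp
    finally have ev: "{\<omega> \<in> space M. \<exists>l\<le>N. real k \<le> V l \<omega>} \<in> events" .
    have eq: "indicator {\<omega> \<in> space M. \<exists>l\<le>N. real k \<le> V l \<omega>} \<omega> = (indicator (?A k) \<omega> :: ennreal)" if "\<omega> \<in> space M" for \<omega>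
      using that by (simp add: indicator_def)
    show ?thesis by (rule measurable_cong[OF eq, THEN iffD1, OF _ borel_measurable_indicator[OF ev]])
  qed
  have "(\<integral>\<^sup>+\<omega>. ennreal (exp (r * Max ((\<lambda>l. V l \<omega>) ` {0..N}))) \<partial>M) \<le> (\<integral>\<^sup>+\<omega>. (\<Sum>k. ?e k * indicator (?A k) \<omega>) \<partial>M)"
  proof (rule nn_integral_mono)
    fix \<omega> assume w: "\<omega> \<in> space M"
    define m where "m = Max ((\<lambda>l. V l \<omega>) ` {0..N})"
    have "m \<in> (\<lambda>l. V l \<omega>) ` {0..N}" unfolding m_def by (intro Max_in) auto
    then obtain l where l: "l \<le> N" "m = V l \<omega>" by auto
    have m0: "0 \<le> m" unfolding m_def using V0[OF w] by (intro Max_ge) (auto intro!: image_eqI[of _ _ 0])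
    define k where "k = nat \<lfloor>m\<rfloor>"
    have k: "real k \<le> m" "m \<le> real k + 1" using m0 by (auto simp: k_def)
    define e where "e k = ?e k * indicator (?A k) \<omega>" for k
    have "ennreal (exp (r * m)) \<le> e k"
      using k l r by (auto simp: e_def indicator_def intro!: ennreal_leI)
    also have "\<dots> \<le> suminf e" using sum_le_suminf[of e "{k}"] by simp
    finally show "ennreal (exp (r * Max ((\<lambda>l. V l \<omega>) ` {0..N}))) \<le> (\<Sum>k. ?e k * indicator (?A k) \<omega>)"
      by (simp only: m_def e_def[abs_def])
  qed
  also have "\<dots> = (\<Sum>k. \<integral>\<^sup>+\<omega>. ?e k * indicator (?A k) \<omega> \<partial>M)"
    by (rule nn_integral_suminf) (intro borel_measurable_times_ennreal borel_measurable_const Am)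
  also have "\<dots> = (\<Sum>k. ?e k * (\<integral>\<^sup>+\<omega>. indicator (?A k) \<omega> \<partial>M))"
    by (intro arg_cong[where f=suminf] ext nn_integral_cmult Am)
  also have "\<dots> \<le> (\<Sum>k. ennreal (exp r * exp (r - 1) ^ k))"
  proof (intro suminf_le summableI)
    fix k
    have "?e k * (\<integral>\<^sup>+\<omega>. indicator (?A k) \<omega> \<partial>M) \<le> ?e k * ennreal (exp (- real k))"
      by (intro mult_left_mono max) simp
    also have "\<dots> = ennreal (exp r * exp (r - 1) ^ k)"
      by (simp add: exp_of_nat_mult[symmetric] exp_add[symmetric] algebra_simps flip: ennreal_mult)
    finally show "?e k * (\<integral>\<^sup>+\<omega>. indicator (?A k) \<omega> \<partial>M) \<le> ennreal (exp r * exp (r - 1) ^ k)" .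
  qed
  also have "\<dots> = ennreal (\<Sum>k. exp r * exp (r - 1) ^ k)"
    using r by (intro suminf_ennreal2 summable_mult summable_geometric) auto
  also have "(\<Sum>k. exp r * exp (r - 1) ^ k) = exp r / (1 - exp (r - 1))"
    using r by (simp add: suminf_mult suminf_geometric summable_geometric)
  finally show ?thesis .
qed

end

locale stochastic_euler = stokes_basis L \<zeta> lam + prob_space M
  for L :: real and \<zeta> :: "nat \<Rightarrow> field" and lam :: "nat \<Rightarrow> real" and M :: "'a measure" +
  fixes \<nu> T :: real and F :: "real \<Rightarrow> 'a measure" and b :: "nat \<Rightarrow> real \<Rightarrow> 'a \<Rightarrow> real" and q :: "nat \<Rightarrow> real"
  assumes nu: "0 < \<nu>" and T: "0 < T"
    and filt: "filtration (space M) F" and sub: "\<And>t. subalgebra M (F t)"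
    and BM: "indep_BMs M F T b" and q: "\<And>j. 0 < q j" and K0_summable: "summable (\<lambda>j. lam j * q j)"
begin

section \<open>Energy norms and the covariance of the noise\<close>

definition K0 :: real where "K0 = (\<Sum>j. lam j * q j)"
definition Tr :: real where "Tr = (\<Sum>j. q j)"

abbreviation "Xsq \<equiv> a12sq L \<zeta> lam"
abbreviation "Ysq \<equiv> Asq L \<zeta> lam"

text \<open>This is |Q^{1/2} A v|^2; 4 h times it is the conditional variance of the part of the
  energy noise that is linear in the increment.\<close>

definition Ssq :: "field \<Rightarrow> real" where
  "Ssq v = (\<Sum>j. q j * (lam j)\<^sup>2 * (l2inner L v (\<zeta> j))\<^sup>2)"

lemma K0_pos: "0 < K0"
  unfolding K0_def by (rule suminf_pos[OF K0_summable]) (simp add: lam_pos q)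

lemma lam_q_le: "lam j * q j \<le> K0"
  unfolding K0_def using sum_le_suminf[OF K0_summable, of "{j}"] lam_pos q by (simp add: less_imp_le)

lemma summable_q: "summable q"
proof (rule summable_comparison_test)
  show "summable (\<lambda>j. lam j * q j * (1 / lam 0))" by (rule summable_mult2[OF K0_summable])
  show "\<exists>N. \<forall>j\<ge>N. norm (q j) \<le> lam j * q j * (1 / lam 0)"
  proof (intro exI[of _ 0] allI impI)
    fix j
    have "lam 0 * q j \<le> lam j * q j" by (intro mult_right_mono lam_mono less_imp_le[OF q]) simp
    then show "norm (q j) \<le> lam j * q j * (1 / lam 0)"
      using q[of j] lam_pos[of 0] by (simp add: pos_le_divide_eq mult.commute)
  qed
qed

lemma Tr_pos: "0 < Tr"
  unfolding Tr_def by (rule suminf_pos[OF summable_q q])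

lemma q_le_Tr: "q j \<le> Tr"
  unfolding Tr_def using sum_le_suminf[OF summable_q, of "{j}"] q by (simp add: less_imp_le)

lemma Xsq_nonneg: "Vsp L v \<Longrightarrow> 0 \<le> Xsq v"
  unfolding a12sq_def by (intro suminf_nonneg summable_V) (simp_all add: less_imp_le[OF lam_pos])

lemma Ysq_nonneg: "DomA L v \<Longrightarrow> 0 \<le> Ysq v"
  unfolding Asq_def by (intro suminf_nonneg summable_DomA) simp_all

text \<open>Each \<open>lam j * q j\<close> is at most K0. This bound makes sense for v in V and
  serves the first step, where u^0 need not be in the domain of A.\<close>

lemma Ssq_V:
  assumes "Vsp L v"
  shows "summable (\<lambda>j. q j * (lam j)\<^sup>2 * (l2inner L v (\<zeta> j))\<^sup>2)" "Ssq v \<le> K0 * Xsq v"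
proof -
  have le: "q j * (lam j)\<^sup>2 * (l2inner L v (\<zeta> j))\<^sup>2 \<le> K0 * (lam j * (l2inner L v (\<zeta> j))\<^sup>2)" for j
    using mult_right_mono[OF lam_q_le[of j], of "lam j * (l2inner L v (\<zeta> j))\<^sup>2"] lam_pos[of j]
    by (simp add: power2_eq_square mult_ac)
  have s: "summable (\<lambda>j. K0 * (lam j * (l2inner L v (\<zeta> j))\<^sup>2))" by (rule summable_mult[OF summable_V[OF assms]])
  show S: "summable (\<lambda>j. q j * (lam j)\<^sup>2 * (l2inner L v (\<zeta> j))\<^sup>2)"
    by (rule summable_comparison_test[OF _ s]) (use le less_imp_le[OF q] in \<open>auto simp: abs_mult\<close>)
  have "Ssq v \<le> (\<Sum>j. K0 * (lam j * (l2inner L v (\<zeta> j))\<^sup>2))"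
    unfolding Ssq_def by (rule suminf_le[OF le S s])
  also have "\<dots> = K0 * Xsq v" unfolding a12sq_def by (rule suminf_mult[OF summable_V[OF assms]])
  finally show "Ssq v \<le> K0 * Xsq v" .
qed

text \<open>Each q_j is at most the trace; this is how Tr(Q) enters the threshold.\<close>

lemma Ssq_DomA:
  assumes "DomA L v" shows "Ssq v \<le> Tr * Ysq v"
proof -
  have "Ssq v \<le> (\<Sum>j. Tr * ((lam j)\<^sup>2 * (l2inner L v (\<zeta> j))\<^sup>2))"
    unfolding Ssq_def
  proof (rule suminf_le[OF _ Ssq_V(1)[OF Vsp_of_DomA[OF assms]] summable_mult[OF summable_DomA[OF assms]]])
    fix j
    show "q j * (lam j)\<^sup>2 * (l2inner L v (\<zeta> j))\<^sup>2 \<le> Tr * ((lam j)\<^sup>2 * (l2inner L v (\<zeta> j))\<^sup>2)"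
      using mult_right_mono[OF q_le_Tr[of j], of "(lam j)\<^sup>2 * (l2inner L v (\<zeta> j))\<^sup>2"] by (simp add: mult_ac)
  qed
  also have "\<dots> = Tr * Ysq v" unfolding Asq_def by (rule suminf_mult[OF summable_DomA[OF assms]])
  finally show ?thesis .
qed

end

locale euler_run = stochastic_euler L \<zeta> lam M \<nu> T F b q
  for L \<zeta> lam and M :: "'a measure" and \<nu> T F b q +
  fixes N :: nat and u0 :: "'a \<Rightarrow> field" and u :: "nat \<Rightarrow> 'a \<Rightarrow> field"
  assumes N: "0 < N" and scheme: "euler_scheme L \<nu> T N M F b q \<zeta> lam u0 u"
    and u0V: "\<And>\<omega>. \<omega> \<in> space M \<Longrightarrow> Vsp L (u0 \<omega>)" and u0m: "Hmeas L (F 0) u0"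
begin

section \<open>The scheme in coordinates of the eigenbasis\<close>

definition h :: real where "h = T / real N"
definition G :: "nat \<Rightarrow> 'a measure" where "G l = F (tgrid T N l)"
definition incr :: "nat \<Rightarrow> nat \<Rightarrow> 'a \<Rightarrow> real" where
  "incr l j \<omega> = b j (tgrid T N (Suc l)) \<omega> - b j (tgrid T N l) \<omega>"
text \<open>The index is that of the starting point: \<open>noise l\<close> drives the step from
  \<open>u l\<close> to \<open>u (Suc l)\<close>, and only the state \<open>u l\<close> enters,
  which is independent of the increment.\<close>

definition noise :: "nat \<Rightarrow> 'a \<Rightarrow> real" where
  "noise l \<omega> = (\<Sum>j. 2 * lam j * l2inner L (u l \<omega>) (\<zeta> j) * (sqrt (q j) * incr l j \<omega>) + lam j * (sqrt (q j) * incr l j \<omega>)\<^sup>2)"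

lemma h_pos: "0 < h" and Nh: "real N * h = T"
  using T N by (simp_all add: h_def)

lemma u_0: "\<omega> \<in> space M \<Longrightarrow> u 0 \<omega> = u0 \<omega>"
  using scheme by (simp add: euler_scheme_def)

lemma u_V: "l \<le> N \<Longrightarrow> \<omega> \<in> space M \<Longrightarrow> Vsp L (u l \<omega>)"
  using scheme u0V by (cases l) (auto simp: euler_scheme_def)

lemma subG: "subalgebra M (G l)"
  using sub by (simp add: G_def)

lemma G_mono: "l \<le> m \<Longrightarrow> sets (G l) \<subseteq> sets (G m)"
  using filtration.sets_F_mono[OF filt, of "tgrid T N l" "tgrid T N m"] T
  by (simp add: G_def tgrid_def divide_right_mono mult_right_mono)

lemma coeff_measurable:
  assumes "l \<le> N" shows "(\<lambda>\<omega>. l2inner L (u l \<omega>) (\<zeta> j)) \<in> borel_measurable (G l)"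
proof (cases l)
  case 0
  have "(\<lambda>\<omega>. l2inner L (u0 \<omega>) (\<zeta> j)) \<in> borel_measurable (F 0)"
    using u0m Hsp_\<zeta> by (simp add: Hmeas_def)
  moreover have "space (F 0) = space M" using sub[of 0] by (simp add: subalgebra_def)
  ultimately have "(\<lambda>\<omega>. l2inner L (u 0 \<omega>) (\<zeta> j)) \<in> borel_measurable (F 0)"
    by (subst measurable_cong[of _ _ "\<lambda>\<omega>. l2inner L (u0 \<omega>) (\<zeta> j)"]) (simp_all add: u_0)
  then show ?thesis by (simp add: 0 G_def tgrid_def)
next
  case (Suc m)
  then have "Hmeas L (F (tgrid T N l)) (u l)" using scheme assms by (simp add: euler_scheme_def)
  then show ?thesis using Hsp_\<zeta> by (simp add: Hmeas_def G_def)
qed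

lemma Xsq_measurable: "l \<le> N \<Longrightarrow> (\<lambda>\<omega>. Xsq (u l \<omega>)) \<in> borel_measurable (G l)"
  and Ysq_measurable: "l \<le> N \<Longrightarrow> (\<lambda>\<omega>. Ysq (u l \<omega>)) \<in> borel_measurable (G l)"
  unfolding a12sq_def Asq_def
  by (intro borel_measurable_suminf borel_measurable_times borel_measurable_power coeff_measurable borel_measurable_const; assumption)+

lemma tgrid_step:
  assumes "l < N"
  shows "0 \<le> tgrid T N l" "tgrid T N l < tgrid T N (Suc l)" "tgrid T N (Suc l) \<le> T" "tgrid T N (Suc l) - tgrid T N l = h"
proof -
  have "real (Suc l) \<le> real N" using assms by linarith
  from this mult_left_mono[OF this, of T] show "0 \<le> tgrid T N l" "tgrid T N l < tgrid T N (Suc l)" "tgrid T N (Suc l) \<le> T" "tgrid T N (Suc l) - tgrid T N l = h"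
    using T N by (simp_all add: tgrid_def h_def field_simps)
qed

lemma BM_step:
  assumes "l < N"
  shows "indep_sets (\<lambda>k. case k of None \<Rightarrow> sets (F (tgrid T N l))
        | Some j \<Rightarrow> {(\<lambda>\<omega>. b j (tgrid T N (Suc l)) \<omega> - b j (tgrid T N l) \<omega>) -` A \<inter> space M | A. A \<in> sets borel}) UNIV
      \<and> (\<forall>j. distributed M lborel (\<lambda>\<omega>. b j (tgrid T N (Suc l)) \<omega> - b j (tgrid T N l) \<omega>)
              (\<lambda>x. ennreal (normal_density 0 (sqrt (tgrid T N (Suc l) - tgrid T N l)) x)))"
  using BM tgrid_step(1-3)[OF assms] unfolding indep_BMs_def by blast

lemma incr_eq: "incr l j = (\<lambda>\<omega>. b j (tgrid T N (Suc l)) \<omega> - b j (tgrid T N l) \<omega>)"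
  by (simp add: incr_def fun_eq_iff)

lemma incr_indep:
  assumes "l < N"
  shows "indep_sets (\<lambda>k. case k of None \<Rightarrow> sets (G l) | Some j \<Rightarrow> {incr l j -` A \<inter> space M | A. A \<in> sets borel}) UNIV"
  unfolding incr_eq G_def by (rule conjunct1[OF BM_step[OF assms]])

lemma incr_distributed:
  assumes "l < N" shows "distributed M lborel (incr l j) (\<lambda>x. ennreal (normal_density 0 (sqrt h) x))"
  using conjunct2[OF BM_step[OF assms]] unfolding incr_eq tgrid_step(4)[OF assms] by (rule spec)

lemma noise_exp_moment:
  assumes l: "l < N" and mu: "0 < \<mu>" "2 * \<mu> * K0 * h \<le> 1/2"
    and f: "f \<in> borel_measurable (G l)" "\<And>\<omega>. 0 \<le> f \<omega>"
  shows "AE \<omega> in M. summable (\<lambda>j. lam j * (sqrt (q j) * incr l j \<omega>)\<^sup>2)"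
    and "(\<integral>\<^sup>+\<omega>. ennreal (f \<omega> * exp (\<mu> * noise l \<omega>)) \<partial>M)
      \<le> (\<integral>\<^sup>+\<omega>. ennreal (f \<omega> * exp (2 * \<mu> * h * K0 + 2 * \<mu>\<^sup>2 * h / (1 - 2 * \<mu> * K0 * h) * Ssq (u l \<omega>))) \<partial>M)"
proof -
  have s1: "\<And>\<omega>. \<omega> \<in> space M \<Longrightarrow> summable (\<lambda>j. lam j * (l2inner L (u l \<omega>) (\<zeta> j))\<^sup>2)"
    and s2: "\<And>\<omega>. \<omega> \<in> space M \<Longrightarrow> summable (\<lambda>j. q j * (lam j)\<^sup>2 * (l2inner L (u l \<omega>) (\<zeta> j))\<^sup>2)"
    using u_V[OF less_imp_le[OF l]] by (auto intro: summable_V Ssq_V(1))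
  note m = gaussian_noise_exp_moment[OF subG incr_indep[OF l] incr_distributed[OF l] h_pos mu(1) less_imp_le[OF lam_pos] less_imp_le[OF q]
      K0_summable mu(2)[unfolded K0_def] coeff_measurable[OF less_imp_le[OF l]] s1 s2 f]
  from m(1) show "AE \<omega> in M. summable (\<lambda>j. lam j * (sqrt (q j) * incr l j \<omega>)\<^sup>2)" by blast
  from m(2) show "(\<integral>\<^sup>+\<omega>. ennreal (f \<omega> * exp (\<mu> * noise l \<omega>)) \<partial>M)
      \<le> (\<integral>\<^sup>+\<omega>. ennreal (f \<omega> * exp (2 * \<mu> * h * K0 + 2 * \<mu>\<^sup>2 * h / (1 - 2 * \<mu> * K0 * h) * Ssq (u l \<omega>))) \<partial>M)"
    unfolding noise_def Ssq_def K0_def by blast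
qed

lemma AE_summable_noise:
  assumes l: "l < N" shows "AE \<omega> in M. summable (\<lambda>j. lam j * (sqrt (q j) * incr l j \<omega>)\<^sup>2)"
proof -
  \<comment> \<open>Summability does not involve \<mu>, so any admissible value will do; this one
    meets the smallness condition with equality.\<close>
  have "0 < 1 / (4 * K0 * h)" "2 * (1 / (4 * K0 * h)) * K0 * h \<le> 1/2" using K0_pos h_pos by simp_all
  from noise_exp_moment(1)[OF l this, of "\<lambda>_. 0"] show ?thesis by simp
qed

lemma AE_DomA: "AE \<omega> in M. \<forall>l\<in>{1..N}. DomA L (u l \<omega>)"
  using scheme by (subst AE_ball_countable) (auto simp: euler_scheme_def)

text \<open>Testing with $\zeta_j$ and summing with weights $\lambda_j (\mathbf u^l, \zeta_j)$ replaces the test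
  function $A\mathbf u^l$, which need not belong to $V$.\<close>

lemma energy_inequality:
  assumes l: "l < N"
  shows "AE \<omega> in M. Xsq (u (Suc l) \<omega>) + 2 * \<nu> * h * Ysq (u (Suc l) \<omega>) \<le> Xsq (u l \<omega>) + noise l \<omega>"
proof -
  have "AE \<omega> in M. DomA L (u (Suc l) \<omega>)"
    "AE \<omega> in M. \<forall>\<phi>. Vsp L \<phi> \<longrightarrow> l2inner L (u (Suc l) \<omega> - u l \<omega>) \<phi>
            + T / real N * (\<nu> * a12inner L \<zeta> lam (u (Suc l) \<omega>) \<phi> + Bform L (u (Suc l) \<omega>) (u (Suc l) \<omega>) \<phi>)
            = noise_inner L \<zeta> q b (tgrid T N l) (tgrid T N (Suc l)) \<phi> \<omega>"
    using scheme l by (auto simp: euler_scheme_def dest!: bspec[of _ _ "Suc l"])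
  then show ?thesis using AE_summable_noise[OF l] AE_space
  proof eventually_elim
    case (elim \<omega>)
    define a where "a j = l2inner L (u (Suc l) \<omega>) (\<zeta> j)" for j
    define p where "p j = l2inner L (u l \<omega>) (\<zeta> j)" for j
    define d where "d j = sqrt (q j) * incr l j \<omega>" for j
    define B where "B j = Bform L (u (Suc l) \<omega>) (u (Suc l) \<omega>) (\<zeta> j)" for j
    have sq: "sqf L (u (Suc l) \<omega>)" "sqf L (u l \<omega>)"
      using u_V[of "Suc l" \<omega>] u_V[of l \<omega>] l elim(4) by (auto simp: Vsp_def intro: Hsp_sqf)
    have eq: "a j - p j + h * (\<nu> * (lam j * a j) + B j) = d j" for j
    proof -
      have "l2inner L (u (Suc l) \<omega> - u l \<omega>) (\<zeta> j) = a j - p j"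
        using l2inner_diff[OF sq sqf_\<zeta>] by (simp add: a_def p_def fun_diff_def)
      moreover have "a12inner L \<zeta> lam (u (Suc l) \<omega>) (\<zeta> j) = lam j * a j"
        unfolding a12inner_def a_def by (subst suminf_finite[of "{j}"]) (auto simp: orthonormal)
      moreover have "noise_inner L \<zeta> q b (tgrid T N l) (tgrid T N (Suc l)) (\<zeta> j) \<omega> = d j"
        unfolding noise_inner_def d_def incr_def by (subst suminf_finite[of "{j}"]) (auto simp: orthonormal)
      ultimately show ?thesis using elim(2)[rule_format, OF Vsp_\<zeta>[of j]] by (simp add: h_def B_def)
    qed
    \<comment> \<open>With a, p the new and old coefficients and d the noise, 2 a (a - p) = a^2 -
      p^2 + (a - p)^2. The last square absorbs the mixed term 2 (a - p) d up to d^2, which leaves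
      the noise paired with the past value p only.\<close>
    have termwise: "(lam j * (a j)\<^sup>2 - lam j * (p j)\<^sup>2) + 2 * \<nu> * h * ((lam j)\<^sup>2 * (a j)\<^sup>2) + 2 * h * (lam j * a j * B j)
        \<le> 2 * lam j * p j * d j + lam j * (d j)\<^sup>2" for j
    proof -
      have "0 \<le> lam j * (d j - (a j - p j))\<^sup>2" using less_imp_le[OF lam_pos[of j]] by simp
      moreover have "2 * lam j * a j * (a j - p j + h * (\<nu> * (lam j * a j) + B j)) = 2 * lam j * a j * d j"
        unfolding eq ..
      ultimately show ?thesis by (simp add: power2_eq_square algebra_simps)
    qed
    have sa: "summable (\<lambda>j. lam j * (a j)\<^sup>2)" and sp: "summable (\<lambda>j. lam j * (p j)\<^sup>2)"
      unfolding a_def p_def using summable_V u_V l elim(4) by simp_all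
    have sA: "summable (\<lambda>j. (lam j)\<^sup>2 * (a j)\<^sup>2)" unfolding a_def by (rule summable_DomA[OF elim(1)])
    have sd: "summable (\<lambda>j. lam j * (d j)\<^sup>2)" using elim(3) by (simp add: d_def)
    have sB: "(\<lambda>j. lam j * a j * B j) sums 0" unfolding a_def B_def by (rule Bform_orthogonal[OF elim(1)])
    have lhs: "(\<lambda>j. (lam j * (a j)\<^sup>2 - lam j * (p j)\<^sup>2) + 2 * \<nu> * h * ((lam j)\<^sup>2 * (a j)\<^sup>2) + 2 * h * (lam j * a j * B j))
        sums ((Xsq (u (Suc l) \<omega>) - Xsq (u l \<omega>)) + 2 * \<nu> * h * Ysq (u (Suc l) \<omega>) + 2 * h * 0)"
      unfolding a12sq_def Asq_def a_def[symmetric] p_def[symmetric]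
      by (intro sums_add sums_diff sums_mult summable_sums sa sp sA sB)
    have "summable (\<lambda>j. 2 * lam j * p j * d j + lam j * (d j)\<^sup>2)"
    proof (intro summable_add sd, rule summable_comparison_test[OF _ summable_add[OF sp sd]])
      have "\<bar>2 * lam j * p j * d j\<bar> \<le> lam j * (p j)\<^sup>2 + lam j * (d j)\<^sup>2" for j
      proof -
        have "\<bar>2 * p j * d j\<bar> \<le> (p j)\<^sup>2 + (d j)\<^sup>2"
          using sum_squares_bound[of "p j" "d j"] sum_squares_bound[of "p j" "- d j"] by (simp add: abs_le_iff)
        from mult_left_mono[OF this less_imp_le[OF lam_pos[of j]]] show ?thesis
          using lam_pos[of j] by (simp add: abs_mult distrib_left mult_ac)
      qed
      then show "\<exists>N. \<forall>j\<ge>N. norm (2 * lam j * p j * d j) \<le> lam j * (p j)\<^sup>2 + lam j * (d j)\<^sup>2" by auto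
    qed
    then have rhs: "(\<lambda>j. 2 * lam j * p j * d j + lam j * (d j)\<^sup>2) sums noise l \<omega>"
      unfolding noise_def p_def[symmetric] d_def[symmetric] by (rule summable_sums)
    show ?case using sums_le[OF termwise lhs rhs] by simp
  qed
qed

end

section \<open>Exponential moments of the scheme\<close>

context euler_run
begin

text \<open>One functional for both bounds: \<theta> = 0 gives the first, \<theta> = 1 the
  second.\<close>

definition energy :: "real \<Rightarrow> nat \<Rightarrow> 'a \<Rightarrow> real" where
  "energy \<theta> l \<omega> = Xsq (u l \<omega>) + \<theta> * (\<nu> * h * (\<Sum>i\<in>{1..l}. Ysq (u i \<omega>)))"

text \<open>The extra dissipation $(2-\theta)\nu h\,|A\mathbf u^l|^2$ pays for the conditional variance of the next
  noise increment; at $l = 0$, where $A\mathbf u^0$ may not exist, a multiple of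
  $|A^{1/2}\mathbf u^0|^2$ is used instead.\<close>

definition lyap :: "real \<Rightarrow> real \<Rightarrow> nat \<Rightarrow> 'a \<Rightarrow> real" where
  "lyap \<theta> \<delta> l \<omega> = (if l = 0 then (1 + \<delta>) * Xsq (u 0 \<omega>) else energy \<theta> l \<omega> + (2 - \<theta>) * \<nu> * h * Ysq (u l \<omega>))"

text \<open>Logarithm of the supermartingale. Subtracting the initial value makes it start at 0, so
  the initial moment can be treated separately; the last term compensates the mean energy input of
  the noise.\<close>

definition logZ :: "real \<Rightarrow> real \<Rightarrow> real \<Rightarrow> nat \<Rightarrow> 'a \<Rightarrow> real" where
  "logZ \<theta> \<delta> \<mu> l \<omega> = \<mu> * (lyap \<theta> \<delta> l \<omega> - lyap \<theta> \<delta> 0 \<omega>) - 2 * \<mu> * h * K0 * real l"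

lemma measurable_G_mono:
  assumes "f \<in> borel_measurable (G l)" "l \<le> m" shows "f \<in> borel_measurable (G m)"
proof -
  have "space (G l) = space (G m)" using subG[of l] subG[of m] by (simp add: subalgebra_def)
  then show ?thesis using measurable_mono[OF order_refl refl G_mono[OF assms(2)]] assms(1) by auto
qed

lemma energy_measurable: "l \<le> N \<Longrightarrow> energy \<theta> l \<in> borel_measurable (G l)"
  unfolding energy_def[abs_def]
  by (intro borel_measurable_add borel_measurable_times borel_measurable_const borel_measurable_sum
        Xsq_measurable measurable_G_mono[OF Ysq_measurable]) auto

lemma lyap_measurable:
  assumes "l \<le> N" shows "lyap \<theta> \<delta> l \<in> borel_measurable (G l)"
proof (cases "l = 0")
  case True
  then show ?thesis using Xsq_measurable[of 0] by (simp add: lyap_def[abs_def])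
next
  case False
  have "(\<lambda>\<omega>. energy \<theta> l \<omega> + (2 - \<theta>) * \<nu> * h * Ysq (u l \<omega>)) \<in> borel_measurable (G l)"
    by (intro borel_measurable_add borel_measurable_times borel_measurable_const energy_measurable Ysq_measurable assms)
  then show ?thesis using False by (simp add: lyap_def[abs_def])
qed

lemma logZ_measurable: "l \<le> N \<Longrightarrow> logZ \<theta> \<delta> \<mu> l \<in> borel_measurable (G l)"
  unfolding logZ_def[abs_def]
  by (intro borel_measurable_diff borel_measurable_times borel_measurable_const lyap_measurable
        measurable_G_mono[OF lyap_measurable]) auto

text \<open>Condition \<open>c1\<close> lets the reserve (2 - \<theta>) \<nu> h |Au|^2 of the
  previous step pay for the conditional variance. Condition \<open>c2\<close> does the same at l = 0
  with the multiple \<delta> of |A^{1/2} u^0|^2.\<close>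

lemma logZ_step:
  assumes mu: "0 < \<mu>" and th: "\<theta> \<le> 2" and \<rho>: "2 * \<mu> * K0 * h \<le> 1/2"
    and c1: "2 * \<mu> * Tr \<le> (2 - \<theta>) * \<nu> * (1 - 2 * \<mu> * K0 * h)"
    and c2: "2 * \<mu> * K0 * h \<le> \<delta> * (1 - 2 * \<mu> * K0 * h)"
    and l: "l < N" and f: "f \<in> borel_measurable (G l)" "\<And>\<omega>. 0 \<le> f \<omega>"
  shows "(\<integral>\<^sup>+\<omega>. ennreal (f \<omega> * exp (logZ \<theta> \<delta> \<mu> (Suc l) \<omega>)) \<partial>M) \<le> (\<integral>\<^sup>+\<omega>. ennreal (f \<omega> * exp (logZ \<theta> \<delta> \<mu> l \<omega>)) \<partial>M)"
proof -
  define c where "c = 2 * \<mu> * h * K0"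
  define D where "D = 1 - 2 * \<mu> * K0 * h"
  have D: "0 < D" using \<rho> by (simp add: D_def)
  \<comment> \<open>Everything known at time l is collected here, leaving exp(\<mu>
    \<open>noise l\<close>) as the only factor to be integrated.\<close>
  define f' where "f' \<omega> = f \<omega> * exp (\<mu> * (energy \<theta> l \<omega> - lyap \<theta> \<delta> 0 \<omega>) - c * real (Suc l))" for \<omega>
  have f'm: "f' \<in> borel_measurable (G l)"
    unfolding f'_def[abs_def] using l
    by (intro borel_measurable_times borel_measurable_diff borel_measurable_const f(1) energy_measurable
        borel_measurable_exp[THEN measurable_compose[rotated]] measurable_G_mono[OF lyap_measurable]) auto
  have f'0: "0 \<le> f' \<omega>" for \<omega> using f(2) by (simp add: f'_def)
  have "(\<integral>\<^sup>+\<omega>. ennreal (f \<omega> * exp (logZ \<theta> \<delta> \<mu> (Suc l) \<omega>)) \<partial>M) \<le> (\<integral>\<^sup>+\<omega>. ennreal (f' \<omega> * exp (\<mu> * noise l \<omega>)) \<partial>M)"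
  proof (rule nn_integral_mono_AE)
    show "AE \<omega> in M. ennreal (f \<omega> * exp (logZ \<theta> \<delta> \<mu> (Suc l) \<omega>)) \<le> ennreal (f' \<omega> * exp (\<mu> * noise l \<omega>))"
      using energy_inequality[OF l]
    proof eventually_elim
      case (elim \<omega>)
      \<comment> \<open>The new summand of the energy, with factor \<theta>, and the reserve, with
        factor 2 - \<theta>, add up to the full dissipation of the energy inequality.\<close>
      have "lyap \<theta> \<delta> (Suc l) \<omega> \<le> energy \<theta> l \<omega> + noise l \<omega>"
        using elim by (simp add: lyap_def energy_def algebra_simps)
      from mult_left_mono[OF this less_imp_le[OF mu]]
      have "logZ \<theta> \<delta> \<mu> (Suc l) \<omega> \<le> (\<mu> * (energy \<theta> l \<omega> - lyap \<theta> \<delta> 0 \<omega>) - c * real (Suc l)) + \<mu> * noise l \<omega>"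
        by (simp add: logZ_def c_def algebra_simps)
      then have "f \<omega> * exp (logZ \<theta> \<delta> \<mu> (Suc l) \<omega>) \<le> f' \<omega> * exp (\<mu> * noise l \<omega>)"
        unfolding f'_def mult.assoc exp_add[symmetric] using f(2)[of \<omega>] by (intro mult_left_mono) auto
      then show ?case by (rule ennreal_leI)
    qed
  qed
  also have "\<dots> \<le> (\<integral>\<^sup>+\<omega>. ennreal (f' \<omega> * exp (2 * \<mu> * h * K0 + 2 * \<mu>\<^sup>2 * h / (1 - 2 * \<mu> * K0 * h) * Ssq (u l \<omega>))) \<partial>M)"
    by (rule noise_exp_moment(2)[OF l mu \<rho> f'm f'0])
  also have "\<dots> \<le> (\<integral>\<^sup>+\<omega>. ennreal (f \<omega> * exp (logZ \<theta> \<delta> \<mu> l \<omega>)) \<partial>M)"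
  proof (rule nn_integral_mono_AE)
    show "AE \<omega> in M. ennreal (f' \<omega> * exp (2 * \<mu> * h * K0 + 2 * \<mu>\<^sup>2 * h / (1 - 2 * \<mu> * K0 * h) * Ssq (u l \<omega>))) \<le> ennreal (f \<omega> * exp (logZ \<theta> \<delta> \<mu> l \<omega>))"
      using AE_DomA AE_space
    proof eventually_elim
      case (elim \<omega>)
      have "2 * \<mu>\<^sup>2 * h / D * Ssq (u l \<omega>) \<le> \<mu> * (lyap \<theta> \<delta> l \<omega> - energy \<theta> l \<omega>)"
      proof (cases "l = 0")
        case True
        have V: "Vsp L (u 0 \<omega>)" using u_V[of 0 \<omega>] elim by simp
        have "2 * \<mu>\<^sup>2 * h / D * Ssq (u 0 \<omega>) \<le> 2 * \<mu>\<^sup>2 * h / D * (K0 * Xsq (u 0 \<omega>))"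
          using h_pos D by (intro mult_left_mono Ssq_V(2)[OF V]) auto
        also have "\<dots> = \<mu> * (2 * \<mu> * K0 * h / D) * Xsq (u 0 \<omega>)" by (simp add: power2_eq_square)
        also have "\<dots> \<le> \<mu> * \<delta> * Xsq (u 0 \<omega>)"
          using c2 D mu Xsq_nonneg[OF V] by (intro mult_right_mono mult_left_mono) (auto simp: pos_divide_le_eq D_def)
        finally show ?thesis using True by (simp add: lyap_def energy_def algebra_simps)
      next
        case False
        then have DA: "DomA L (u l \<omega>)" using elim(1) l by auto
        have "2 * \<mu>\<^sup>2 * h / D * Ssq (u l \<omega>) \<le> 2 * \<mu>\<^sup>2 * h / D * (Tr * Ysq (u l \<omega>))"
          using h_pos D by (intro mult_left_mono Ssq_DomA[OF DA]) auto
        also have "\<dots> = \<mu> * h * (2 * \<mu> * Tr / D) * Ysq (u l \<omega>)" by (simp add: power2_eq_square)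
        also have "\<dots> \<le> \<mu> * h * ((2 - \<theta>) * \<nu>) * Ysq (u l \<omega>)"
          using c1 D mu h_pos Ysq_nonneg[OF DA] by (intro mult_right_mono mult_left_mono) (auto simp: pos_divide_le_eq D_def)
        finally show ?thesis using False by (simp add: lyap_def algebra_simps)
      qed
      then have "(\<mu> * (energy \<theta> l \<omega> - lyap \<theta> \<delta> 0 \<omega>) - c * real (Suc l)) + (2 * \<mu> * h * K0 + 2 * \<mu>\<^sup>2 * h / D * Ssq (u l \<omega>)) \<le> logZ \<theta> \<delta> \<mu> l \<omega>"
        by (simp add: logZ_def c_def algebra_simps)
      then have "f' \<omega> * exp (2 * \<mu> * h * K0 + 2 * \<mu>\<^sup>2 * h / D * Ssq (u l \<omega>)) \<le> f \<omega> * exp (logZ \<theta> \<delta> \<mu> l \<omega>)"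
        unfolding f'_def mult.assoc exp_add[symmetric] using f(2)[of \<omega>] by (intro mult_left_mono) auto
      then show ?case unfolding D_def by (rule ennreal_leI)
    qed
  qed
  finally show ?thesis .
qed

text \<open>The exponent is a convex combination: weight s goes to the initial value, of which order
  \<gamma> is available, and weight 1 - s to the maximum of \<open>logZ\<close>. For the latter r is
  the order that remains, and r < 1 is what the maximal inequality can deliver.\<close>

lemma exp_moment_energy:
  assumes mu: "0 < \<mu>" and th: "0 \<le> \<theta>" "\<theta> \<le> 2" and \<rho>: "2 * \<mu> * K0 * h \<le> 1/2"
    and c1: "2 * \<mu> * Tr \<le> (2 - \<theta>) * \<nu> * (1 - 2 * \<mu> * K0 * h)"
    and c2: "2 * \<mu> * K0 * h \<le> \<delta> * (1 - 2 * \<mu> * K0 * h)" and \<delta>: "0 \<le> \<delta>"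
    and \<alpha>: "0 < \<alpha>" and \<gamma>: "0 < \<gamma>" and s: "s = \<alpha> * (1 + \<delta>) / \<gamma>" "s < 1"
    and r: "r = (\<alpha> / \<mu>) / (1 - s)" "r < 1"
  shows "(\<integral>\<^sup>+\<omega>. ennreal (exp (\<alpha> * Max ((\<lambda>l. energy \<theta> l \<omega>) ` {0..N}))) \<partial>M)
    \<le> ennreal (exp (2 * \<alpha> * K0 * T)) * ((\<integral>\<^sup>+\<omega>. ennreal (exp (\<gamma> * Xsq (u0 \<omega>))) \<partial>M) + ennreal (exp r / (1 - exp (r - 1))))"
proof -
  let ?V = "logZ \<theta> \<delta> \<mu>"
  have VM: "?V l \<in> borel_measurable M" if "l \<le> N" for l
    using measurable_from_subalg[OF subG logZ_measurable[OF that]] .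
  have r0: "0 < r" using \<alpha> mu s r by simp
  have mx: "(\<integral>\<^sup>+\<omega>. ennreal (exp (r * Max ((\<lambda>l. ?V l \<omega>) ` {0..N}))) \<partial>M) \<le> ennreal (exp r / (1 - exp (r - 1)))"
  proof (rule exp_moment_max[OF r0 r(2) VM])
    show "?V 0 \<omega> = 0" for \<omega> by (simp add: logZ_def)
    show "(\<integral>\<^sup>+\<omega>. indicator {\<omega>. \<exists>l\<le>N. k \<le> ?V l \<omega>} \<omega> \<partial>M) \<le> ennreal (exp (- k))" for k
      by (rule maximal_inequality_exp[where V="?V" and G=G and N=N, OF subG G_mono logZ_measurable _ logZ_step[OF mu th(2) \<rho> c1 c2]])
         (simp_all add: logZ_def)
  qed
  have X0m: "(\<lambda>\<omega>. Xsq (u 0 \<omega>)) \<in> borel_measurable M"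
    using measurable_from_subalg[OF subG Xsq_measurable[of 0]] by simp
  have Maxm: "(\<lambda>\<omega>. Max ((\<lambda>l. ?V l \<omega>) ` {0..N})) \<in> borel_measurable M"
    using VM by (intro borel_measurable_Max) auto
  have "(\<integral>\<^sup>+\<omega>. ennreal (exp (\<alpha> * Max ((\<lambda>l. energy \<theta> l \<omega>) ` {0..N}))) \<partial>M)
      \<le> (\<integral>\<^sup>+\<omega>. ennreal (exp (2 * \<alpha> * K0 * T)) * (ennreal (exp (\<gamma> * Xsq (u 0 \<omega>))) + ennreal (exp (r * Max ((\<lambda>l. ?V l \<omega>) ` {0..N})))) \<partial>M)"
  proof (rule nn_integral_mono_AE)
    show "AE \<omega> in M. ennreal (exp (\<alpha> * Max ((\<lambda>l. energy \<theta> l \<omega>) ` {0..N})))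
      \<le> ennreal (exp (2 * \<alpha> * K0 * T)) * (ennreal (exp (\<gamma> * Xsq (u 0 \<omega>))) + ennreal (exp (r * Max ((\<lambda>l. ?V l \<omega>) ` {0..N}))))"
      using AE_DomA AE_space
    proof eventually_elim
      case (elim \<omega>)
      define m where "m = Max ((\<lambda>l. ?V l \<omega>) ` {0..N})"
      let ?x = "Xsq (u 0 \<omega>)"
      have x0: "0 \<le> ?x" by (rule Xsq_nonneg[OF u_V]) (use elim in auto)
      have en: "energy \<theta> l \<omega> \<le> (1 + \<delta>) * ?x + (m + 2 * \<mu> * K0 * T) / \<mu>" if l: "l \<le> N" for l
      proof -
        have "energy \<theta> l \<omega> \<le> lyap \<theta> \<delta> l \<omega>"
        proof (cases "l = 0")
          case True
          then show ?thesis using x0 \<delta> by (simp add: lyap_def energy_def distrib_right)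
        next
          case False
          then have "0 \<le> Ysq (u l \<omega>)" using elim(1) l by (intro Ysq_nonneg) auto
          then show ?thesis using False th nu h_pos by (simp add: lyap_def)
        qed
        moreover have "?V l \<omega> \<le> m" unfolding m_def using l by (intro Max_ge) auto
        moreover have "2 * \<mu> * h * K0 * real l \<le> 2 * \<mu> * K0 * T"
        proof -
          have "(2 * \<mu> * h * K0) * real l \<le> (2 * \<mu> * h * K0) * real N"
            using l mu h_pos K0_pos by (intro mult_left_mono) auto
          also have "\<dots> = 2 * \<mu> * K0 * (real N * h)" by (simp only: mult_ac)
          finally show ?thesis by (simp only: Nh)
        qed
        ultimately have "\<mu> * (lyap \<theta> \<delta> l \<omega> - lyap \<theta> \<delta> 0 \<omega>) \<le> m + 2 * \<mu> * K0 * T" by (simp add: logZ_def)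
        then have "lyap \<theta> \<delta> l \<omega> - lyap \<theta> \<delta> 0 \<omega> \<le> (m + 2 * \<mu> * K0 * T) / \<mu>"
          using mu by (simp add: pos_le_divide_eq mult.commute)
        then show ?thesis using \<open>energy \<theta> l \<omega> \<le> lyap \<theta> \<delta> l \<omega>\<close> by (simp add: lyap_def)
      qed
      have "Max ((\<lambda>l. energy \<theta> l \<omega>) ` {0..N}) \<le> (1 + \<delta>) * ?x + (m + 2 * \<mu> * K0 * T) / \<mu>"
        using en by (intro Max.boundedI) auto
      from mult_left_mono[OF this less_imp_le[OF \<alpha>]]
      have "\<alpha> * Max ((\<lambda>l. energy \<theta> l \<omega>) ` {0..N}) \<le> \<alpha> * (1 + \<delta>) * ?x + \<alpha> / \<mu> * m + 2 * \<alpha> * K0 * T"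
        using mu by (simp add: field_simps)
      \<comment> \<open>The convex combination is below the maximum, and the exponential of a
        maximum is below the sum of exponentials; hence no independence of the two parts is
        required.\<close>
      also have "\<alpha> * (1 + \<delta>) * ?x + \<alpha> / \<mu> * m = s * (\<gamma> * ?x) + (1 - s) * (r * m)"
      proof -
        have "\<alpha> * (1 + \<delta>) = s * \<gamma>" using s \<gamma> by simp
        moreover have "\<alpha> / \<mu> = (1 - s) * r" unfolding r(1) using s(2) by simp
        ultimately show ?thesis by (simp only: mult.assoc)
      qed
      also have "s * (\<gamma> * ?x) + (1 - s) * (r * m) \<le> s * max (\<gamma> * ?x) (r * m) + (1 - s) * max (\<gamma> * ?x) (r * m)"
      proof (intro add_mono mult_left_mono)
        show "0 \<le> s" using s(1) \<alpha> \<delta> \<gamma> by simp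
      qed (use s in auto)
      also have "\<dots> = max (\<gamma> * ?x) (r * m)" by (simp add: algebra_simps)
      finally have "exp (\<alpha> * Max ((\<lambda>l. energy \<theta> l \<omega>) ` {0..N})) \<le> exp (2 * \<alpha> * K0 * T) * exp (max (\<gamma> * ?x) (r * m))"
        by (simp add: exp_add[symmetric] add.commute)
      also have "\<dots> \<le> exp (2 * \<alpha> * K0 * T) * (exp (\<gamma> * ?x) + exp (r * m))"
        by (intro mult_left_mono) (auto simp: max_def)
      finally show ?case unfolding m_def[symmetric] by (simp add: ennreal_leI flip: ennreal_mult ennreal_plus)
    qed
  qed
  also have "\<dots> = ennreal (exp (2 * \<alpha> * K0 * T)) * ((\<integral>\<^sup>+\<omega>. ennreal (exp (\<gamma> * Xsq (u 0 \<omega>))) \<partial>M)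
      + (\<integral>\<^sup>+\<omega>. ennreal (exp (r * Max ((\<lambda>l. ?V l \<omega>) ` {0..N}))) \<partial>M))"
  proof -
    note [measurable] = X0m Maxm
    show ?thesis by (subst nn_integral_cmult, measurable) (subst nn_integral_add, measurable)
  qed
  also have "(\<integral>\<^sup>+\<omega>. ennreal (exp (\<gamma> * Xsq (u 0 \<omega>))) \<partial>M) = (\<integral>\<^sup>+\<omega>. ennreal (exp (\<gamma> * Xsq (u0 \<omega>))) \<partial>M)"
    by (rule nn_integral_cong) (simp add: u_0)
  finally show ?thesis by (rule order_trans) (intro mult_left_mono add_left_mono mx zero_le)
qed

end

context stochastic_euler
begin

text \<open>The strict inequality in \<open>a\<close> leaves a margin \<eta>, which is split in
  thirds: one for taking \<mu> strictly below its limit, one for \<delta>, and one for r <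
  1.\<close>

lemma exp_moment_scheme:
  assumes th: "\<theta> \<in> {0, 1}" and \<alpha>: "0 < \<alpha>" and \<gamma>: "0 < \<gamma>"
    and a: "\<alpha> * (2 * Tr) / ((2 - \<theta>) * \<nu>) + \<alpha> / \<gamma> < 1"
    and u0: "\<And>\<omega>. \<omega> \<in> space M \<Longrightarrow> Vsp L (u0 \<omega>)" "Hmeas L (F 0) u0"
    and E: "(\<integral>\<^sup>+\<omega>. ennreal (exp (\<gamma> * Xsq (u0 \<omega>))) \<partial>M) < \<infinity>"
  shows "\<exists>C::real. \<exists>N0. \<forall>N\<ge>N0. \<forall>u. euler_scheme L \<nu> T N M F b q \<zeta> lam u0 u \<longrightarrow>
    (\<integral>\<^sup>+\<omega>. ennreal (exp (\<alpha> * Max ((\<lambda>n. Xsq (u n \<omega>) + \<theta> * (\<nu> * (T / real N) * (\<Sum>l\<in>{1..n}. Ysq (u l \<omega>)))) ` {0..N}))) \<partial>M) \<le> ennreal C"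
proof -
  \<comment> \<open>The supremum of the \<mu> satisfying the absorption condition in the limit h =
    0: \<nu>/Tr for \<theta> = 0 and half of it for \<theta> = 1.\<close>
  define A where "A = (2 - \<theta>) * \<nu> / (2 * Tr)"
  have A: "0 < A" using th nu Tr_pos by (auto simp: A_def)
  have \<alpha>A: "\<alpha> * (2 * Tr) / ((2 - \<theta>) * \<nu>) = \<alpha> / A" by (simp add: A_def)
  define \<eta> where "\<eta> = 1 - \<alpha> / A - \<alpha> / \<gamma>"
  have \<eta>: "0 < \<eta>" using a unfolding \<alpha>A by (simp add: \<eta>_def)
  have pos: "0 < \<alpha> / A" "0 < \<alpha> / \<gamma>" using \<alpha> A \<gamma> by simp_all
  \<comment> \<open>Chosen so that \<alpha>/\<mu> = \<alpha>/A + \<eta>/3.\<close>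
  define \<mu> where "\<mu> = \<alpha> / (\<alpha> / A + \<eta> / 3)"
  have mu: "0 < \<mu>" using \<alpha> pos \<eta> by (simp add: \<mu>_def)
  have \<alpha>\<mu>: "\<alpha> / \<mu> = \<alpha> / A + \<eta> / 3" using \<alpha> pos \<eta> by (simp add: \<mu>_def)
  have \<mu>A: "\<mu> < A"
  proof -
    have "\<alpha> / A < \<alpha> / \<mu>" using \<alpha>\<mu> \<eta> by simp
    then show ?thesis using \<alpha> A mu by (simp add: frac_less2 divide_less_eq less_divide_eq mult.commute)
  qed
  \<comment> \<open>Chosen so that s = \<alpha>/\<gamma> + \<eta>/3.\<close>
  define \<delta> where "\<delta> = \<gamma> * \<eta> / (3 * \<alpha>)"
  have \<delta>: "0 < \<delta>" using \<gamma> \<eta> \<alpha> by (simp add: \<delta>_def)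
  define s where "s = \<alpha> * (1 + \<delta>) / \<gamma>"
  have s_eq: "s = \<alpha> / \<gamma> + \<eta> / 3" using \<alpha> \<gamma> by (simp add: s_def \<delta>_def field_simps)
  have \<alpha>\<mu>_less: "\<alpha> / \<mu> < 1 - s" 
  proof -
    have "1 - s - (\<alpha> / A + \<eta> / 3) = \<eta> / 3" by (simp add: s_eq \<eta>_def field_simps)
    then show ?thesis unfolding \<alpha>\<mu> using \<eta> by linarith
  qed
  have s1: "s < 1"
    using \<alpha>\<mu>_less \<alpha> mu by (smt (verit) divide_pos_pos)
  define r where "r = (\<alpha> / \<mu>) / (1 - s)"
  have r: "r < 1" unfolding r_def using \<alpha>\<mu>_less s1 by (subst pos_divide_less_eq) simp_all
  \<comment> \<open>Three bounds on 2 \<mu> K0 h: 1/2 for the Gaussian integrals, 1 - \<mu>/A for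
    the absorption of the variance, and \<delta>/2 for the first step, where 1 - 2 \<mu> K0 h is at
    least 1/2. N0 makes h small enough and does not depend on the solution.\<close>
  define \<epsilon> where "\<epsilon> = min (1/2) (min (1 - \<mu> / A) (\<delta> / 2))"
  have \<epsilon>: "0 < \<epsilon>" using \<mu>A A \<delta> by (simp add: \<epsilon>_def)
  obtain N0 :: nat where N0: "2 * \<mu> * K0 * T / \<epsilon> < real N0" using reals_Archimedean2 by blast
  have N0pos: "0 < N0"
  proof -
    have "0 < 2 * \<mu> * K0 * T / \<epsilon>" using mu K0_pos T \<epsilon> by simp
    then show ?thesis using N0 by (metis less_trans of_nat_0_less_iff)
  qed
  let ?E = "\<integral>\<^sup>+\<omega>. ennreal (exp (\<gamma> * Xsq (u0 \<omega>))) \<partial>M"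
  define C where "C = exp (2 * \<alpha> * K0 * T) * (enn2real ?E + exp r / (1 - exp (r - 1)))"
  have rC: "0 \<le> exp r / (1 - exp (r - 1))" using r by simp
  have Ceq: "ennreal (exp (2 * \<alpha> * K0 * T)) * (?E + ennreal (exp r / (1 - exp (r - 1)))) = ennreal C"
  proof -
    have "?E = ennreal (enn2real ?E)" using E by simp
    then have "?E + ennreal (exp r / (1 - exp (r - 1))) = ennreal (enn2real ?E + exp r / (1 - exp (r - 1)))"
      using ennreal_plus[OF enn2real_nonneg rC, of ?E] by simp
    then show ?thesis using rC by (simp add: C_def ennreal_mult)
  qed
  show ?thesis
  proof (intro exI[of _ C] exI[of _ N0] allI impI)
    fix N u assume N: "N0 \<le> N" and sch: "euler_scheme L \<nu> T N M F b q \<zeta> lam u0 u"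
    interpret R: euler_run L \<zeta> lam M \<nu> T F b q N u0 u
      by unfold_locales (use N N0pos sch u0 in auto)
    have \<rho>: "2 * \<mu> * K0 * R.h \<le> \<epsilon>"
    proof -
      have "2 * \<mu> * K0 * T / \<epsilon> \<le> real N" using N0 N by linarith
      then have "2 * \<mu> * K0 * T \<le> real N * \<epsilon>" using \<epsilon> by (simp add: pos_divide_le_eq)
      then show ?thesis using N N0pos by (simp add: R.h_def pos_divide_le_eq mult.commute)
    qed
    then have \<rho>1: "2 * \<mu> * K0 * R.h \<le> 1/2" and \<rho>2: "2 * \<mu> * K0 * R.h \<le> 1 - \<mu> / A" and \<rho>3: "2 * \<mu> * K0 * R.h \<le> \<delta> / 2"
      by (simp_all add: \<epsilon>_def)
    have c1: "2 * \<mu> * Tr \<le> (2 - \<theta>) * \<nu> * (1 - 2 * \<mu> * K0 * R.h)"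
    proof -
      have "0 \<le> (2 - \<theta>) * \<nu>" using th nu by auto
      from mult_left_mono[OF _ this, of "\<mu> / A" "1 - 2 * \<mu> * K0 * R.h"] \<rho>2
      have "(2 - \<theta>) * \<nu> * (\<mu> / A) \<le> (2 - \<theta>) * \<nu> * (1 - 2 * \<mu> * K0 * R.h)" by simp
      moreover have "(2 - \<theta>) * \<nu> * (\<mu> / A) = 2 * \<mu> * Tr"
        using th nu Tr_pos by (auto simp: A_def)
      ultimately show ?thesis by simp
    qed
    have c2: "2 * \<mu> * K0 * R.h \<le> \<delta> * (1 - 2 * \<mu> * K0 * R.h)"
    proof -
      have "\<delta> * (1/2) \<le> \<delta> * (1 - 2 * \<mu> * K0 * R.h)" using \<rho>1 \<delta> by (intro mult_left_mono) auto
      then show ?thesis using \<rho>3 by simp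
    qed
    have "0 \<le> \<theta>" "\<theta> \<le> 2" using th by auto
    from R.exp_moment_energy[OF mu this \<rho>1 c1 c2 less_imp_le[OF \<delta>] \<alpha> \<gamma> s_def s1 r_def r]
    show "(\<integral>\<^sup>+\<omega>. ennreal (exp (\<alpha> * Max ((\<lambda>n. Xsq (u n \<omega>) + \<theta> * (\<nu> * (T / real N) * (\<Sum>l\<in>{1..n}. Ysq (u l \<omega>)))) ` {0..N}))) \<partial>M) \<le> ennreal C"
      unfolding Ceq by (simp only: R.energy_def R.h_def)
  qed
qed

end

theorem theorem3p2:
  fixes L \<nu> T :: real
    and M :: "'a measure" and F :: "real \<Rightarrow> 'a measure"
    and b :: "nat \<Rightarrow> real \<Rightarrow> 'a \<Rightarrow> real" and q :: "nat \<Rightarrow> real"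
    and \<zeta> :: "nat \<Rightarrow> field" and lam :: "nat \<Rightarrow> real"
  assumes L_pos: "0 < L" and nu_pos: "0 < \<nu>" and T_pos: "0 < T"
    and basis: "eigenbasis L \<zeta> lam"
    and prob: "prob_space M"
    and filt: "filtration (space M) F" and sub: "\<forall>t. subalgebra M (F t)"
    and BM: "indep_BMs M F T b"
    and q_pos: "\<forall>j. 0 < q j"
    and K0: "summable (\<lambda>j. lam j * q j)"
  shows
    "(\<forall>u0. Vsp L u0 \<longrightarrow>
        (\<forall>\<alpha>. 0 < \<alpha> \<and> \<alpha> < \<nu> / (\<Sum>j. q j) \<longrightarrow>
           (\<exists>C1::real. \<exists>N0. \<forall>N\<ge>N0. \<forall>u. euler_scheme L \<nu> T N M F b q \<zeta> lam (\<lambda>_. u0) u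
               \<longrightarrow> expmom1 L \<zeta> lam M N u \<alpha> \<le> ennreal C1))
      \<and> (\<forall>\<beta>. 0 < \<beta> \<and> \<beta> < (\<nu> / (\<Sum>j. q j)) / 2 \<longrightarrow>
           (\<exists>C2::real. \<exists>N0. \<forall>N\<ge>N0. \<forall>u. euler_scheme L \<nu> T N M F b q \<zeta> lam (\<lambda>_. u0) u
               \<longrightarrow> expmom2 L \<nu> T \<zeta> lam M N u \<beta> \<le> ennreal C2)))
   \<and>
    (\<forall>u0 \<gamma>0. 0 < \<gamma>0 \<and> (\<forall>\<omega>\<in>space M. Vsp L (u0 \<omega>)) \<and> Hmeas L (F 0) u0
        \<and> (\<integral>\<^sup>+\<omega>. ennreal (exp (\<gamma>0 * a12sq L \<zeta> lam (u0 \<omega>))) \<partial>M) < \<infinity> \<longrightarrow>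
        (let a0 = \<nu> / (\<Sum>j. q j) in
        (\<forall>\<alpha>. 0 < \<alpha> \<and> \<alpha> < a0 * (\<gamma>0 / (\<gamma>0 + a0)) \<longrightarrow>
           (\<exists>C1::real. \<exists>N0. \<forall>N\<ge>N0. \<forall>u. euler_scheme L \<nu> T N M F b q \<zeta> lam u0 u
               \<longrightarrow> expmom1 L \<zeta> lam M N u \<alpha> \<le> ennreal C1))
      \<and> (\<forall>\<beta>. 0 < \<beta> \<and> \<beta> < a0 * (\<gamma>0 / (2 * \<gamma>0 + a0)) \<longrightarrow>
           (\<exists>C2::real. \<exists>N0. \<forall>N\<ge>N0. \<forall>u. euler_scheme L \<nu> T N M F b q \<zeta> lam u0 u
               \<longrightarrow> expmom2 L \<nu> T \<zeta> lam M N u \<beta> \<le> ennreal C2))))"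
proof -
  interpret P: prob_space M by (rule prob)
  interpret S: stochastic_euler L \<zeta> lam M \<nu> T F b q
    by unfold_locales (rule L_pos basis nu_pos T_pos filtration.space_F[OF filt] filtration.sets_F_mono[OF filt]
      BM K0 sub[rule_format] q_pos[rule_format] | assumption)+
  define a0 where "a0 = \<nu> / (\<Sum>j. q j)"
  have a0: "0 < a0" using nu_pos S.Tr_pos by (simp add: a0_def S.Tr_def)
  \<comment> \<open>For \<theta> = 1 half of the dissipation is spent on the sum of the |Au|^2,
    which doubles the first term of the condition.\<close>
  have Tr: "\<alpha> * (2 * S.Tr) / ((2 - 0) * \<nu>) = \<alpha> / a0" "\<alpha> * (2 * S.Tr) / ((2 - 1) * \<nu>) = 2 * \<alpha> / a0" for \<alpha>
    by (simp_all add: a0_def S.Tr_def)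
  have m1: "\<exists>C1::real. \<exists>N0. \<forall>N\<ge>N0. \<forall>u. euler_scheme L \<nu> T N M F b q \<zeta> lam u0 u \<longrightarrow> expmom1 L \<zeta> lam M N u \<alpha> \<le> ennreal C1"
    if "0 < \<alpha>" "0 < \<gamma>" "\<alpha> / a0 + \<alpha> / \<gamma> < 1" "\<And>\<omega>. \<omega> \<in> space M \<Longrightarrow> Vsp L (u0 \<omega>)" "Hmeas L (F 0) u0"
      "(\<integral>\<^sup>+\<omega>. ennreal (exp (\<gamma> * a12sq L \<zeta> lam (u0 \<omega>))) \<partial>M) < \<infinity>" for \<alpha> \<gamma> u0
    using S.exp_moment_scheme[of 0 \<alpha> \<gamma> u0] that unfolding Tr expmom1_def by simp
  have m2: "\<exists>C2::real. \<exists>N0. \<forall>N\<ge>N0. \<forall>u. euler_scheme L \<nu> T N M F b q \<zeta> lam u0 u \<longrightarrow> expmom2 L \<nu> T \<zeta> lam M N u \<beta> \<le> ennreal C2"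
    if "0 < \<beta>" "0 < \<gamma>" "2 * \<beta> / a0 + \<beta> / \<gamma> < 1" "\<And>\<omega>. \<omega> \<in> space M \<Longrightarrow> Vsp L (u0 \<omega>)" "Hmeas L (F 0) u0"
      "(\<integral>\<^sup>+\<omega>. ennreal (exp (\<gamma> * a12sq L \<zeta> lam (u0 \<omega>))) \<partial>M) < \<infinity>" for \<beta> \<gamma> u0
    using S.exp_moment_scheme[of 1 \<beta> \<gamma> u0] that unfolding Tr expmom2_def by simp
  \<comment> \<open>A deterministic initial value has exponential moments of every order, so
    \<gamma> may be taken so large that x/\<gamma> uses only half of the margin.\<close>
  have big: "\<exists>\<gamma>>0. k * x / a0 + x / \<gamma> < 1" if "0 < x" "k * x / a0 < 1" for k x
  proof (intro exI conjI)
    define \<eta> where "\<eta> = 1 - k * x / a0"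
    have "0 < \<eta>" using that by (simp add: \<eta>_def)
    then show "0 < 2 * x / \<eta>" using that by simp
    have "x / (2 * x / \<eta>) = \<eta> / 2" using that by simp
    moreover have "k * x / a0 = 1 - \<eta>" by (simp add: \<eta>_def)
    ultimately show "k * x / a0 + x / (2 * x / \<eta>) < 1" using \<open>0 < \<eta>\<close> by linarith
  qed
  have const: "Hmeas L (F 0) (\<lambda>_. v)" "(\<integral>\<^sup>+\<omega>. ennreal (exp (\<gamma> * a12sq L \<zeta> lam v)) \<partial>M) < \<infinity>" for v \<gamma>
    by (simp_all add: Hmeas_def P.emeasure_space_1)
  show ?thesis unfolding Let_def a0_def[symmetric]
  proof (intro conjI allI impI; (elim conjE)?)
    fix u0 \<alpha> assume "Vsp L u0" "0 < \<alpha>" "\<alpha> < a0"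
    moreover from this obtain \<gamma> where "0 < \<gamma>" "1 * \<alpha> / a0 + \<alpha> / \<gamma> < 1" using big[of \<alpha> 1] a0 by auto
    ultimately show "\<exists>C1::real. \<exists>N0. \<forall>N\<ge>N0. \<forall>u. euler_scheme L \<nu> T N M F b q \<zeta> lam (\<lambda>_. u0) u \<longrightarrow> expmom1 L \<zeta> lam M N u \<alpha> \<le> ennreal C1"
      by (intro m1[of \<alpha> \<gamma>] const) simp_all
  next
    fix u0 \<beta> assume "Vsp L u0" "0 < \<beta>" "\<beta> < a0 / 2"
    moreover from this obtain \<gamma> where "0 < \<gamma>" "2 * \<beta> / a0 + \<beta> / \<gamma> < 1" using big[of \<beta> 2] a0 by auto
    ultimately show "\<exists>C2::real. \<exists>N0. \<forall>N\<ge>N0. \<forall>u. euler_scheme L \<nu> T N M F b q \<zeta> lam (\<lambda>_. u0) u \<longrightarrow> expmom2 L \<nu> T \<zeta> lam M N u \<beta> \<le> ennreal C2"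
      by (intro m2[of \<beta> \<gamma>] const) simp_all
  next
    fix u0 \<gamma>0 \<alpha>
    assume *: "0 < \<gamma>0" "\<forall>\<omega>\<in>space M. Vsp L (u0 \<omega>)" "Hmeas L (F 0) u0"
      "(\<integral>\<^sup>+\<omega>. ennreal (exp (\<gamma>0 * a12sq L \<zeta> lam (u0 \<omega>))) \<partial>M) < \<infinity>" "0 < \<alpha>" "\<alpha> < a0 * (\<gamma>0 / (\<gamma>0 + a0))"
    \<comment> \<open>Clearing denominators shows that the threshold is the condition \<alpha>/a0 +
      \<alpha>/\<gamma>0 < 1.\<close>
    have "\<alpha> * (\<gamma>0 + a0) < a0 * \<gamma>0" using *(1,6) a0 by (simp add: pos_less_divide_eq)
    then have "\<alpha> / a0 + \<alpha> / \<gamma>0 < 1" using *(1) a0 by (simp add: field_simps)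
    with * show "\<exists>C1::real. \<exists>N0. \<forall>N\<ge>N0. \<forall>u. euler_scheme L \<nu> T N M F b q \<zeta> lam u0 u \<longrightarrow> expmom1 L \<zeta> lam M N u \<alpha> \<le> ennreal C1"
      by (intro m1[of \<alpha> \<gamma>0]) simp_all
  next
    fix u0 \<gamma>0 \<beta>
    assume *: "0 < \<gamma>0" "\<forall>\<omega>\<in>space M. Vsp L (u0 \<omega>)" "Hmeas L (F 0) u0"
      "(\<integral>\<^sup>+\<omega>. ennreal (exp (\<gamma>0 * a12sq L \<zeta> lam (u0 \<omega>))) \<partial>M) < \<infinity>" "0 < \<beta>" "\<beta> < a0 * (\<gamma>0 / (2 * \<gamma>0 + a0))"
    have "\<beta> * (2 * \<gamma>0 + a0) < a0 * \<gamma>0" using *(1,6) a0 by (simp add: pos_less_divide_eq)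
    then have "2 * \<beta> / a0 + \<beta> / \<gamma>0 < 1" using *(1) a0 by (simp add: field_simps)
    with * show "\<exists>C2::real. \<exists>N0. \<forall>N\<ge>N0. \<forall>u. euler_scheme L \<nu> T N M F b q \<zeta> lam u0 u \<longrightarrow> expmom2 L \<nu> T \<zeta> lam M N u \<beta> \<le> ennreal C2"
      by (intro m2[of \<beta> \<gamma>0]) simp_all
  qed
qed

end
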